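(* Assume that for every point $(x_0,p_0,p_0')\in U$ the Cauchy problem $u^A_\alpha=F^A_\alpha(x^i,u^B,u^B_\Gamma)$, $u^A(x^\Lambda,x_0^\alpha)=a^A(x^\Lambda)$ is approximately solvable for every initial data at $(x_0,p_0,p_0')$. Let $l\ge k$, let $z_0=((x^i)_0,(p^A)_0,(p^A_i)_0)$ with $((x^i)_0,(p^A)_0,(p^A_\Lambda)_0)\in U$ and $(p^A_\alpha)_0=F^A_\alpha((x^i)_0,(p^B)_0,(p^B_\Lambda)_0)$, and let $E_0\subset T_{z_0}\mathbb{R}^{n+m+nm}$ be an $l$-dimensional integral element of $\mathcal{I}$ having a basis of the form $\frac{\partial}{\partial x^a}+(c^A_a)_0\frac{\partial}{\partial p^A}+(c^A_{aj})_0\frac{\partial}{\partial p^A_j}$, $a=1,\dots,l$. Then every $l$-dimensional integral element $E\subset T_z\mathbb{R}^{n+m+nm}$ of $\mathcal{I}$ with $(z,E)$ sufficiently close to $(z_0,E_0)$ in $X_l$ is Kähler regular.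
   Context: Let $1\le k<n$, $m\ge1$; indices $i,j\in\{1,\dots,n\}$, $\Lambda,\Gamma\in\{1,\dots,k\}$, $\alpha\in\{k+1,\dots,n\}$, $A,B\in\{1,\dots,m\}$, $a,a'\in\{1,\dots,l\}$, $b\in\{l+1,\dots,n\}$; repeated upper/lower indices summed. $F^A_\alpha(x^i,p^B,p^B_\Lambda)$ real-valued real-analytic on open $U\subset\mathbb{R}^n\times\mathbb{R}^m\times\mathbb{R}^{mk}$. Approximate solvability for every initial data at $(x_0,p_0,p_0')$: for every real-analytic $a^A$ near $(x_0^\Lambda)$ with $a^A(x_0^\Gamma)=p^A_0$, $a^A_\Lambda(x_0^\Gamma)=(p_0')^A_\Lambda$, there is a real-analytic $u$ near $x_0$ with $u^A_\alpha-F^A_\alpha(x^i,u^B,u^B_\Gamma)=O(|x-x_0|^2)$ and $u^A(x^1,\dots,x^k,x_0^{k+1},\dots,x_0^n)-a^A(x^\Lambda)=O(|x^\Lambda-x_0^\Lambda|^3)$. On $\mathbb{R}^n\times\mathbb{R}^m\times\mathbb{R}^{nm}$ with coordinates $z=(x^i,p^A,p^A_i)$, $\mathcal{I}$ is the exterior differential system generated by $f^A_\alpha:=p^A_\alpha-F^A_\alpha(x^i,p^B,p^B_\Gamma)$ and $\eta^A:=dp^A-p^A_idx^i$; set $\Omega^A:=dp^A_i\wedge dx^i$. An integral element at $z$ is a linear subspace of $T_z\mathbb{R}^{n+m+nm}$ on which all forms of $\mathcal{I}$ vanish (functions vanish at $z$); for an $l$-dimensional integral element $E$ with basis $e_1,\dots,e_l$,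 $H(E):=\{v:\phi(v,e_1,\dots,e_l)=0$ for all $(l+1)$-forms $\phi\in\mathcal{I}\}$. $X_l$ is the Grassmann bundle of pairs $(z,E)$ with $E$ an $l$-dimensional subspace of $T_z\mathbb{R}^{n+m+nm}$. Near $(z_0,E_0)$, each $(z,E)$ has a unique basis $\tilde e_a=\frac{\partial}{\partial x^a}+c^b_a\frac{\partial}{\partial x^b}+c^A_a\frac{\partial}{\partial p^A}+c^A_{aj}\frac{\partial}{\partial p^A_j}$, and $(z,c^b_a,c^A_a,c^A_{aj})$ are local coordinates on $X_l$. Let $\mathcal{F}$ be the family of real-analytic functions of $(z,E)$ consisting of $f^A_\alpha$, $\eta^A(\tilde e_a)$, $(df^A_\alpha)(\tilde e_a)$, $\Omega^A(\tilde e_a,\tilde e_{a'})$. A point $t_0$ is an ordinary zero of a family $\mathcal{F}$ of germs of real-analytic functions vanishing at $t_0$ if there are $f_1,\dots,f_\kappa\in\mathcal{F}$ with linearly independent differentials at $t_0$ such that the germ at $t_0$ of the common zero set of $\mathcal{F}$ equals that of $\{f_1=\dots=f_\kappa=0\}$. An $l$-dimensional integral element $E$ at $z$ (with $(z,E)$ in this chart) is Kähler ordinary if $(z,E)$ is an ordinary zero of $\mathcal{F}$, and Kähler regular if it is Kähler ordinary and $\dim H(E')$ is constant for all $l$-dimensional integral elements $E'$ at $z'$ with $(z',E')$ sufficiently close to $(z,E)$. *)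

theory Defs
  imports "HOL-Analysis.Analysis"
begin

text \<open>Conventions: all indices are 0-based.  i,j range over {0..<n}, Lambda,Gamma over {0..<k},
  alpha over {k..<n}, A,B over {0..<m}, a,a' over {0..<l}, b over {l..<n}.\<close>

definition supp_on :: "'i set \<Rightarrow> ('i \<Rightarrow> real) \<Rightarrow> bool" where
  "supp_on C y \<longleftrightarrow> (\<forall>i. i \<notin> C \<longrightarrow> y i = 0)"

definition box_nbhd :: "'i set \<Rightarrow> ('i \<Rightarrow> real) \<Rightarrow> real \<Rightarrow> ('i \<Rightarrow> real) set" where
  "box_nbhd C x e = {y. supp_on C y \<and> (\<forall>i\<in>C. \<bar>y i - x i\<bar> < e)}"

definition open_coords :: "'i set \<Rightarrow> ('i \<Rightarrow> real) set \<Rightarrow> bool" where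
  "open_coords C U \<longleftrightarrow> (\<forall>w\<in>U. supp_on C w \<and> (\<exists>e>0. box_nbhd C w e \<subseteq> U))"

definition analytic_at :: "'i set \<Rightarrow> (('i \<Rightarrow> real) \<Rightarrow> real) \<Rightarrow> ('i \<Rightarrow> real) \<Rightarrow> bool" where
  "analytic_at C g x \<longleftrightarrow>
     (\<exists>c :: ('i \<Rightarrow> nat) \<Rightarrow> real. \<exists>e>0. \<forall>y\<in>box_nbhd C x e.
        ((\<lambda>\<alpha>. c \<alpha> * (\<Prod>i\<in>C. (y i - x i) ^ \<alpha> i)) has_sum g y) {\<alpha>. \<forall>i. i \<notin> C \<longrightarrow> \<alpha> i = 0})"

definition partial :: "'i \<Rightarrow> (('i \<Rightarrow> real) \<Rightarrow> real) \<Rightarrow> ('i \<Rightarrow> real) \<Rightarrow> real" where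
  "partial c g x = deriv (\<lambda>s. g (x(c := x c + s))) 0"

definition sqdist :: "'i set \<Rightarrow> ('i \<Rightarrow> real) \<Rightarrow> ('i \<Rightarrow> real) \<Rightarrow> real" where
  "sqdist C x y = (\<Sum>i\<in>C. (x i - y i)\<^sup>2)"

definition lin_indep_set :: "('i \<Rightarrow> real) set \<Rightarrow> bool" where
  "lin_indep_set S \<longleftrightarrow> finite S \<and>
     (\<forall>\<mu>. (\<forall>c. (\<Sum>v\<in>S. \<mu> v * v c) = 0) \<longrightarrow> (\<forall>v\<in>S. \<mu> v = 0))"

definition vdim :: "('i \<Rightarrow> real) set \<Rightarrow> nat" where
  "vdim V = (GREATEST d. \<exists>S\<subseteq>V. lin_indep_set S \<and> card S = d)"

definition lin_subspace :: "('i \<Rightarrow> real) set \<Rightarrow> bool" where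
  "lin_subspace E \<longleftrightarrow> (\<lambda>c. 0) \<in> E \<and> (\<forall>v\<in>E. \<forall>w\<in>E. (\<lambda>c. v c + w c) \<in> E)
      \<and> (\<forall>r. \<forall>v\<in>E. (\<lambda>c. r * v c) \<in> E)"

datatype coord = CX nat | CP nat | CQ nat nat  \<comment> \<open>CQ A i is p^A_i\<close>

definition Zc :: "nat \<Rightarrow> nat \<Rightarrow> coord set" where
  "Zc n m = {CX i | i. i < n} \<union> {CP A | A. A < m} \<union> {CQ A i | A i. A < m \<and> i < n}"

definition Dset :: "nat \<Rightarrow> nat \<Rightarrow> nat \<Rightarrow> coord set" where
  "Dset n k m = {CX i | i. i < n} \<union> {CP A | A. A < m} \<union> {CQ A L | A L. A < m \<and> L < k}"

definition projD :: "nat \<Rightarrow> nat \<Rightarrow> nat \<Rightarrow> (coord \<Rightarrow> real) \<Rightarrow> (coord \<Rightarrow> real)" where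
  "projD n k m z = (\<lambda>c. if c \<in> Dset n k m then z c else 0)"

text \<open>F A alpha w stands for F^A_alpha evaluated at the point w = (x^i,p^B,p^B_Lambda).\<close>
type_synonym rhs = "nat \<Rightarrow> nat \<Rightarrow> (coord \<Rightarrow> real) \<Rightarrow> real"

definition jetpt :: "nat \<Rightarrow> nat \<Rightarrow> nat \<Rightarrow> (nat \<Rightarrow> (nat \<Rightarrow> real) \<Rightarrow> real) \<Rightarrow> (nat \<Rightarrow> real) \<Rightarrow> (coord \<Rightarrow> real)" where
  "jetpt n k m u x = (\<lambda>c. case c of
       CX i \<Rightarrow> (if i < n then x i else 0)
     | CP B \<Rightarrow> (if B < m then u B x else 0)
     | CQ B G \<Rightarrow> (if B < m \<and> G < k then partial G (u B) x else 0))"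

definition approx_solvable :: "nat \<Rightarrow> nat \<Rightarrow> nat \<Rightarrow> rhs \<Rightarrow> (coord \<Rightarrow> real) \<Rightarrow> bool" where
  "approx_solvable n k m F w0 \<longleftrightarrow>
    (let x0 = (\<lambda>i. if i < n then w0 (CX i) else 0);
         x0k = (\<lambda>i. if i < k then w0 (CX i) else 0)
     in \<forall>a :: nat \<Rightarrow> (nat \<Rightarrow> real) \<Rightarrow> real.
        (\<forall>A<m. analytic_at {..<k} (a A) x0k \<and> a A x0k = w0 (CP A)
               \<and> (\<forall>L<k. partial L (a A) x0k = w0 (CQ A L))) \<longrightarrow>
        (\<exists>u :: nat \<Rightarrow> (nat \<Rightarrow> real) \<Rightarrow> real.
           (\<forall>A<m. analytic_at {..<n} (u A) x0) \<and>
           (\<exists>K d. d > 0 \<and> (\<forall>x\<in>box_nbhd {..<n} x0 d. \<forall>A<m. \<forall>\<alpha>\<in>{k..<n}.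
               \<bar>partial \<alpha> (u A) x - F A \<alpha> (jetpt n k m u x)\<bar> \<le> K * sqdist {..<n} x x0)) \<and>
           (\<exists>K d. d > 0 \<and> (\<forall>y\<in>box_nbhd {..<k} x0k d. \<forall>A<m.
               \<bar>u A (\<lambda>i. if i < k then y i else x0 i) - a A y\<bar> \<le> K * (sqrt (sqdist {..<k} y x0k)) ^ 3))))"

definition fA :: "nat \<Rightarrow> nat \<Rightarrow> nat \<Rightarrow> rhs \<Rightarrow> nat \<Rightarrow> nat \<Rightarrow> (coord \<Rightarrow> real) \<Rightarrow> real" where
  "fA n k m F A \<alpha> z = z (CQ A \<alpha>) - F A \<alpha> (projD n k m z)"

definition eta :: "nat \<Rightarrow> nat \<Rightarrow> (coord \<Rightarrow> real) \<Rightarrow> (coord \<Rightarrow> real) \<Rightarrow> real" where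
  "eta n A z v = v (CP A) - (\<Sum>i<n. z (CQ A i) * v (CX i))"

definition dfA :: "nat \<Rightarrow> nat \<Rightarrow> nat \<Rightarrow> rhs \<Rightarrow> nat \<Rightarrow> nat \<Rightarrow> (coord \<Rightarrow> real) \<Rightarrow> (coord \<Rightarrow> real) \<Rightarrow> real" where
  "dfA n k m F A \<alpha> z v = v (CQ A \<alpha>)
     - (\<Sum>c\<in>Dset n k m. partial c (F A \<alpha>) (projD n k m z) * v c)"

text \<open>Omega^A = dp^A_i wedge dx^i applied to (v,w).\<close>
definition Omega :: "nat \<Rightarrow> nat \<Rightarrow> (coord \<Rightarrow> real) \<Rightarrow> (coord \<Rightarrow> real) \<Rightarrow> real" where
  "Omega n A v w = (\<Sum>i<n. v (CQ A i) * w (CX i) - w (CQ A i) * v (CX i))"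

text \<open>Integral elements of I (the differential ideal generated by f^A_alpha and eta^A, which is
  algebraically generated by f^A_alpha, eta^A, d f^A_alpha and d eta^A = - Omega^A).
  The system lives over the domain of the f^A_alpha, i.e. where (x,p,p_Lambda) lies in U.\<close>
definition integral_element :: "nat \<Rightarrow> nat \<Rightarrow> nat \<Rightarrow> rhs \<Rightarrow> (coord \<Rightarrow> real) set
    \<Rightarrow> (coord \<Rightarrow> real) \<Rightarrow> (coord \<Rightarrow> real) set \<Rightarrow> bool" where
  "integral_element n k m F U z E \<longleftrightarrow>
     supp_on (Zc n m) z \<and> projD n k m z \<in> U \<and>
     lin_subspace E \<and> (\<forall>v\<in>E. supp_on (Zc n m) v) \<and>
     (\<forall>A<m. \<forall>\<alpha>\<in>{k..<n}. fA n k m F A \<alpha> z = 0) \<and>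
     (\<forall>v\<in>E. \<forall>A<m. eta n A z v = 0 \<and> (\<forall>\<alpha>\<in>{k..<n}. dfA n k m F A \<alpha> z v = 0)) \<and>
     (\<forall>v\<in>E. \<forall>w\<in>E. \<forall>A<m. Omega n A v w = 0)"

text \<open>Polar space H(E): vectors v with phi(v,e_1,...,e_l) = 0 for all (l+1)-forms phi of I,
  written out for the generators.\<close>
definition Hpolar :: "nat \<Rightarrow> nat \<Rightarrow> nat \<Rightarrow> rhs \<Rightarrow> (coord \<Rightarrow> real) \<Rightarrow> (coord \<Rightarrow> real) set
    \<Rightarrow> (coord \<Rightarrow> real) set" where
  "Hpolar n k m F z E = {v. supp_on (Zc n m) v \<and>
     (\<forall>A<m. eta n A z v = 0 \<and> (\<forall>\<alpha>\<in>{k..<n}. dfA n k m F A \<alpha> z v = 0)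
            \<and> (\<forall>w\<in>E. Omega n A v w = 0))}"

datatype xcoord = ZZ coord | Cb nat nat | Cp nat nat | Cq nat nat nat
  \<comment> \<open>Cb b a = c^b_a, Cp A a = c^A_a, Cq A a j = c^A_{aj}\<close>

definition chartC :: "nat \<Rightarrow> nat \<Rightarrow> nat \<Rightarrow> xcoord set" where
  "chartC n m l = ZZ ` Zc n m \<union> {Cb b a | b a. l \<le> b \<and> b < n \<and> a < l}
     \<union> {Cp A a | A a. A < m \<and> a < l} \<union> {Cq A a j | A a j. A < m \<and> a < l \<and> j < n}"

definition zpart :: "(xcoord \<Rightarrow> real) \<Rightarrow> (coord \<Rightarrow> real)" where
  "zpart t = (\<lambda>c. t (ZZ c))"

definition ebasis :: "nat \<Rightarrow> nat \<Rightarrow> (xcoord \<Rightarrow> real) \<Rightarrow> nat \<Rightarrow> (coord \<Rightarrow> real)" where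
  "ebasis n l t a = (\<lambda>c. case c of
       CX i \<Rightarrow> (if i = a then 1 else if l \<le> i \<and> i < n then t (Cb i a) else 0)
     | CP A \<Rightarrow> t (Cp A a)
     | CQ A j \<Rightarrow> t (Cq A a j))"

definition Espan :: "nat \<Rightarrow> nat \<Rightarrow> (xcoord \<Rightarrow> real) \<Rightarrow> (coord \<Rightarrow> real) set" where
  "Espan n l t = {v. \<exists>\<mu>. v = (\<lambda>c. \<Sum>a<l. \<mu> a * ebasis n l t a c)}"

definition Fam :: "nat \<Rightarrow> nat \<Rightarrow> nat \<Rightarrow> nat \<Rightarrow> rhs \<Rightarrow> ((xcoord \<Rightarrow> real) \<Rightarrow> real) set" where
  "Fam n k m l F =
      {(\<lambda>t. fA n k m F A \<alpha> (zpart t)) | A \<alpha>. A < m \<and> k \<le> \<alpha> \<and> \<alpha> < n}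
    \<union> {(\<lambda>t. eta n A (zpart t) (ebasis n l t a)) | A a. A < m \<and> a < l}
    \<union> {(\<lambda>t. dfA n k m F A \<alpha> (zpart t) (ebasis n l t a)) | A \<alpha> a. A < m \<and> k \<le> \<alpha> \<and> \<alpha> < n \<and> a < l}
    \<union> {(\<lambda>t. Omega n A (ebasis n l t a) (ebasis n l t a')) | A a a'. A < m \<and> a < l \<and> a' < l}"

definition ordinary_zero :: "'i set \<Rightarrow> (('i \<Rightarrow> real) \<Rightarrow> real) set \<Rightarrow> ('i \<Rightarrow> real) \<Rightarrow> bool" where
  "ordinary_zero C \<F> t0 \<longleftrightarrow> (\<forall>g\<in>\<F>. g t0 = 0) \<and>
     (\<exists>gs. set gs \<subseteq> \<F> \<and>
        (\<forall>\<mu>. (\<forall>c\<in>C. (\<Sum>j<length gs. \<mu> j * partial c (gs ! j) t0) = 0) \<longrightarrow> (\<forall>j<length gs. \<mu> j = 0)) \<and>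
        (\<exists>e>0. \<forall>t\<in>box_nbhd C t0 e. (\<forall>g\<in>\<F>. g t = 0) \<longleftrightarrow> (\<forall>g\<in>set gs. g t = 0)))"

definition kahler_ordinary :: "nat \<Rightarrow> nat \<Rightarrow> nat \<Rightarrow> nat \<Rightarrow> rhs \<Rightarrow> (coord \<Rightarrow> real) set \<Rightarrow> (xcoord \<Rightarrow> real) \<Rightarrow> bool" where
  "kahler_ordinary n k m l F U t \<longleftrightarrow>
     integral_element n k m F U (zpart t) (Espan n l t) \<and> ordinary_zero (chartC n m l) (Fam n k m l F) t"

definition kahler_regular :: "nat \<Rightarrow> nat \<Rightarrow> nat \<Rightarrow> nat \<Rightarrow> rhs \<Rightarrow> (coord \<Rightarrow> real) set \<Rightarrow> (xcoord \<Rightarrow> real) \<Rightarrow> bool" where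
  "kahler_regular n k m l F U t \<longleftrightarrow> kahler_ordinary n k m l F U t \<and>
     (\<exists>e>0. \<forall>t'\<in>box_nbhd (chartC n m l) t e.
        integral_element n k m F U (zpart t') (Espan n l t') \<longrightarrow>
        vdim (Hpolar n k m F (zpart t') (Espan n l t')) = vdim (Hpolar n k m F (zpart t) (Espan n l t)))"

end

theory Submission
  imports Defs
begin

text \<open>Differentiating the approximate solutions at a point shows that every symmetric matrix of second
  derivatives \<open>q\<^sup>A\<^sub>\<Lambda>\<^sub>\<Gamma>\<close> extends to a symmetric 2-jet compatible with the first prolongation of the
  equations, that is, to an integral element \<open>E\<^sub>q\<close> of dimension \<open>n\<close>.  If the coordinates \<open>c\<^sup>b\<^sub>a\<close> of an
  \<open>l\<close>-dimensional element are small, then the equations \<open>f = 0\<close>, \<open>\<eta>(e\<^sub>a) = 0\<close>, \<open>df(e\<^sub>a) = 0\<close> and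
  \<open>\<Omega>(e\<^sub>\<Lambda>, e\<^sub>a) = 0\<close> with \<open>\<Lambda> < k\<close> force \<open>e\<^sub>\<Lambda> \<in> E\<^sub>q\<close> for some \<open>q\<close>, and a vector annihilated by \<open>\<eta>\<close>, \<open>df\<close>
  and all \<open>\<Omega>(\<cdot>, e\<^sub>\<Lambda>)\<close> is determined by its \<open>x\<close>-part, so it lies in \<open>E\<^sub>q\<close> too.  Hence the remaining
  equations \<open>\<Omega>(e\<^sub>a, e\<^sub>a\<^sub>') = 0\<close> are redundant, the differentials of the chosen ones are independent, and
  \<open>H(E) = E\<^sub>q\<close> always has dimension \<open>n\<close>.\<close>

section \<open>Multivariate power series\<close>

text \<open>The hypothesis bounds the errors of an approximate solution only pointwise, with no
  control of their derivatives, while the argument needs exact identities between second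
  derivatives. Analyticity bridges the gap: difference quotients with explicit quadratic remainders
  turn the pointwise bounds into equalities of jets. For vanishing c^b_a the entries
  c^A_{\<Lambda>\<Gamma>} of \<open>e\<^sub>\<Lambda>\<close> are the wanted \<open>q\<close>
  themselves. In general \<open>e\<^sub>\<Lambda>\<close> also involves the vectors of
  \<open>E\<^sub>q\<close> in the directions b, whose components depend affinely on
  \<open>q\<close>, and a symmetric \<open>q\<close> has to solve an overdetermined system. Giving
  up symmetry makes the system square, of the form (1 + M) x = r with M small; that x is symmetric
  is shown afterwards. The same M decides existence of \<open>E\<^sub>q\<close>, uniqueness of polar
  vectors and, transposed, independence of the differentials, so both its row sums and its column
  sums are kept small. Solvability has to be available over every nearby base point, because an
  ordinary zero compares the zero sets in a whole neighbourhood.\<close>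

definition multi_idx :: "'i set \<Rightarrow> ('i \<Rightarrow> nat) set" where
  "multi_idx C = {\<alpha>. \<forall>i. i \<notin> C \<longrightarrow> \<alpha> i = 0}"

definition monom_at :: "'i set \<Rightarrow> ('i \<Rightarrow> real) \<Rightarrow> ('i \<Rightarrow> nat) \<Rightarrow> real" where
  "monom_at C h \<alpha> = (\<Prod>i\<in>C. h i ^ \<alpha> i)"

definition mdeg :: "'i set \<Rightarrow> ('i \<Rightarrow> nat) \<Rightarrow> nat" where
  "mdeg C \<alpha> = (\<Sum>i\<in>C. \<alpha> i)"

definition unit_idx :: "'i \<Rightarrow> 'i \<Rightarrow> nat" where
  "unit_idx i = (\<lambda>_. 0)(i := 1)"

text \<open>Absolute convergence at the corner of the box is made part of the data: the sum of this
  dominating series is the constant in all remainder estimates.\<close>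

definition power_series_at ::
  "'i set \<Rightarrow> (('i \<Rightarrow> nat) \<Rightarrow> real) \<Rightarrow> real \<Rightarrow> (('i \<Rightarrow> real) \<Rightarrow> real) \<Rightarrow> ('i \<Rightarrow> real) \<Rightarrow> bool" where
  "power_series_at C c r g x \<longleftrightarrow> r > 0 \<and> (\<lambda>\<alpha>. \<bar>c \<alpha>\<bar> * r ^ mdeg C \<alpha>) summable_on multi_idx C \<and>
     (\<forall>y\<in>box_nbhd C x r. ((\<lambda>\<alpha>. c \<alpha> * monom_at C (\<lambda>i. y i - x i) \<alpha>) has_sum g y) (multi_idx C))"

lemma monom_at_const: "monom_at C (\<lambda>i. r) \<alpha> = r ^ mdeg C \<alpha>"
  by (simp add: monom_at_def mdeg_def power_sum)

lemma abs_monom_at_le: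
  assumes "\<And>i. i \<in> C \<Longrightarrow> \<bar>h i\<bar> \<le> r"
  shows "\<bar>monom_at C h \<alpha>\<bar> \<le> r ^ mdeg C \<alpha>"
proof -
  have "\<bar>monom_at C h \<alpha>\<bar> = (\<Prod>i\<in>C. \<bar>h i\<bar> ^ \<alpha> i)"
    by (simp add: monom_at_def abs_prod power_abs)
  also have "\<dots> \<le> (\<Prod>i\<in>C. r ^ \<alpha> i)"
    by (intro prod_mono) (auto intro!: power_mono assms)
  also have "\<dots> = r ^ mdeg C \<alpha>" using monom_at_const[of C r \<alpha>] by (simp add: monom_at_def)
  finally show ?thesis .
qed

lemma box_nbhd_mono: "e \<le> e' \<Longrightarrow> box_nbhd C x e \<subseteq> box_nbhd C x e'"
  unfolding box_nbhd_def by fastforce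

lemma box_nbhd_center: "supp_on C x \<Longrightarrow> 0 < e \<Longrightarrow> x \<in> box_nbhd C x e"
  by (simp add: box_nbhd_def)

lemma box_nbhd_upd:
  assumes "x \<in> box_nbhd C x0 e" "i \<in> C" "\<bar>x i + s - x0 i\<bar> < e"
  shows "x(i := x i + s) \<in> box_nbhd C x0 e"
  using assms by (auto simp: box_nbhd_def supp_on_def)

text \<open>At the corner of a smaller box, where every increment equals \<open>r\<close>, the
  monomials become \<open>r ^ mdeg C \<alpha>\<close>. Unconditional convergence of a real family is
  absolute, which yields the dominating series.\<close>

lemma analytic_at_iff_power_series:
  assumes "finite C"
  shows "analytic_at C g x \<longleftrightarrow> (\<exists>c r. power_series_at C c r g x)"
proof
  assume "analytic_at C g x"
  then obtain c e where e: "e > 0" and hs: "\<And>y. y \<in> box_nbhd C x e \<Longrightarrow>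
     ((\<lambda>\<alpha>. c \<alpha> * (\<Prod>i\<in>C. (y i - x i) ^ \<alpha> i)) has_sum g y) {\<alpha>. \<forall>i. i \<notin> C \<longrightarrow> \<alpha> i = 0}"
    unfolding analytic_at_def by blast
  define r where "r = e / 2"
  have r: "r > 0" "r < e" using e by (auto simp: r_def)
  define y where "y = (\<lambda>i. if i \<in> C then x i + r else 0)"
  have y: "y \<in> box_nbhd C x e" using r by (auto simp: box_nbhd_def supp_on_def y_def)
  have "((\<lambda>\<alpha>. c \<alpha> * r ^ mdeg C \<alpha>) has_sum g y) (multi_idx C)"
    using hs[OF y] by (simp add: multi_idx_def mdeg_def power_sum y_def)
  then have "(\<lambda>\<alpha>. c \<alpha> * r ^ mdeg C \<alpha>) summable_on multi_idx C"
    by (rule has_sum_imp_summable)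
  then have "(\<lambda>\<alpha>. \<bar>c \<alpha> * r ^ mdeg C \<alpha>\<bar>) summable_on multi_idx C"
    using summable_on_iff_abs_summable_on_real by fastforce
  then have "(\<lambda>\<alpha>. \<bar>c \<alpha>\<bar> * r ^ mdeg C \<alpha>) summable_on multi_idx C"
    using r by (simp add: abs_mult)
  then have "power_series_at C c r g x"
    unfolding power_series_at_def using r hs box_nbhd_mono[of r e C x]
    by (auto simp: multi_idx_def monom_at_def)
  then show "\<exists>c r. power_series_at C c r g x" by blast
next
  assume "\<exists>c r. power_series_at C c r g x"
  then show "analytic_at C g x"
    unfolding power_series_at_def analytic_at_def multi_idx_def monom_at_def by blast
qed

lemma has_sum_diff_real:
  fixes f g :: "'a \<Rightarrow> real"
  assumes "(f has_sum a) A" "(g has_sum b) A"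
  shows "((\<lambda>x. f x - g x) has_sum (a - b)) A"
  using has_sum_add[OF assms(1), of "\<lambda>x. - g x" "- b"] assms(2) by (simp add: has_sum_uminus)

lemma has_sum_abs_le:
  fixes f b :: "'a \<Rightarrow> real"
  assumes "(f has_sum s) A" "b summable_on B" "A \<subseteq> B"
    "\<And>x. x \<in> A \<Longrightarrow> \<bar>f x\<bar> \<le> b x" "\<And>x. x \<in> B \<Longrightarrow> 0 \<le> b x"
  shows "\<bar>s\<bar> \<le> infsum b B"
proof -
  have bA: "b summable_on A" using assms(2,3) summable_on_subset_banach by blast
  have "s \<le> infsum b A"
    by (rule has_sum_mono[OF assms(1) has_sum_infsum[OF bA]]) (use assms(4) in force)
  moreover have "- s \<le> infsum b A"
    by (rule has_sum_mono[of "\<lambda>x. - f x", OF _ has_sum_infsum[OF bA]])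
      (use assms(1,4) in \<open>auto simp: has_sum_uminus abs_le_iff\<close>)
  moreover have "infsum b A \<le> infsum b B"
    by (rule infsum_mono2[OF bA assms(2,3)]) (use assms(5) in auto)
  ultimately show ?thesis by linarith
qed

lemma monom_at_unit_idx:
  assumes "finite C" "i \<in> C" shows "monom_at C h (unit_idx i) = h i"
proof -
  have "monom_at C h (unit_idx i) = (\<Prod>j\<in>C. if j = i then h j else 1)"
    unfolding monom_at_def unit_idx_def by (rule prod.cong) auto
  then show ?thesis using assms by simp
qed

lemma mdeg_less_2:
  assumes "finite C" "\<alpha> \<in> multi_idx C" "mdeg C \<alpha> < 2"
  shows "\<alpha> \<in> insert (\<lambda>_. 0) (unit_idx ` C)"
proof (cases "mdeg C \<alpha> = 0")
  case True
  then have "\<forall>i\<in>C. \<alpha> i = 0" using assms(1) by (simp add: mdeg_def)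
  then have "\<alpha> = (\<lambda>_. 0)" using assms(2) by (auto simp: multi_idx_def)
  then show ?thesis by simp
next
  case False
  then have 1: "(\<Sum>i\<in>C. \<alpha> i) = 1" using assms(3) by (simp add: mdeg_def)
  then obtain i where i: "i \<in> C" "\<alpha> i = Suc 0" "\<forall>b\<in>C. i \<noteq> b \<longrightarrow> \<alpha> b = 0"
    using sum_eq_1_iff[OF assms(1), of \<alpha>] by auto
  then have "\<alpha> = unit_idx i" using assms(2) by (intro ext) (auto simp: multi_idx_def unit_idx_def)
  then show ?thesis using i by simp
qed

lemma power_series_bounded:
  assumes "power_series_at C c r g x" "y \<in> box_nbhd C x r"
  shows "\<bar>g y\<bar> \<le> infsum (\<lambda>\<alpha>. \<bar>c \<alpha>\<bar> * r ^ mdeg C \<alpha>) (multi_idx C)"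
proof (rule has_sum_abs_le)
  show "((\<lambda>\<alpha>. c \<alpha> * monom_at C (\<lambda>i. y i - x i) \<alpha>) has_sum g y) (multi_idx C)"
    "(\<lambda>\<alpha>. \<bar>c \<alpha>\<bar> * r ^ mdeg C \<alpha>) summable_on multi_idx C"
    using assms by (auto simp: power_series_at_def)
  fix \<alpha>
  have "\<bar>monom_at C (\<lambda>i. y i - x i) \<alpha>\<bar> \<le> r ^ mdeg C \<alpha>"
    by (rule abs_monom_at_le) (use assms(2) in \<open>auto simp: box_nbhd_def less_imp_le\<close>)
  then show "\<bar>c \<alpha> * monom_at C (\<lambda>i. y i - x i) \<alpha>\<bar> \<le> \<bar>c \<alpha>\<bar> * r ^ mdeg C \<alpha>"
    by (simp add: abs_mult mult_left_mono)
  show "0 \<le> \<bar>c \<alpha>\<bar> * r ^ mdeg C \<alpha>" using assms(1) by (simp add: power_series_at_def)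
qed simp

text \<open>After the constant and linear terms are removed, every remaining monomial has degree at
  least 2: two factors of size \<open>\<rho>\<close> are taken out, and the others are bounded by
  powers of \<open>r\<close>.\<close>

lemma power_series_expansion:
  assumes "finite C" "power_series_at C c r g x" "y \<in> box_nbhd C x r"
  shows "\<bar>g y - c (\<lambda>_. 0) - (\<Sum>i\<in>C. c (unit_idx i) * (y i - x i))\<bar> \<le>
    infsum (\<lambda>\<alpha>. \<bar>c \<alpha>\<bar> * r ^ mdeg C \<alpha>) (multi_idx C) / r\<^sup>2 * (\<Sum>i\<in>C. \<bar>y i - x i\<bar>)\<^sup>2"
proof -
  define h where "h = (\<lambda>i. y i - x i)"
  \<comment> \<open>The sum of all increments bounds each of them; the cap at \<open>r\<close> keeps
    the remaining powers below the dominating series.\<close>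
  define \<rho> where "\<rho> = min r (\<Sum>i\<in>C. \<bar>h i\<bar>)"
  define B where "B = insert (\<lambda>_. 0) (unit_idx ` C)"
  have r: "r > 0" and sb: "(\<lambda>\<alpha>. \<bar>c \<alpha>\<bar> * r ^ mdeg C \<alpha>) summable_on multi_idx C"
    and hs: "((\<lambda>\<alpha>. c \<alpha> * monom_at C h \<alpha>) has_sum g y) (multi_idx C)"
    using assms(2,3) by (auto simp: power_series_at_def h_def)
  have S0: "0 \<le> (\<Sum>i\<in>C. \<bar>h i\<bar>)" by (simp add: sum_nonneg)
  have \<rho>: "0 \<le> \<rho>" "\<rho> \<le> r" "\<And>i. i \<in> C \<Longrightarrow> \<bar>h i\<bar> \<le> \<rho>"
    using r assms(1,3) S0 by (auto simp: \<rho>_def h_def box_nbhd_def less_imp_le intro!: member_le_sum)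
  have BC: "B \<subseteq> multi_idx C" "finite B" using assms(1) by (auto simp: B_def multi_idx_def unit_idx_def)
  have inj: "inj_on unit_idx C"
    by (auto simp: inj_on_def unit_idx_def fun_eq_iff split: if_splits)
  have n0: "(\<lambda>_. 0) \<notin> unit_idx ` C"
    by (auto simp: unit_idx_def fun_eq_iff) (metis Suc_neq_Zero)
  have "(\<Sum>\<alpha>\<in>B. c \<alpha> * monom_at C h \<alpha>) = c (\<lambda>_. 0) + (\<Sum>i\<in>C. c (unit_idx i) * h i)"
    unfolding B_def using assms(1) n0 inj
    by (simp add: sum.reindex monom_at_unit_idx monom_at_def[of C h "\<lambda>_. 0"] cong: sum.cong)
  then have "((\<lambda>\<alpha>. c \<alpha> * monom_at C h \<alpha>) has_sum
      (g y - (c (\<lambda>_. 0) + (\<Sum>i\<in>C. c (unit_idx i) * h i)))) (multi_idx C - B)"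
    using has_sum_Diff[OF hs has_sum_finite[OF BC(2)] BC(1)] by simp
  then have "\<bar>g y - (c (\<lambda>_. 0) + (\<Sum>i\<in>C. c (unit_idx i) * h i))\<bar> \<le>
     infsum (\<lambda>\<alpha>. (\<bar>c \<alpha>\<bar> * r ^ mdeg C \<alpha>) * (\<rho> / r)\<^sup>2) (multi_idx C)"
  proof (rule has_sum_abs_le)
    show "(\<lambda>\<alpha>. (\<bar>c \<alpha>\<bar> * r ^ mdeg C \<alpha>) * (\<rho> / r)\<^sup>2) summable_on multi_idx C"
      using sb by (rule summable_on_cmult_left)
    fix \<alpha> assume "\<alpha> \<in> multi_idx C - B"
    then have d: "2 \<le> mdeg C \<alpha>" using mdeg_less_2[OF assms(1), of \<alpha>] by (auto simp: B_def not_less)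
    have "\<bar>monom_at C h \<alpha>\<bar> \<le> \<rho> ^ mdeg C \<alpha>" by (rule abs_monom_at_le) (use \<rho> in auto)
    also have "\<dots> = \<rho>\<^sup>2 * \<rho> ^ (mdeg C \<alpha> - 2)" using d by (metis le_add_diff_inverse power_add)
    also have "\<dots> \<le> \<rho>\<^sup>2 * r ^ (mdeg C \<alpha> - 2)" by (intro mult_left_mono power_mono) (use \<rho> in auto)
    also have "r ^ (mdeg C \<alpha> - 2) = r ^ mdeg C \<alpha> / r\<^sup>2" using d r by (simp add: power_diff)
    finally have "\<bar>monom_at C h \<alpha>\<bar> \<le> r ^ mdeg C \<alpha> * (\<rho> / r)\<^sup>2"
      by (simp add: power_divide mult.commute)
    then show "\<bar>c \<alpha> * monom_at C h \<alpha>\<bar> \<le> (\<bar>c \<alpha>\<bar> * r ^ mdeg C \<alpha>) * (\<rho> / r)\<^sup>2"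
      by (simp add: abs_mult mult_left_mono mult.assoc)
  qed (use r in auto)
  also have "\<dots> = infsum (\<lambda>\<alpha>. \<bar>c \<alpha>\<bar> * r ^ mdeg C \<alpha>) (multi_idx C) / r\<^sup>2 * \<rho>\<^sup>2"
    by (simp only: infsum_cmult_left') (simp add: power_divide)
  also have "\<dots> \<le> infsum (\<lambda>\<alpha>. \<bar>c \<alpha>\<bar> * r ^ mdeg C \<alpha>) (multi_idx C) / r\<^sup>2 * (\<Sum>i\<in>C. \<bar>h i\<bar>)\<^sup>2"
    by (intro mult_left_mono power_mono divide_nonneg_nonneg infsum_nonneg) (use \<rho> r in \<open>auto simp: \<rho>_def\<close>)
  finally show ?thesis by (simp add: h_def algebra_simps)
qed

lemma power_series_center:
  assumes "finite C" "supp_on C x" "power_series_at C c r g x"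
  shows "c (\<lambda>_. 0) = g x"
proof -
  have "x \<in> box_nbhd C x r" using assms by (simp add: box_nbhd_def power_series_at_def)
  from power_series_expansion[OF assms(1,3) this] show ?thesis by simp
qed

section \<open>Partial derivatives of power series\<close>

lemma has_real_derivative_of_quadratic_bound:
  fixes f :: "real \<Rightarrow> real"
  assumes "d > 0" and "\<And>s. \<bar>s\<bar> < d \<Longrightarrow> \<bar>f s - f 0 - D * s\<bar> \<le> K * s\<^sup>2"
  shows "(f has_real_derivative D) (at 0)"
proof -
  have "((\<lambda>s. (f s - f 0) / s - D) \<longlongrightarrow> 0) (at 0)"
  proof (rule Lim_null_comparison)
    show "\<forall>\<^sub>F s in at 0. norm ((f s - f 0) / s - D) \<le> \<bar>K\<bar> * \<bar>s\<bar>"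
      unfolding eventually_at
    proof (intro exI conjI ballI impI)
      fix s :: real assume s: "s \<noteq> 0 \<and> dist s 0 < d"
      have "norm ((f s - f 0) / s - D) = \<bar>f s - f 0 - D * s\<bar> / \<bar>s\<bar>"
        using s by (simp add: field_simps flip: abs_divide)
      also have "\<dots> \<le> (\<bar>K\<bar> * s\<^sup>2) / \<bar>s\<bar>"
        using assms(2)[of s] s
        by (intro divide_right_mono) (auto intro: order_trans mult_right_mono[OF abs_ge_self])
      also have "\<dots> = \<bar>K\<bar> * \<bar>s\<bar>" 
        using s by (metis abs_0_eq mult.assoc nonzero_mult_div_cancel_right power2_abs power2_eq_square)
      finally show "norm ((f s - f 0) / s - D) \<le> \<bar>K\<bar> * \<bar>s\<bar>" .
    qed (use assms in auto)
    show "((\<lambda>s. \<bar>K\<bar> * \<bar>s\<bar>) \<longlongrightarrow> 0) (at (0::real))" by (auto intro!: tendsto_eq_intros)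
  qed
  then have "((\<lambda>s. (f s - f 0) / s) \<longlongrightarrow> D) (at 0)" by (simp add: LIM_zero_iff)
  then show ?thesis by (simp add: has_field_derivative_iff)
qed

lemma partial_eqI:
  assumes "d > 0" and "\<And>s. \<bar>s\<bar> < d \<Longrightarrow> \<bar>g (x(i := x i + s)) - g x - D * s\<bar> \<le> K * s\<^sup>2"
  shows "((\<lambda>s. g (x(i := x i + s))) has_real_derivative D) (at 0)" "partial i g x = D"
proof -
  show "((\<lambda>s. g (x(i := x i + s))) has_real_derivative D) (at 0)"
    by (rule has_real_derivative_of_quadratic_bound[OF assms(1), of _ _ K]) (use assms in simp)
  then show "partial i g x = D" unfolding partial_def by (rule DERIV_imp_deriv)
qed

lemma power_series_partial_center:
  assumes "finite C" "supp_on C x" "power_series_at C c r g x" "i \<in> C"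
  shows "((\<lambda>s. g (x(i := x i + s))) has_real_derivative c (unit_idx i)) (at 0)"
    "partial i g x = c (unit_idx i)"
proof -
  let ?K = "infsum (\<lambda>\<alpha>. \<bar>c \<alpha>\<bar> * r ^ mdeg C \<alpha>) (multi_idx C) / r\<^sup>2"
  have r: "r > 0" using assms(3) by (simp add: power_series_at_def)
  have "\<bar>g (x(i := x i + s)) - g x - c (unit_idx i) * s\<bar> \<le> ?K * s\<^sup>2" if "\<bar>s\<bar> < r" for s
  proof -
    let ?y = "x(i := x i + s)"
    have "?y \<in> box_nbhd C x r" using that assms box_nbhd_center[OF assms(2) r]
      by (intro box_nbhd_upd) auto
    from power_series_expansion[OF assms(1,3) this]
    show ?thesis using assms(1,4)
      by (simp add: power_series_center[OF assms(1-3)] if_distrib if_distribR sum.delta cong: if_cong)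
  qed
  note b = this
  show "((\<lambda>s. g (x(i := x i + s))) has_real_derivative c (unit_idx i)) (at 0)"
    "partial i g x = c (unit_idx i)"
    by (rule partial_eqI[OF r b]; simp)+
qed

text \<open>Induction on \<open>j\<close>, multiplying the remainder by \<open>h + s\<close>. The
  factor \<open>\<rho>\<^sup>2\<close> on the left stands in for a division, so that the right-hand
  side is a full power of \<open>\<rho>\<close> even for \<open>j < 2\<close>.\<close>

lemma power_linear_remainder:
  fixes h s \<rho> :: real
  assumes "\<bar>h\<bar> \<le> \<rho>" "\<bar>h + s\<bar> \<le> \<rho>"
  shows "\<rho>\<^sup>2 * \<bar>(h + s) ^ j - h ^ j - real j * h ^ (j - 1) * s\<bar> \<le> s\<^sup>2 * (real j)\<^sup>2 * \<rho> ^ j"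
proof (induction j)
  case (Suc j)
  have \<rho>: "0 \<le> \<rho>" using assms by linarith
  let ?R = "(h + s) ^ j - h ^ j - real j * h ^ (j - 1) * s"
  have hj: "\<rho>\<^sup>2 * \<bar>real j * h ^ (j - 1)\<bar> \<le> real j * \<rho> ^ Suc j"
  proof (cases j)
    case (Suc i)
    have "\<rho>\<^sup>2 * \<bar>h ^ i\<bar> \<le> \<rho>\<^sup>2 * \<rho> ^ i"
      by (intro mult_left_mono) (auto simp: power_abs intro!: power_mono assms)
    from mult_left_mono[OF this, of "real j"] show ?thesis using Suc
      by (simp only: abs_mult) (simp add: power2_eq_square algebra_simps)
  qed simp
  have "(h + s) ^ Suc j - h ^ Suc j - real (Suc j) * h ^ (Suc j - 1) * s
      = (h + s) * ?R + s\<^sup>2 * (real j * h ^ (j - 1))"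
    by (cases j) (simp_all add: algebra_simps power2_eq_square)
  then have "\<rho>\<^sup>2 * \<bar>(h + s) ^ Suc j - h ^ Suc j - real (Suc j) * h ^ (Suc j - 1) * s\<bar>
      \<le> \<rho>\<^sup>2 * (\<bar>h + s\<bar> * \<bar>?R\<bar> + s\<^sup>2 * \<bar>real j * h ^ (j - 1)\<bar>)"
    by (intro mult_left_mono) (auto intro!: order_trans[OF abs_triangle_ineq] simp: abs_mult)
  also have "\<dots> = \<bar>h + s\<bar> * (\<rho>\<^sup>2 * \<bar>?R\<bar>) + s\<^sup>2 * (\<rho>\<^sup>2 * \<bar>real j * h ^ (j - 1)\<bar>)"
    by (simp add: algebra_simps)
  also have "\<dots> \<le> \<rho> * (s\<^sup>2 * (real j)\<^sup>2 * \<rho> ^ j) + s\<^sup>2 * (real j * \<rho> ^ Suc j)"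
    by (intro add_mono mult_mono mult_left_mono Suc.IH hj) (use assms \<rho> in auto)
  also have "\<dots> = s\<^sup>2 * ((real j)\<^sup>2 + real j) * \<rho> ^ Suc j"
    by (simp add: algebra_simps)
  also have "\<dots> \<le> s\<^sup>2 * (real (Suc j))\<^sup>2 * \<rho> ^ Suc j"
    by (intro mult_right_mono mult_left_mono) (use \<rho> in \<open>auto simp: power2_eq_square algebra_simps\<close>)
  finally show ?case .
qed simp

text \<open>Lets a doubling of the radius absorb the factor \<open>(real j)\<^sup>2\<close> of the
  second-order remainder.\<close>

lemma square_le_4_power_2: "(real j)\<^sup>2 \<le> 4 * 2 ^ j"
proof (induction j rule: less_induct)
  case (less j)
  show ?case
  proof (cases "j \<le> 2")
    case True
    then have "j = 0 \<or> j = 1 \<or> j = 2" by auto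
    then show ?thesis by auto
  next
    case False
    then obtain i where i: "j = Suc i" "i \<ge> 2" by (cases j) auto
    show ?thesis
    proof (cases "i = 2")
      case False
      then have i3: "real i \<ge> 3" using i by simp
      have "(real j)\<^sup>2 = (real i)\<^sup>2 + 2 * real i + 1" using i by (simp add: power2_eq_square algebra_simps)
      also have "\<dots> \<le> 2 * (real i)\<^sup>2"
      proof -
        have "3 * real i \<le> (real i)\<^sup>2"
          using mult_right_mono[OF i3, of "real i"] by (simp only: power2_eq_square)
        then show ?thesis using i3 by linarith
      qed
      also have "\<dots> \<le> 2 * (4 * 2 ^ i)" using less[of i] i by simp
      finally show ?thesis using i by simp
    qed (use i in simp)
  qed
qed

lemma monom_at_split:
  assumes "finite C" "i \<in> C"
  shows "monom_at C h \<alpha> = h i ^ \<alpha> i * (\<Prod>j\<in>C - {i}. h j ^ \<alpha> j)"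
  unfolding monom_at_def using assms by (rule prod.remove)

lemma mdeg_split:
  assumes "finite C" "i \<in> C"
  shows "mdeg C \<alpha> = \<alpha> i + mdeg (C - {i}) \<alpha>"
  unfolding mdeg_def using assms by (rule sum.remove)

lemma mdeg_raise:
  assumes "finite C" "i \<in> C"
  shows "mdeg C (\<alpha>(i := Suc (\<alpha> i))) = Suc (mdeg C \<alpha>)"
proof -
  have "mdeg (C - {i}) (\<alpha>(i := Suc (\<alpha> i))) = mdeg (C - {i}) \<alpha>" by (simp add: mdeg_def)
  then show ?thesis using mdeg_split[OF assms] by simp
qed

definition raise_idx :: "'i \<Rightarrow> ('i \<Rightarrow> nat) \<Rightarrow> 'i \<Rightarrow> nat" where
  "raise_idx i \<alpha> = \<alpha>(i := Suc (\<alpha> i))"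

lemma raise_idx_bij:
  assumes "i \<in> C"
  shows "bij_betw (raise_idx i) (multi_idx C) {\<alpha> \<in> multi_idx C. \<alpha> i \<noteq> 0}"
proof (rule bij_betw_byWitness[where f' = "\<lambda>\<alpha>. \<alpha>(i := \<alpha> i - 1)"])
qed (use assms in \<open>auto simp: raise_idx_def multi_idx_def\<close>)

text \<open>Termwise differentiation with an explicit remainder: halving the radius leaves a spare
  power of 2 that swallows the polynomial factors in the exponents. The constant \<open>K\<close> of
  the second claim is common to all base points \<open>y\<close>, as difference quotients at moving
  points will require.\<close>

lemma power_series_partial:
  fixes x :: "'i \<Rightarrow> real"
  assumes C: "finite C" "i \<in> C" and ps: "power_series_at C c r g x"
  defines "c' \<equiv> \<lambda>\<alpha>. real (Suc (\<alpha> i)) * c (raise_idx i \<alpha>)"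
  shows "power_series_at C c' (r / 2) (partial i g) x"
    and "\<exists>K. \<forall>y\<in>box_nbhd C x (r / 2). \<forall>s. \<bar>y i + s - x i\<bar> < r / 2 \<longrightarrow>
      \<bar>g (y(i := y i + s)) - g y - partial i g y * s\<bar> \<le> K * s\<^sup>2"
proof -
  define \<rho> where "\<rho> = r / 2"
  define b where "b = (\<lambda>\<alpha>. \<bar>c \<alpha>\<bar> * r ^ mdeg C \<alpha>)"
  have r: "r > 0" and \<rho>: "\<rho> > 0" "r = 2 * \<rho>" and sb: "b summable_on multi_idx C"
    and hs: "\<And>y. y \<in> box_nbhd C x r \<Longrightarrow>
      ((\<lambda>\<alpha>. c \<alpha> * monom_at C (\<lambda>i. y i - x i) \<alpha>) has_sum g y) (multi_idx C)"
    using ps by (auto simp: power_series_at_def \<rho>_def b_def)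
  have c'_bound: "\<bar>c' \<alpha>\<bar> * \<rho> ^ mdeg C \<alpha> \<le> 1 / \<rho> * b (raise_idx i \<alpha>)" for \<alpha>
  proof -
    have d: "mdeg C (raise_idx i \<alpha>) = Suc (mdeg C \<alpha>)" unfolding raise_idx_def by (rule mdeg_raise[OF C])
    have "real (Suc (\<alpha> i)) \<le> 2 ^ Suc (\<alpha> i)"
      using of_nat_less_two_power[of "Suc (\<alpha> i)", where 'a=real] by linarith
    also have "\<dots> \<le> 2 ^ Suc (mdeg C \<alpha>)"
      by (rule power_increasing) (use mdeg_split[OF C, of \<alpha>] in auto)
    finally have 1: "real (Suc (\<alpha> i)) \<le> 2 ^ Suc (mdeg C \<alpha>)" .
    have "\<bar>c' \<alpha>\<bar> * \<rho> ^ mdeg C \<alpha> = \<bar>c (raise_idx i \<alpha>)\<bar> * \<rho> ^ mdeg C \<alpha> * real (Suc (\<alpha> i))"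
      by (simp add: c'_def abs_mult)
    also have "\<dots> \<le> \<bar>c (raise_idx i \<alpha>)\<bar> * \<rho> ^ mdeg C \<alpha> * 2 ^ Suc (mdeg C \<alpha>)"
      by (rule mult_left_mono[OF 1]) (use \<rho> in auto)
    also have "\<dots> = 1 / \<rho> * b (raise_idx i \<alpha>)"
      unfolding b_def d \<rho>(2) power_mult_distrib using \<rho>(1) by (simp add: field_simps)
    finally show ?thesis .
  qed
  have "b summable_on {\<alpha> \<in> multi_idx C. \<alpha> i \<noteq> 0}"
    by (rule summable_on_subset_banach[OF sb]) auto
  then have "(\<lambda>\<alpha>. b (raise_idx i \<alpha>)) summable_on multi_idx C"
    using summable_on_reindex_bij_betw[OF raise_idx_bij[OF C(2)], of b] by simp
  then have "(\<lambda>\<alpha>. 1 / \<rho> * b (raise_idx i \<alpha>)) summable_on multi_idx C"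
    by (rule summable_on_cmult_right)
  then have sc': "(\<lambda>\<alpha>. \<bar>c' \<alpha>\<bar> * \<rho> ^ mdeg C \<alpha>) summable_on multi_idx C"
    by (rule summable_on_comparison_test) (use c'_bound \<rho> in auto)
  define D where "D = (\<lambda>y. infsum (\<lambda>\<alpha>. c' \<alpha> * monom_at C (\<lambda>i. y i - x i) \<alpha>) (multi_idx C))"
  have D: "((\<lambda>\<alpha>. c' \<alpha> * monom_at C (\<lambda>i. y i - x i) \<alpha>) has_sum D y) (multi_idx C)"
    if y: "y \<in> box_nbhd C x \<rho>" for y
  proof -
    have "\<bar>monom_at C (\<lambda>i. y i - x i) \<alpha>\<bar> \<le> \<rho> ^ mdeg C \<alpha>" for \<alpha>
      by (rule abs_monom_at_le) (use y in \<open>auto simp: box_nbhd_def less_imp_le\<close>)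
    then have "(\<lambda>\<alpha>. norm (c' \<alpha> * monom_at C (\<lambda>i. y i - x i) \<alpha>)) summable_on multi_idx C"
      by (intro summable_on_comparison_test[OF sc']) (auto simp: abs_mult intro!: mult_left_mono)
    then have "(\<lambda>\<alpha>. c' \<alpha> * monom_at C (\<lambda>i. y i - x i) \<alpha>) summable_on multi_idx C"
      by (rule abs_summable_summable)
    then show ?thesis unfolding D_def by (rule has_sum_infsum)
  qed
  define K where "K = infsum b (multi_idx C) * (4 / \<rho>\<^sup>2)"
  have rem: "\<bar>g (y(i := y i + s)) - g y - D y * s\<bar> \<le> K * s\<^sup>2"
    if y: "y \<in> box_nbhd C x \<rho>" and s: "\<bar>y i + s - x i\<bar> < \<rho>" for y s
  proof -
    define h where "h = (\<lambda>j. y j - x j)"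
    define h' where "h' = (\<lambda>j. (y(i := y i + s)) j - x j)"
    have h': "h' i = h i + s" "\<And>j. j \<noteq> i \<Longrightarrow> h' j = h j" by (auto simp: h_def h'_def)
    have hb: "\<And>j. j \<in> C \<Longrightarrow> \<bar>h j\<bar> \<le> \<rho>" "\<bar>h i + s\<bar> \<le> \<rho>"
      using y s C by (auto simp: h_def box_nbhd_def less_imp_le algebra_simps)
    have sub: "box_nbhd C x \<rho> \<subseteq> box_nbhd C x r" by (rule box_nbhd_mono) (use \<rho> in auto)
    have y': "y(i := y i + s) \<in> box_nbhd C x \<rho>" using y C(2) s by (rule box_nbhd_upd)
    \<comment> \<open>The termwise derivative indexed by the original exponents, so that it can be
      subtracted from the increment of \<open>g\<close> term by term. Truncated subtraction at
      \<open>\<alpha> i = 0\<close> is harmless since the factor in front is zero.\<close>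
    define d where "d = (\<lambda>\<alpha>. c \<alpha> * (real (\<alpha> i) * (h i ^ (\<alpha> i - 1) * (\<Prod>j\<in>C - {i}. h j ^ \<alpha> j))))"
    have "d (raise_idx i \<alpha>) = c' \<alpha> * monom_at C h \<alpha>" for \<alpha>
    proof -
      have "(\<Prod>j\<in>C - {i}. h j ^ raise_idx i \<alpha> j) = (\<Prod>j\<in>C - {i}. h j ^ \<alpha> j)"
        by (rule prod.cong) (auto simp: raise_idx_def)
      then show ?thesis by (simp add: d_def c'_def monom_at_split[OF C]) (simp add: raise_idx_def)
    qed
    then have "((\<lambda>\<alpha>. d (raise_idx i \<alpha>)) has_sum D y) (multi_idx C)"
      using D[OF y] by (simp add: h_def)
    then have "(d has_sum D y) {\<alpha> \<in> multi_idx C. \<alpha> i \<noteq> 0}"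
      using has_sum_reindex_bij_betw[OF raise_idx_bij[OF C(2)], of d] by simp
    then have "(d has_sum D y) (multi_idx C)"
      by (rule has_sum_cong_neutral[THEN iffD1, rotated -1]) (auto simp: d_def)
    then have dsum: "((\<lambda>\<alpha>. d \<alpha> * s) has_sum D y * s) (multi_idx C)"
      by (rule has_sum_cmult_left)
    have gg: "((\<lambda>\<alpha>. c \<alpha> * monom_at C h' \<alpha> - c \<alpha> * monom_at C h \<alpha>) has_sum
        (g (y(i := y i + s)) - g y)) (multi_idx C)"
      using hs[of y] hs[of "y(i := y i + s)"] y y' sub unfolding h_def h'_def
      by (intro has_sum_diff_real) auto
    have "((\<lambda>\<alpha>. c \<alpha> * monom_at C h' \<alpha> - c \<alpha> * monom_at C h \<alpha> - d \<alpha> * s) has_sum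
        (g (y(i := y i + s)) - g y - D y * s)) (multi_idx C)"
      by (rule has_sum_diff_real[OF gg dsum])
    then have "\<bar>g (y(i := y i + s)) - g y - D y * s\<bar> \<le>
      infsum (\<lambda>\<alpha>. b \<alpha> * (4 / \<rho>\<^sup>2 * s\<^sup>2)) (multi_idx C)"
    proof (rule has_sum_abs_le)
      show "(\<lambda>\<alpha>. b \<alpha> * (4 / \<rho>\<^sup>2 * s\<^sup>2)) summable_on multi_idx C"
        using sb by (rule summable_on_cmult_left)
      fix \<alpha>
      define P where "P = (\<Prod>j\<in>C - {i}. h j ^ \<alpha> j)"
      define R where "R = (h i + s) ^ \<alpha> i - h i ^ \<alpha> i - real (\<alpha> i) * h i ^ (\<alpha> i - 1) * s"
      have P': "(\<Prod>j\<in>C - {i}. h' j ^ \<alpha> j) = P"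
        unfolding P_def by (rule prod.cong) (auto simp: h')
      have "c \<alpha> * monom_at C h' \<alpha> - c \<alpha> * monom_at C h \<alpha> - d \<alpha> * s = c \<alpha> * (R * P)"
        unfolding monom_at_split[OF C] P' d_def R_def h'(1) unfolding P_def[symmetric]
        by (simp add: algebra_simps)
      then have "\<bar>c \<alpha> * monom_at C h' \<alpha> - c \<alpha> * monom_at C h \<alpha> - d \<alpha> * s\<bar> = \<bar>c \<alpha>\<bar> * (\<bar>R\<bar> * \<bar>P\<bar>)"
        by (simp add: abs_mult)
      moreover have "\<bar>R\<bar> * \<bar>P\<bar> \<le> r ^ mdeg C \<alpha> * (4 / \<rho>\<^sup>2 * s\<^sup>2)"
      proof -
        have "\<rho>\<^sup>2 * \<bar>R\<bar> \<le> s\<^sup>2 * (real (\<alpha> i))\<^sup>2 * \<rho> ^ \<alpha> i"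
          unfolding R_def by (rule power_linear_remainder) (use hb C in auto)
        also have "\<dots> \<le> s\<^sup>2 * (4 * 2 ^ \<alpha> i) * \<rho> ^ \<alpha> i"
          by (intro mult_right_mono mult_left_mono square_le_4_power_2) (use \<rho> in auto)
        finally have 1: "\<rho>\<^sup>2 * \<bar>R\<bar> \<le> s\<^sup>2 * (4 * r ^ \<alpha> i)" by (simp add: \<rho>(2) power_mult_distrib mult.assoc)
        have "\<bar>P\<bar> \<le> r ^ mdeg (C - {i}) \<alpha>"
          using abs_monom_at_le[of "C - {i}" h r \<alpha>] hb \<rho> unfolding P_def monom_at_def by force
        then have "\<rho>\<^sup>2 * \<bar>R\<bar> * \<bar>P\<bar> \<le> s\<^sup>2 * (4 * r ^ \<alpha> i) * r ^ mdeg (C - {i}) \<alpha>"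
          by (intro mult_mono 1) (use r in auto)
        also have "\<dots> = r ^ mdeg C \<alpha> * (4 * s\<^sup>2)" by (simp add: mdeg_split[OF C] power_add)
        finally show ?thesis using \<rho>(1) by (simp add: field_simps)
      qed
      ultimately show "\<bar>c \<alpha> * monom_at C h' \<alpha> - c \<alpha> * monom_at C h \<alpha> - d \<alpha> * s\<bar> \<le> b \<alpha> * (4 / \<rho>\<^sup>2 * s\<^sup>2)"
        unfolding b_def by (simp only: mult.assoc) (rule mult_left_mono, auto)
    qed (use r in \<open>auto simp: b_def\<close>)
    then show ?thesis unfolding K_def by (simp only: infsum_cmult_left' mult.assoc)
  qed
  have pD: "partial i g y = D y" if y: "y \<in> box_nbhd C x \<rho>" for y
  proof (rule partial_eqI(2))
    show "0 < \<rho> - \<bar>y i - x i\<bar>" using y C by (simp add: box_nbhd_def)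
    show "\<bar>g (y(i := y i + s)) - g y - D y * s\<bar> \<le> K * s\<^sup>2" if "\<bar>s\<bar> < \<rho> - \<bar>y i - x i\<bar>" for s
      by (rule rem[OF y]) (use that in linarith)
  qed
  show "power_series_at C c' (r / 2) (partial i g) x"
    unfolding power_series_at_def \<rho>_def[symmetric] using \<rho>(1) sc' D pD by simp
  show "\<exists>K. \<forall>y\<in>box_nbhd C x (r / 2). \<forall>s. \<bar>y i + s - x i\<bar> < r / 2 \<longrightarrow>
      \<bar>g (y(i := y i + s)) - g y - partial i g y * s\<bar> \<le> K * s\<^sup>2"
    using rem pD unfolding \<rho>_def by (intro exI[of _ K]) auto
qed

lemma analytic_at_has_partial:
  assumes "finite C" "supp_on C x" "analytic_at C g x" "i \<in> C"
  shows "((\<lambda>s. g (x(i := x i + s))) has_real_derivative partial i g x) (at 0)"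
proof -
  obtain c r where ps: "power_series_at C c r g x"
    using assms(3) unfolding analytic_at_iff_power_series[OF assms(1)] by blast
  from power_series_partial_center[OF assms(1,2) ps assms(4)] show ?thesis by simp
qed

lemma analytic_at_partial:
  assumes "finite C" "analytic_at C g x" "i \<in> C"
  shows "analytic_at C (partial i g) x"
  using assms(2) power_series_partial(1)[OF assms(1,3)]
  unfolding analytic_at_iff_power_series[OF assms(1)] by blast

text \<open>At the centre both mixed partials are the coefficient with index
  \<open>raise_idx i (unit_idx j)\<close>, multiplied by the same factor.\<close>

lemma partial_commute:
  assumes C: "finite C" "supp_on C x" and g: "analytic_at C g x" and ij: "i \<in> C" "j \<in> C"
  shows "partial i (partial j g) x = partial j (partial i g) x"
proof -
  obtain c r where ps: "power_series_at C c r g x"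
    using g unfolding analytic_at_iff_power_series[OF C(1)] by blast
  have "raise_idx i (unit_idx j) = raise_idx j (unit_idx i)"
    by (auto simp: raise_idx_def unit_idx_def)
  then show ?thesis
    using power_series_partial_center(2)[OF C power_series_partial(1)[OF C(1) ij(1) ps] ij(2)]
      power_series_partial_center(2)[OF C power_series_partial(1)[OF C(1) ij(2) ps] ij(1)]
    by (simp add: unit_idx_def)
qed

lemma analytic_at_expansion:
  assumes C: "finite C" "supp_on C x" and g: "analytic_at C g x"
  obtains e K where "e > 0"
    "\<forall>y\<in>box_nbhd C x e.
      \<bar>g y - g x - (\<Sum>i\<in>C. partial i g x * (y i - x i))\<bar> \<le> K * (\<Sum>i\<in>C. \<bar>y i - x i\<bar>)\<^sup>2"
proof -
  obtain c r where ps: "power_series_at C c r g x"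
    using g unfolding analytic_at_iff_power_series[OF C(1)] by blast
  have "r > 0" using ps by (simp add: power_series_at_def)
  then show ?thesis
  proof (rule that, intro ballI)
    fix y assume "y \<in> box_nbhd C x r"
    from power_series_expansion[OF C(1) ps this]
    show "\<bar>g y - g x - (\<Sum>i\<in>C. partial i g x * (y i - x i))\<bar> \<le>
      infsum (\<lambda>\<alpha>. \<bar>c \<alpha>\<bar> * r ^ mdeg C \<alpha>) (multi_idx C) / r\<^sup>2 * (\<Sum>i\<in>C. \<bar>y i - x i\<bar>)\<^sup>2"
      by (simp add: power_series_center[OF C ps] power_series_partial_center(2)[OF C ps] cong: sum.cong)
  qed
qed

lemma analytic_at_partial_remainder:
  assumes C: "finite C" and g: "analytic_at C g x" and i: "i \<in> C"
  obtains e K where "e > 0"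
    "\<forall>y\<in>box_nbhd C x e. \<forall>s. \<bar>y i + s - x i\<bar> < e \<longrightarrow>
      \<bar>g (y(i := y i + s)) - g y - partial i g y * s\<bar> \<le> K * s\<^sup>2"
proof -
  obtain c r where ps: "power_series_at C c r g x"
    using g unfolding analytic_at_iff_power_series[OF C(1)] by blast
  have "r / 2 > 0" using ps by (simp add: power_series_at_def)
  with that show ?thesis using power_series_partial(2)[OF C i ps] by blast
qed

lemma analytic_at_bounded:
  assumes C: "finite C" and g: "analytic_at C g x"
  obtains e K where "e > 0" "\<forall>y\<in>box_nbhd C x e. \<bar>g y\<bar> \<le> K"
proof -
  obtain c r where ps: "power_series_at C c r g x"
    using g unfolding analytic_at_iff_power_series[OF C(1)] by blast
  have "r > 0" using ps by (simp add: power_series_at_def)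
  with that show ?thesis using power_series_bounded[OF ps] by blast
qed

section \<open>Analyticity of polynomials\<close>

lemma analytic_at_monomial:
  assumes "\<beta> \<in> multi_idx C"
  shows "analytic_at C (\<lambda>y. K * monom_at C (\<lambda>i. y i - x i) \<beta>) x"
proof -
  have "((\<lambda>\<alpha>. (if \<alpha> = \<beta> then K else 0) * monom_at C (\<lambda>i. y i - x i) \<alpha>) has_sum
     K * monom_at C (\<lambda>i. y i - x i) \<beta>) (multi_idx C)" for y :: "'a \<Rightarrow> real"
  proof -
    have "((\<lambda>\<alpha>. (if \<alpha> = \<beta> then K else 0) * monom_at C (\<lambda>i. y i - x i) \<alpha>) has_sum
       K * monom_at C (\<lambda>i. y i - x i) \<beta>) {\<beta>}"
      by (rule has_sum_finiteI) auto
    then show ?thesis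
      by (rule has_sum_cong_neutral[THEN iffD1, rotated -1]) (use assms in auto)
  qed
  then show ?thesis unfolding analytic_at_def multi_idx_def monom_at_def
    by (intro exI[of _ "\<lambda>\<alpha>. if \<alpha> = \<beta> then K else 0"] exI[of _ 1]) auto
qed

lemma analytic_at_add:
  assumes "analytic_at C f x" "analytic_at C g x"
  shows "analytic_at C (\<lambda>y. f y + g y) x"
proof -
  obtain c e where e: "e > 0" "\<forall>y\<in>box_nbhd C x e.
     ((\<lambda>\<alpha>. c \<alpha> * (\<Prod>i\<in>C. (y i - x i) ^ \<alpha> i)) has_sum f y) {\<alpha>. \<forall>i. i \<notin> C \<longrightarrow> \<alpha> i = 0}"
    using assms(1) unfolding analytic_at_def by blast
  obtain c' e' where e': "e' > 0" "\<forall>y\<in>box_nbhd C x e'.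
     ((\<lambda>\<alpha>. c' \<alpha> * (\<Prod>i\<in>C. (y i - x i) ^ \<alpha> i)) has_sum g y) {\<alpha>. \<forall>i. i \<notin> C \<longrightarrow> \<alpha> i = 0}"
    using assms(2) unfolding analytic_at_def by blast
  show ?thesis unfolding analytic_at_def
  proof (intro exI conjI ballI)
    show "min e e' > 0" using e e' by simp
    fix y assume "y \<in> box_nbhd C x (min e e')"
    then have "y \<in> box_nbhd C x e" "y \<in> box_nbhd C x e'" by (auto simp: box_nbhd_def)
    then show "((\<lambda>\<alpha>. (c \<alpha> + c' \<alpha>) * (\<Prod>i\<in>C. (y i - x i) ^ \<alpha> i)) has_sum f y + g y)
        {\<alpha>. \<forall>i. i \<notin> C \<longrightarrow> \<alpha> i = 0}"
      unfolding distrib_right using e(2) e'(2) by (intro has_sum_add) blast+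
  qed
qed

lemma analytic_at_const: "analytic_at C (\<lambda>y. K) x"
  using analytic_at_monomial[of "\<lambda>_. 0" C K x] by (simp add: multi_idx_def monom_at_def)

lemma analytic_at_sum:
  assumes "finite I" "\<And>k. k \<in> I \<Longrightarrow> analytic_at C (f k) x"
  shows "analytic_at C (\<lambda>y. \<Sum>k\<in>I. f k y) x"
  using assms by (induction rule: finite_induct) (auto intro: analytic_at_const analytic_at_add)

lemma analytic_at_linear:
  assumes "finite C" "i \<in> C"
  shows "analytic_at C (\<lambda>y. K * (y i - x i)) x"
proof -
  have "unit_idx i \<in> multi_idx C" using assms by (auto simp: unit_idx_def multi_idx_def)
  from analytic_at_monomial[OF this, of K x] show ?thesis
    by (simp add: monom_at_unit_idx[OF assms])
qed

lemma analytic_at_bilinear: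
  assumes "finite C" "i \<in> C" "j \<in> C"
  shows "analytic_at C (\<lambda>y. K * ((y i - x i) * (y j - x j))) x"
proof -
  have m: "raise_idx j (unit_idx i) \<in> multi_idx C"
    using assms by (auto simp: unit_idx_def multi_idx_def raise_idx_def)
  have "monom_at C h (raise_idx j (unit_idx i)) = h i * h j" for h :: "'a \<Rightarrow> real"
  proof -
    have "(\<Prod>a\<in>C - {j}. h a ^ raise_idx j (unit_idx i) a) = (\<Prod>a\<in>C - {j}. h a ^ unit_idx i a)"
      by (rule prod.cong) (auto simp: raise_idx_def)
    then have "monom_at C h (raise_idx j (unit_idx i)) = h j * monom_at C h (unit_idx i)"
      unfolding monom_at_split[OF assms(1,3)] by (simp add: raise_idx_def)
    then show ?thesis by (simp add: monom_at_unit_idx[OF assms(1,2)])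
  qed
  with analytic_at_monomial[OF m, of K x] show ?thesis by simp
qed

section \<open>Second jets of approximate solutions\<close>

text \<open>With s = \<tau>^2 the bound says that \<Phi>(s) is O(s^(3/2)) for s > 0, which is of
  smaller order than s. As the derivative at 0 exists, approaching from the right determines
  it.\<close>

lemma deriv_eq_0_of_cubic_bound:
  fixes \<Phi> :: "real \<Rightarrow> real"
  assumes D: "(\<Phi> has_real_derivative D) (at 0)" and "\<delta> > 0"
    and b: "\<And>\<tau>. 0 < \<tau> \<Longrightarrow> \<tau> < \<delta> \<Longrightarrow> \<bar>\<Phi> (\<tau>\<^sup>2)\<bar> \<le> K * \<tau> ^ 3"
  shows "\<Phi> 0 = 0" "D = 0"
proof -
  have lim: "filterlim (\<lambda>\<tau>::real. \<tau>\<^sup>2) (at 0) (at_right 0)"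
    unfolding filterlim_at
    by (auto intro!: tendsto_eq_intros simp: eventually_at_right_less eventually_at intro: exI[of _ 1])
  have ev: "\<forall>\<^sub>F \<tau> in at_right (0::real). 0 < \<tau> \<and> \<tau> < \<delta>"
    using assms(2) by (auto simp: eventually_at_right intro: exI[of _ \<delta>])
  have "(\<Phi> \<longlongrightarrow> \<Phi> 0) (at 0)" using DERIV_isCont[OF D] by (simp add: isCont_def)
  then have 1: "((\<lambda>\<tau>. \<Phi> (\<tau>\<^sup>2)) \<longlongrightarrow> \<Phi> 0) (at_right 0)"
    using lim by (rule filterlim_compose)
  have "((\<lambda>\<tau>. \<Phi> (\<tau>\<^sup>2)) \<longlongrightarrow> 0) (at_right 0)"
  proof (rule Lim_null_comparison)
    show "\<forall>\<^sub>F \<tau> in at_right 0. norm (\<Phi> (\<tau>\<^sup>2)) \<le> K * \<tau> ^ 3"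
      using ev by eventually_elim (use b in auto)
    show "((\<lambda>\<tau>. K * \<tau> ^ 3) \<longlongrightarrow> 0) (at_right (0::real))" by (auto intro!: tendsto_eq_intros)
  qed
  from tendsto_unique[OF _ 1 this] show 0: "\<Phi> 0 = 0" by simp
  have "((\<lambda>s. \<Phi> s / s) \<longlongrightarrow> D) (at 0)"
    using D 0 by (simp add: has_field_derivative_iff)
  then have 2: "((\<lambda>\<tau>. \<Phi> (\<tau>\<^sup>2) / \<tau>\<^sup>2) \<longlongrightarrow> D) (at_right 0)"
    using lim by (rule filterlim_compose)
  have "((\<lambda>\<tau>. \<Phi> (\<tau>\<^sup>2) / \<tau>\<^sup>2) \<longlongrightarrow> 0) (at_right 0)"
  proof (rule Lim_null_comparison)
    show "\<forall>\<^sub>F \<tau> in at_right 0. norm (\<Phi> (\<tau>\<^sup>2) / \<tau>\<^sup>2) \<le> K * \<tau>"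
      using ev
    proof eventually_elim
      fix \<tau> :: real assume t: "0 < \<tau> \<and> \<tau> < \<delta>"
      then have "\<bar>\<Phi> (\<tau>\<^sup>2)\<bar> / \<tau>\<^sup>2 \<le> K * \<tau> ^ 3 / \<tau>\<^sup>2" by (intro divide_right_mono b) auto
      also have "\<dots> = K * \<tau>" using t by (simp add: power3_eq_cube power2_eq_square)
      finally show "norm (\<Phi> (\<tau>\<^sup>2) / \<tau>\<^sup>2) \<le> K * \<tau>" by simp
    qed
    show "((\<lambda>\<tau>. K * \<tau>) \<longlongrightarrow> 0) (at_right (0::real))" by (auto intro!: tendsto_eq_intros)
  qed
  from tendsto_unique[OF _ 2 this] show "D = 0" by simp
qed

text \<open>The contact bound speaks about values only. Derivatives at points near the centre are
  recovered from difference quotients, whose errors are controlled by the analyticity of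
  \<open>u\<close> and \<open>a\<close>; letting these points tend to the centre gives first and
  second derivatives together.\<close>

lemma cubic_contact_jets_agree:
  fixes u a :: "(nat \<Rightarrow> real) \<Rightarrow> real"
  assumes kn: "k \<le> n" and x0: "supp_on {..<n} x0"
    and u: "analytic_at {..<n} u x0" and x0k: "x0k = (\<lambda>i. if i < k then x0 i else 0)"
    and a: "analytic_at {..<k} a x0k" and d: "d > 0"
    and c: "\<And>y. y \<in> box_nbhd {..<k} x0k d \<Longrightarrow>
      \<bar>u (\<lambda>i. if i < k then y i else x0 i) - a y\<bar> \<le> K * sqrt (sqdist {..<k} y x0k) ^ 3"
  shows "u x0 = a x0k"
    and "G < k \<Longrightarrow> partial G u x0 = partial G a x0k"
    and "G < k \<Longrightarrow> L < k \<Longrightarrow> partial L (partial G u) x0 = partial L (partial G a) x0k"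
proof -
  define E where "E = (\<lambda>y i. if i < k then y i else x0 i)"
  define v where "v = (\<lambda>y. u (E y) - a y)"
  have Ex0: "E x0k = x0" by (auto simp: E_def x0k)
  have sx0k: "supp_on {..<k} x0k" by (simp add: supp_on_def x0k)
  have Eupd: "E (y(G := y G + s)) = (E y)(G := E y G + s)" if "G < k" for y G s
    using that by (auto simp: E_def)
  have Ebox: "E y \<in> box_nbhd {..<n} x0 e" if "y \<in> box_nbhd {..<k} x0k e" "e > 0" for y e
    using that x0 kn by (auto simp: box_nbhd_def supp_on_def E_def x0k)
  have vb: "\<bar>v y\<bar> \<le> \<bar>K\<bar> * sqrt k ^ 3 * \<rho> ^ 3"
    if y: "y \<in> box_nbhd {..<k} x0k d" and \<rho>: "\<And>i. i < k \<Longrightarrow> \<bar>y i - x0k i\<bar> \<le> \<rho>" "0 \<le> \<rho>" for y \<rho>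
  proof -
    have "sqdist {..<k} y x0k \<le> (\<Sum>i<k. \<rho>\<^sup>2)"
      unfolding sqdist_def by (rule sum_mono) (use \<rho> abs_le_square_iff in fastforce)
    then have "sqrt (sqdist {..<k} y x0k) \<le> sqrt (real k * \<rho>\<^sup>2)" by simp
    also have "\<dots> = sqrt k * \<rho>" using \<rho>(2) by (simp add: real_sqrt_mult)
    finally have 1: "sqrt (sqdist {..<k} y x0k) \<le> sqrt k * \<rho>" .
    have 0: "0 \<le> sqrt (sqdist {..<k} y x0k)" by (simp add: sqdist_def sum_nonneg)
    have "\<bar>v y\<bar> \<le> K * sqrt (sqdist {..<k} y x0k) ^ 3"
      using c[OF y] by (simp add: v_def E_def)
    also have "\<dots> \<le> \<bar>K\<bar> * (sqrt k * \<rho>) ^ 3"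
      using 0 1 by (intro mult_mono power_mono) auto
    finally show ?thesis by (simp add: power_mult_distrib mult.assoc)
  qed
  show "u x0 = a x0k"
    using vb[of x0k 0] box_nbhd_center[OF sx0k d] by (simp add: v_def Ex0)
  have main: "partial G u x0 = partial G a x0k \<and> partial L (partial G u) x0 = partial L (partial G a) x0k"
    if G: "G < k" and L: "L < k" for G L
  proof -
    have Gn: "G \<in> {..<n}" and Gk: "G \<in> {..<k}" using G kn by auto
    obtain e1 K1 where 1: "e1 > 0" "\<forall>y\<in>box_nbhd {..<n} x0 e1. \<forall>s. \<bar>y G + s - x0 G\<bar> < e1 \<longrightarrow>
      \<bar>u (y(G := y G + s)) - u y - partial G u y * s\<bar> \<le> K1 * s\<^sup>2"
      by (rule analytic_at_partial_remainder[OF finite_lessThan u Gn])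
    obtain e2 K2 where 2: "e2 > 0" "\<forall>y\<in>box_nbhd {..<k} x0k e2. \<forall>s. \<bar>y G + s - x0k G\<bar> < e2 \<longrightarrow>
      \<bar>a (y(G := y G + s)) - a y - partial G a y * s\<bar> \<le> K2 * s\<^sup>2"
      by (rule analytic_at_partial_remainder[OF finite_lessThan a Gk])
    define \<Phi> where "\<Phi> = (\<lambda>\<sigma>. partial G u (x0(L := x0 L + \<sigma>)) - partial G a (x0k(L := x0k L + \<sigma>)))"
    have \<Phi>D: "(\<Phi> has_real_derivative (partial L (partial G u) x0 - partial L (partial G a) x0k)) (at 0)"
      unfolding \<Phi>_def using G L kn x0 sx0k u a
      by (intro DERIV_diff analytic_at_has_partial[of "{..<n}"] analytic_at_has_partial[of "{..<k}"]
          analytic_at_partial) auto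
    define e where "e = min d (min e1 e2)"
    have e: "e > 0" "e \<le> d" "e \<le> e1" "e \<le> e2" using d 1(1) 2(1) by (auto simp: e_def)
    define \<delta> where "\<delta> = min 1 (e / 2)"
    have \<delta>: "\<delta> > 0" "\<delta> \<le> 1" "2 * \<delta> \<le> e" using e by (auto simp: \<delta>_def)
    define M where "M = \<bar>K\<bar> * sqrt k ^ 3"
    \<comment> \<open>The point \<open>y\<close> lies at distance \<tau>^2 from the centre, and the
      difference step is \<tau>^3. Both \<open>v y\<close> and \<open>v y'\<close> are O(\<tau>^6),
      and the remainders are O(\<tau>^6), so after division by the step everything is O(\<tau>^3),
      of smaller order than the offset \<tau>^2. The 16 is 2 * 2^3: two values of \<open>v\<close>,
      each within 2 \<tau>^2 of the centre.\<close>
    have bound: "\<bar>\<Phi> (\<tau>\<^sup>2)\<bar> \<le> (16 * M + K1 + K2) * \<tau> ^ 3" if \<tau>: "0 < \<tau>" "\<tau> < \<delta>" for \<tau>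
    proof -
      have t3: "\<tau> ^ 3 \<le> \<tau>\<^sup>2" by (rule power_decreasing) (use \<tau> \<delta> in auto)
      have t0: "0 < \<tau> ^ 3" "0 < \<tau>\<^sup>2" using \<tau> by auto
      then have t3': "\<tau> ^ 3 \<le> 2 * \<tau>\<^sup>2" using t3 by linarith
      have t2: "\<tau>\<^sup>2 \<le> \<tau>" using power_decreasing[of 1 2 \<tau>] \<tau> \<delta> by auto
      have t2e: "2 * \<tau>\<^sup>2 < e" using t2 \<tau> \<delta> by linarith
      define y where "y = x0k(L := x0k L + \<tau>\<^sup>2)"
      define y' where "y' = y(G := y G + \<tau> ^ 3)"
      have yb: "\<bar>y i - x0k i\<bar> \<le> 2 * \<tau>\<^sup>2" "\<bar>y' i - x0k i\<bar> \<le> 2 * \<tau>\<^sup>2" for i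
        using t3 t0 t3' by (auto simp: y_def y'_def abs_le_iff)
      have sy: "supp_on {..<k} y" "supp_on {..<k} y'"
        using G L by (auto simp: y_def y'_def supp_on_def x0k)
      have ye: "y \<in> box_nbhd {..<k} x0k e'" "y' \<in> box_nbhd {..<k} x0k e'" if "e \<le> e'" for e'
        using sy le_less_trans[OF yb(1) t2e] le_less_trans[OF yb(2) t2e] that
        by (auto simp: box_nbhd_def intro: less_le_trans)
      have Ey: "E y = x0(L := x0 L + \<tau>\<^sup>2)" using Eupd[OF L, of x0k] by (simp add: y_def Ex0)
      have "\<bar>u (E y') - u (E y) - partial G u (E y) * \<tau> ^ 3\<bar> \<le> K1 * (\<tau> ^ 3)\<^sup>2"
        unfolding y'_def Eupd[OF G]
      proof (rule 1(2)[rule_format])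
        show "E y \<in> box_nbhd {..<n} x0 e1" using Ebox ye e 1(1) by blast
        have "E y G + \<tau> ^ 3 - x0 G = y' G - x0k G" using G by (simp add: y'_def E_def x0k)
        then show "\<bar>E y G + \<tau> ^ 3 - x0 G\<bar> < e1" using ye(2)[OF e(3)] G by (simp add: box_nbhd_def)
      qed
      moreover have "\<bar>a y' - a y - partial G a y * \<tau> ^ 3\<bar> \<le> K2 * (\<tau> ^ 3)\<^sup>2"
        unfolding y'_def
      proof (rule 2(2)[rule_format])
        show "y \<in> box_nbhd {..<k} x0k e2" using ye e by blast
        show "\<bar>y G + \<tau> ^ 3 - x0k G\<bar> < e2" using ye(2)[OF e(4)] G by (simp add: box_nbhd_def) (metis fun_upd_same lessThan_iff y'_def)
      qed
      moreover have "\<bar>v y\<bar> \<le> M * (2 * \<tau>\<^sup>2) ^ 3" "\<bar>v y'\<bar> \<le> M * (2 * \<tau>\<^sup>2) ^ 3"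
        unfolding M_def by (rule vb; use ye e yb in auto)+
      moreover have "\<Phi> (\<tau>\<^sup>2) * \<tau> ^ 3 = v y' - v y - (u (E y') - u (E y) - partial G u (E y) * \<tau> ^ 3)
          + (a y' - a y - partial G a y * \<tau> ^ 3)"
        by (simp add: \<Phi>_def v_def Ey algebra_simps flip: y_def)
      ultimately have "\<bar>\<Phi> (\<tau>\<^sup>2) * \<tau> ^ 3\<bar> \<le> 2 * (M * (2 * \<tau>\<^sup>2) ^ 3) + K1 * (\<tau> ^ 3)\<^sup>2 + K2 * (\<tau> ^ 3)\<^sup>2"
        by linarith
      also have "\<dots> = ((16 * M + K1 + K2) * \<tau> ^ 3) * \<tau> ^ 3"
        by (simp add: power_mult_distrib algebra_simps flip: power_mult power_add)
      finally show ?thesis using \<tau> by (simp add: abs_mult mult_le_cancel_right)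
    qed
    show ?thesis using deriv_eq_0_of_cubic_bound[OF \<Phi>D \<delta>(1) bound] by (simp add: \<Phi>_def)
  qed
  show "G < k \<Longrightarrow> partial G u x0 = partial G a x0k" using main by blast
  show "G < k \<Longrightarrow> L < k \<Longrightarrow> partial L (partial G u) x0 = partial L (partial G a) x0k" using main by blast
qed

text \<open>Differentiability of the curve at 0 makes its increments O(s), so the quadratic
  remainder of \<open>g\<close> divided by \<open>s\<close> tends to 0.\<close>

lemma analytic_at_chain_rule:
  assumes C: "finite C" "supp_on C w0" and g: "analytic_at C g w0"
    and W0: "W 0 = w0" and sW: "\<And>s. supp_on C (W s)"
    and WD: "\<And>c. c \<in> C \<Longrightarrow> ((\<lambda>s. W s c) has_real_derivative V c) (at 0)"
  shows "((\<lambda>s. g (W s)) has_real_derivative (\<Sum>c\<in>C. partial c g w0 * V c)) (at (0::real))"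
proof -
  obtain e K where e: "e > 0" and exp: "\<forall>y\<in>box_nbhd C w0 e.
      \<bar>g y - g w0 - (\<Sum>i\<in>C. partial i g w0 * (y i - w0 i))\<bar> \<le> K * (\<Sum>i\<in>C. \<bar>y i - w0 i\<bar>)\<^sup>2"
    by (rule analytic_at_expansion[OF C g])
  have quot: "((\<lambda>s. (W s c - w0 c) / s) \<longlongrightarrow> V c) (at 0)" if "c \<in> C" for c
    using WD[OF that] W0 by (simp add: has_field_derivative_iff)
  have cont: "((\<lambda>s. W s c - w0 c) \<longlongrightarrow> 0) (at 0)" if "c \<in> C" for c
    using DERIV_isCont[OF WD[OF that]] W0 by (simp add: isCont_def LIM_zero_iff)
  define N where "N = (\<lambda>s. \<Sum>i\<in>C. \<bar>W s i - w0 i\<bar>)"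
  define R where "R = (\<lambda>s. g (W s) - g w0 - (\<Sum>i\<in>C. partial i g w0 * (W s i - w0 i)))"
  have "\<forall>\<^sub>F s in at 0. \<forall>c\<in>C. \<bar>W s c - w0 c\<bar> < e"
    using C(1) cont tendstoD[OF _ e, of _ 0] by (intro eventually_ball_finite) fastforce+
  then have "\<forall>\<^sub>F s in at 0. norm (R s / s) \<le> K * N s * (\<Sum>i\<in>C. \<bar>(W s i - w0 i) / s\<bar>)"
    using eventually_neq_at_within[of 0 0 UNIV]
  proof eventually_elim
    fix s :: real assume s: "\<forall>c\<in>C. \<bar>W s c - w0 c\<bar> < e" "s \<noteq> 0"
    then have "W s \<in> box_nbhd C w0 e" using sW by (simp add: box_nbhd_def)
    from exp[rule_format, OF this] have "\<bar>R s\<bar> \<le> K * (N s)\<^sup>2" by (simp add: R_def N_def)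
    then have "\<bar>R s\<bar> / \<bar>s\<bar> \<le> K * (N s)\<^sup>2 / \<bar>s\<bar>" by (intro divide_right_mono) auto
    also have "\<dots> = K * N s * (\<Sum>i\<in>C. \<bar>(W s i - w0 i) / s\<bar>)"
      by (simp add: power2_eq_square N_def abs_divide flip: sum_divide_distrib)
    finally show "norm (R s / s) \<le> K * N s * (\<Sum>i\<in>C. \<bar>(W s i - w0 i) / s\<bar>)"
      by (simp add: abs_divide)
  qed
  moreover have "((\<lambda>s. K * N s * (\<Sum>i\<in>C. \<bar>(W s i - w0 i) / s\<bar>)) \<longlongrightarrow> K * (\<Sum>i\<in>C. \<bar>0\<bar>) * (\<Sum>i\<in>C. \<bar>V i\<bar>)) (at 0)"
    unfolding N_def by (intro tendsto_intros quot cont)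
  ultimately have R0: "((\<lambda>s. R s / s) \<longlongrightarrow> 0) (at 0)"
    by (intro Lim_null_comparison[where f="\<lambda>s. R s / s"]) auto
  have "((\<lambda>s. R s / s + (\<Sum>i\<in>C. partial i g w0 * ((W s i - w0 i) / s))) \<longlongrightarrow>
      0 + (\<Sum>c\<in>C. partial c g w0 * V c)) (at 0)"
    by (intro tendsto_intros R0 quot)
  moreover have "R s / s + (\<Sum>i\<in>C. partial i g w0 * ((W s i - w0 i) / s)) = (g (W s) - g w0) / s" for s
    by (simp add: R_def sum_divide_distrib diff_divide_distrib[of _ "sum _ _"])
  ultimately show ?thesis by (simp add: has_field_derivative_iff W0)
qed

lemma finite_Dset: "finite (Dset n k m)"
proof -
  have "Dset n k m = CX ` {..<n} \<union> CP ` {..<m} \<union> (\<lambda>(A, L). CQ A L) ` ({..<m} \<times> {..<k})"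
    by (auto simp: Dset_def)
  then show ?thesis by simp
qed

text \<open>Tangent vectors, over the coordinate directions, of the graph of a 1-jet with first
  derivatives \<open>P\<close> and second derivatives \<open>S\<close>; \<open>S B j i\<close> is
  the change of p^B_i in direction j.\<close>

definition jet_frame :: "nat \<Rightarrow> nat \<Rightarrow> (nat \<Rightarrow> nat \<Rightarrow> real) \<Rightarrow> (nat \<Rightarrow> nat \<Rightarrow> nat \<Rightarrow> real)
    \<Rightarrow> nat \<Rightarrow> coord \<Rightarrow> real" where
  "jet_frame n m P S j = (\<lambda>c. case c of
       CX i \<Rightarrow> (if i = j then 1 else 0)
     | CP B \<Rightarrow> (if B < m then P B j else 0)
     | CQ B i \<Rightarrow> (if B < m \<and> i < n then S B j i else 0))"

text \<open>Varying one coordinate hits both factors of the quadratic form; symmetry of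
  \<open>q\<close> merges the two resulting sums, which is why the coefficients carry the factor
  1/2.\<close>

lemma quadratic_partials:
  fixes q :: "nat \<Rightarrow> nat \<Rightarrow> real" and p :: real and b x :: "nat \<Rightarrow> real"
  assumes q: "\<And>L G. L < k \<Longrightarrow> G < k \<Longrightarrow> q L G = q G L" and G: "G < k"
  defines "a \<equiv> \<lambda>y. p + (\<Sum>L<k. b L * (y L - x L)) +
      (\<Sum>L<k. \<Sum>G<k. q L G / 2 * ((y L - x L) * (y G - x G)))"
  shows "partial G a = (\<lambda>y. b G + (\<Sum>L<k. q L G * (y L - x L)))"
    and "L < k \<Longrightarrow> partial L (partial G a) y = q L G"
proof -
  show *: "partial G a = (\<lambda>y. b G + (\<Sum>L<k. q L G * (y L - x L)))"
  proof
    fix y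
    show "partial G a y = b G + (\<Sum>L<k. q L G * (y L - x L))"
    proof (rule partial_eqI(2)[of 1])
      fix s :: real
      define h where "h = (\<lambda>L. y L - x L)"
      have hL: "y L - x L = h L" for L by (simp add: h_def)
      have h': "(y(G := y G + s)) L - x L = h L + (if L = G then s else 0)" for L
        by (simp add: h_def)
      have lin: "(\<Sum>L<k. b L * (h L + (if L = G then s else 0))) = (\<Sum>L<k. b L * h L) + b G * s"
      proof -
        have "(\<Sum>L<k. b L * (h L + (if L = G then s else 0))) = (\<Sum>L<k. b L * h L + (if L = G then b L * s else 0))"
          by (rule sum.cong) (auto simp: algebra_simps)
        then show ?thesis using G by (simp add: sum.distrib sum.delta)
      qed
      have inner: "(\<Sum>M<k. q L M / 2 * ((h L + (if L = G then s else 0)) * (h M + (if M = G then s else 0))))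
        = (\<Sum>M<k. q L M / 2 * (h L * h M)) + (if L = G then s * (\<Sum>M<k. q L M / 2 * h M) else 0)
          + q L G / 2 * (h L * s) + (if L = G then q L G / 2 * s\<^sup>2 else 0)" for L
      proof -
        have "(\<Sum>M<k. q L M / 2 * ((h L + (if L = G then s else 0)) * (h M + (if M = G then s else 0))))
          = (\<Sum>M<k. q L M / 2 * (h L * h M) + (if L = G then s else 0) * (q L M / 2 * h M)
            + (if M = G then q L M / 2 * ((h L + (if L = G then s else 0)) * s) else 0))"
          by (rule sum.cong) (auto simp: algebra_simps)
        also have "\<dots> = (\<Sum>M<k. q L M / 2 * (h L * h M)) + (if L = G then s else 0) * (\<Sum>M<k. q L M / 2 * h M)
            + q L G / 2 * ((h L + (if L = G then s else 0)) * s)"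
          using G by (simp add: sum.distrib sum_distrib_left sum.delta)
        finally show ?thesis by (auto simp: algebra_simps power2_eq_square)
      qed
      have "(\<Sum>M<k. q G M / 2 * h M) = (\<Sum>M<k. q M G / 2 * h M)"
        by (rule sum.cong) (use q G in auto)
      then have "(\<Sum>L<k. \<Sum>M<k. q L M / 2 * ((h L + (if L = G then s else 0)) * (h M + (if M = G then s else 0))))
        = (\<Sum>L<k. \<Sum>M<k. q L M / 2 * (h L * h M)) + s * (\<Sum>L<k. q L G / 2 * h L)
          + s * (\<Sum>L<k. q L G / 2 * h L) + q G G / 2 * s\<^sup>2"
        unfolding inner using G by (simp add: sum.distrib sum.delta sum_distrib_left mult_ac)
      moreover have "s * (\<Sum>L<k. q L G / 2 * h L) + s * (\<Sum>L<k. q L G / 2 * h L) = (\<Sum>L<k. q L G * h L) * s"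
        by (simp add: sum_distrib_left sum_distrib_right mult_ac flip: sum.distrib)
      ultimately have "a (y(G := y G + s)) - a y - (b G + (\<Sum>L<k. q L G * h L)) * s = q G G / 2 * s\<^sup>2"
        unfolding a_def h' lin hL distrib_right by linarith
      then show "\<bar>a (y(G := y G + s)) - a y - (b G + (\<Sum>L<k. q L G * (y L - x L))) * s\<bar>
          \<le> \<bar>q G G / 2\<bar> * s\<^sup>2"
        unfolding hL by (simp only: abs_mult) simp
    qed simp
  qed
  show "partial L (partial G a) y = q L G" if L: "L < k"
    unfolding *
  proof (rule partial_eqI(2)[of 1 _ _ _ _ 0])
    fix s :: real
    have "(\<Sum>M<k. q M G * ((y(L := y L + s)) M - x M)) = (\<Sum>M<k. q M G * (y M - x M) + (if M = L then q M G * s else 0))"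
      by (rule sum.cong) (auto simp: algebra_simps)
    then show "\<bar>b G + (\<Sum>M<k. q M G * ((y(L := y L + s)) M - x M)) - (b G + (\<Sum>M<k. q M G * (y M - x M))) - q L G * s\<bar>
      \<le> 0 * s\<^sup>2"
      using L by (simp add: sum.distrib sum.delta)
  qed simp
qed

text \<open>The second jet at \<open>w0\<close> of an approximate solution whose initial data have the prescribed
  second derivatives \<open>q\<close>.  Its tangent plane is an integral element of dimension \<open>n\<close>.\<close>
lemma approx_solvable_second_jet:
  assumes kn: "k < n" and sw: "supp_on (Dset n k m) w0"
    and F: "\<And>A \<alpha>. A < m \<Longrightarrow> k \<le> \<alpha> \<Longrightarrow> \<alpha> < n \<Longrightarrow> analytic_at (Dset n k m) (F A \<alpha>) w0"
    and sol: "approx_solvable n k m F w0"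
    and q: "\<And>A L G. A < m \<Longrightarrow> L < k \<Longrightarrow> G < k \<Longrightarrow> q A L G = q A G L"
  obtains S :: "nat \<Rightarrow> nat \<Rightarrow> nat \<Rightarrow> real" where
    "\<forall>A<m. \<forall>i<n. \<forall>j<n. S A i j = S A j i"
    "\<forall>A<m. \<forall>L<k. \<forall>G<k. S A L G = q A L G"
    "\<forall>A<m. \<forall>\<alpha>\<in>{k..<n}. \<forall>j<n. S A j \<alpha> = (\<Sum>c\<in>Dset n k m. partial c (F A \<alpha>) w0 *
        jet_frame n m (\<lambda>B j. if j < k then w0 (CQ B j) else F B j w0) S j c)"
proof -
  define x0 where "x0 = (\<lambda>i. if i < n then w0 (CX i) else 0)"
  define x0k where "x0k = (\<lambda>i. if i < k then w0 (CX i) else 0)"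
  have x0k': "x0k = (\<lambda>i. if i < k then x0 i else 0)" using kn by (auto simp: x0k_def x0_def)
  have sx0: "supp_on {..<n} x0" by (simp add: supp_on_def x0_def)
  \<comment> \<open>Polynomial initial data with first jet taken from \<open>w0\<close> and second
    derivatives \<open>q\<close>.\<close>
  define a where "a = (\<lambda>A y. w0 (CP A) + (\<Sum>L<k. w0 (CQ A L) * (y L - x0k L)) +
      (\<Sum>L<k. \<Sum>G<k. q A L G / 2 * ((y L - x0k L) * (y G - x0k G))))"
  have a_an: "analytic_at {..<k} (a A) x0k" for A
    unfolding a_def by (intro analytic_at_add analytic_at_sum analytic_at_const
      analytic_at_linear analytic_at_bilinear) auto
  have a1: "partial G (a A) x0k = w0 (CQ A G)" if "A < m" "G < k" for A G
    using quadratic_partials(1)[of k "q A" G "w0 (CP A)" "\<lambda>L. w0 (CQ A L)" x0k] q that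
    by (simp add: a_def)
  have a2: "partial L (partial G (a A)) x0k = q A L G" if "A < m" "G < k" "L < k" for A G L
    using quadratic_partials(2)[of k "q A" G L "w0 (CP A)" "\<lambda>L. w0 (CQ A L)" x0k] q that
    by (simp add: a_def)
  have "\<forall>A<m. analytic_at {..<k} (a A) x0k \<and> a A x0k = w0 (CP A)
               \<and> (\<forall>L<k. partial L (a A) x0k = w0 (CQ A L))"
    using a_an a1 by (simp add: a_def)
  then obtain u where u: "\<forall>A<m. analytic_at {..<n} (u A) x0"
    and ex1: "\<exists>K d. d > 0 \<and> (\<forall>x\<in>box_nbhd {..<n} x0 d. \<forall>A<m. \<forall>\<alpha>\<in>{k..<n}.
               \<bar>partial \<alpha> (u A) x - F A \<alpha> (jetpt n k m u x)\<bar> \<le> K * sqdist {..<n} x x0)"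
    and ex2: "\<exists>K d. d > 0 \<and> (\<forall>y\<in>box_nbhd {..<k} x0k d. \<forall>A<m.
               \<bar>u A (\<lambda>i. if i < k then y i else x0 i) - a A y\<bar> \<le> K * (sqrt (sqdist {..<k} y x0k)) ^ 3)"
    using sol unfolding approx_solvable_def Let_def x0_def[symmetric] x0k_def[symmetric] by blast
  obtain K1 d1 where d1: "d1 > 0" and b1: "\<forall>x\<in>box_nbhd {..<n} x0 d1. \<forall>A<m. \<forall>\<alpha>\<in>{k..<n}.
      \<bar>partial \<alpha> (u A) x - F A \<alpha> (jetpt n k m u x)\<bar> \<le> K1 * sqdist {..<n} x x0"
    using ex1 by blast
  obtain K2 d2 where d2: "d2 > 0" and b2: "\<forall>y\<in>box_nbhd {..<k} x0k d2. \<forall>A<m.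
      \<bar>u A (\<lambda>i. if i < k then y i else x0 i) - a A y\<bar> \<le> K2 * (sqrt (sqdist {..<k} y x0k)) ^ 3"
    using ex2 by blast
  have contact: "u A x0 = a A x0k" "\<And>G. G < k \<Longrightarrow> partial G (u A) x0 = partial G (a A) x0k"
    "\<And>G L. G < k \<Longrightarrow> L < k \<Longrightarrow> partial L (partial G (u A)) x0 = partial L (partial G (a A)) x0k"
    if A: "A < m" for A
  proof -
    have uA: "analytic_at {..<n} (u A) x0" using u A by blast
    have b: "\<bar>u A (\<lambda>i. if i < k then y i else x0 i) - a A y\<bar> \<le> K2 * sqrt (sqdist {..<k} y x0k) ^ 3"
      if "y \<in> box_nbhd {..<k} x0k d2" for y using b2 A that by blast
    note c = cubic_contact_jets_agree[OF less_imp_le[OF kn] sx0 uA x0k' a_an[of A] d2 b]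
    show "u A x0 = a A x0k" by (rule c(1))
    show "\<And>G. G < k \<Longrightarrow> partial G (u A) x0 = partial G (a A) x0k" by (rule c(2))
    show "\<And>G L. G < k \<Longrightarrow> L < k \<Longrightarrow> partial L (partial G (u A)) x0 = partial L (partial G (a A)) x0k"
      by (rule c(3))
  qed
  define S where "S = (\<lambda>A i j. partial j (partial i (u A)) x0)"
  have S_sym: "S A i j = S A j i" if "A < m" "i < n" "j < n" for A i j
    unfolding S_def by (rule partial_commute[OF _ sx0]) (use u that in auto)
  have S_blk: "S A L G = q A L G" if "A < m" "L < k" "G < k" for A L G
    using contact(3)[OF that] a2[OF that] q[OF that] by (simp add: S_def)
  \<comment> \<open>The 1-jet of \<open>u\<close> along the j-th coordinate axis through
    \<open>x0\<close>. Differentiating the equation along these curves gives all that is wanted at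
    \<open>x0\<close>.\<close>
  define W where "W = (\<lambda>j s. jetpt n k m u (x0(j := x0 j + s)))"
  have W0: "W j 0 = w0" for j
  proof
    fix c
    have ux0: "u B x0 = w0 (CP B)" if "B < m" for B using contact(1)[OF that] by (simp add: a_def)
    have W: "W j 0 c = jetpt n k m u x0 c" by (simp add: W_def)
    have x0n: "x0 i = w0 (CX i)" if "i < n" for i using that by (simp add: x0_def)
    show "W j 0 c = w0 c"
    proof (cases "c \<in> Dset n k m")
      case True
      then show ?thesis unfolding W by (auto simp: Dset_def jetpt_def x0n ux0 contact(2) a1)
    next
      case False
      then have "w0 c = 0" using sw by (simp add: supp_on_def)
      with False show ?thesis unfolding W by (cases c) (auto simp: Dset_def jetpt_def)
    qed
  qed
  have sW: "supp_on (Dset n k m) (W j s)" for j s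
    by (auto simp: W_def jetpt_def supp_on_def Dset_def split: coord.split)
  define P where "P = (\<lambda>B j. if j < k then w0 (CQ B j) else F B j w0)"
  have close: "\<bar>partial \<alpha> (u A) (x0(j := x0 j + s)) - F A \<alpha> (W j s)\<bar> \<le> K1 * s\<^sup>2"
    if "A < m" "k \<le> \<alpha>" "\<alpha> < n" "j < n" "\<bar>s\<bar> < d1" for A \<alpha> j s
  proof -
    have "x0(j := x0 j + s) \<in> box_nbhd {..<n} x0 d1"
      using that box_nbhd_center[OF sx0 d1] by (intro box_nbhd_upd) auto
    moreover have "sqdist {..<n} (x0(j := x0 j + s)) x0 = (\<Sum>i<n. if i = j then s\<^sup>2 else 0)"
      unfolding sqdist_def by (rule sum.cong) auto
    moreover have "\<alpha> \<in> {k..<n}" using that by simp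
    ultimately show ?thesis using b1[rule_format, of "x0(j := x0 j + s)" A \<alpha>] that
      by (simp only: W_def sum.delta[OF finite_lessThan] lessThan_iff if_True)
  qed
  \<comment> \<open>For derivatives in the initial plane this is the contact of \<open>u\<close>
    with the data; in the other directions the residual bound at s = 0 forces the equation to hold
    exactly at \<open>x0\<close>.\<close>
  have P: "partial j (u B) x0 = P B j" if "B < m" "j < n" for B j
  proof (cases "j < k")
    case True
    then show ?thesis using contact(2) a1 that by (simp add: P_def)
  next
    case False
    then show ?thesis using close[of B j j 0] that d1 W0 by (simp add: P_def)
  qed
  have WD: "((\<lambda>s. W j s c) has_real_derivative jet_frame n m P S j c) (at 0)"
    if j: "j < n" and c: "c \<in> Dset n k m" for j c
  proof (cases c)
    case (CX i)
    then have "(\<lambda>s. W j s c) = (\<lambda>s. x0 i + (if i = j then s else 0))" "jet_frame n m P S j c = (if i = j then 1 else 0)"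
      using c by (auto simp: W_def jetpt_def Dset_def jet_frame_def)
    then show ?thesis by (auto intro!: derivative_eq_intros)
  next
    case (CP B)
    then have B: "B < m" using c by (auto simp: Dset_def)
    have "((\<lambda>s. u B (x0(j := x0 j + s))) has_real_derivative partial j (u B) x0) (at 0)"
      using u B j by (intro analytic_at_has_partial[of "{..<n}"] sx0) auto
    then show ?thesis using CP B P[OF B j] by (simp add: W_def jetpt_def jet_frame_def)
  next
    case (CQ B G)
    then have B: "B < m" "G < k" using c by (auto simp: Dset_def)
    have "((\<lambda>s. partial G (u B) (x0(j := x0 j + s))) has_real_derivative partial j (partial G (u B)) x0) (at 0)"
      using u B j kn by (intro analytic_at_has_partial[of "{..<n}"] analytic_at_partial sx0) auto
    then show ?thesis using CQ B S_sym[of B G j] j kn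
      by (simp add: W_def jetpt_def jet_frame_def) (simp add: S_def)
  qed
  have S_eq: "S A j \<alpha> = (\<Sum>c\<in>Dset n k m. partial c (F A \<alpha>) w0 * jet_frame n m P S j c)"
    if A: "A < m" "k \<le> \<alpha>" "\<alpha> < n" and j: "j < n" for A \<alpha> j
  proof -
    \<comment> \<open>On a coordinate axis the residual is O(s^2), so its derivative at 0 vanishes.
      Computing this derivative by the chain rule yields the once differentiated equation.\<close>
    let ?\<Delta> = "\<lambda>s. partial \<alpha> (u A) (x0(j := x0 j + s)) - F A \<alpha> (W j s)"
    have "((\<lambda>s. F A \<alpha> (W j s)) has_real_derivative
        (\<Sum>c\<in>Dset n k m. partial c (F A \<alpha>) w0 * jet_frame n m P S j c)) (at 0)"
      by (rule analytic_at_chain_rule[OF finite_Dset sw F[OF A] W0 sW WD[OF j]])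
    moreover have "((\<lambda>s. partial \<alpha> (u A) (x0(j := x0 j + s))) has_real_derivative S A \<alpha> j) (at 0)"
      unfolding S_def using u A j kn
      by (intro analytic_at_has_partial[of "{..<n}"] analytic_at_partial sx0) auto
    ultimately have 1: "(?\<Delta> has_real_derivative
        (S A \<alpha> j - (\<Sum>c\<in>Dset n k m. partial c (F A \<alpha>) w0 * jet_frame n m P S j c))) (at 0)"
      by (intro DERIV_diff)
    have \<Delta>0: "?\<Delta> 0 = 0" using close[OF A j, of 0] d1 by simp
    have "(?\<Delta> has_real_derivative 0) (at 0)"
      by (rule has_real_derivative_of_quadratic_bound[OF d1, of _ _ K1])
        (use \<Delta>0 close[OF A j] in simp)
    from DERIV_unique[OF 1 this] show ?thesis using S_sym[of A j \<alpha>] A j by simp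
  qed
  show thesis
  proof (rule that[of S])
    show "\<forall>A<m. \<forall>i<n. \<forall>j<n. S A i j = S A j i" using S_sym by blast
    show "\<forall>A<m. \<forall>L<k. \<forall>G<k. S A L G = q A L G" using S_blk by blast
    show "\<forall>A<m. \<forall>\<alpha>\<in>{k..<n}. \<forall>j<n. S A j \<alpha> = (\<Sum>c\<in>Dset n k m. partial c (F A \<alpha>) w0 *
        jet_frame n m (\<lambda>B j. if j < k then w0 (CQ B j) else F B j w0) S j c)"
      using S_eq unfolding P_def by auto
  qed
qed

section \<open>Integral elements of dimension n\<close>

lemma contraction_fixpoint_zero:
  fixes x :: "'a \<Rightarrow> real"
  assumes "finite J" "\<theta> < 1"
    and b: "\<And>i c. i \<in> J \<Longrightarrow> (\<forall>j\<in>J. \<bar>x j\<bar> \<le> c) \<Longrightarrow> \<bar>x i\<bar> \<le> \<theta> * c"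
    and i: "i \<in> J"
  shows "x i = 0"
proof -
  define c where "c = Max ((\<lambda>j. \<bar>x j\<bar>) ` J)"
  have c: "\<forall>j\<in>J. \<bar>x j\<bar> \<le> c" using assms(1) by (simp add: c_def)
  have "c \<in> (\<lambda>j. \<bar>x j\<bar>) ` J" unfolding c_def using assms(1) i by (intro Max_in) auto
  then obtain j where j: "j \<in> J" "c = \<bar>x j\<bar>" by blast
  then have "(1 - \<theta>) * c \<le> 0" using b[OF j(1) c] by (simp add: algebra_simps)
  then have "c \<le> 0" using assms(2) by (simp add: mult_le_0_iff)
  then show ?thesis using c i by force
qed

lemma abs_weighted_sum_le:
  fixes M x :: "'a \<Rightarrow> real"
  assumes "(\<Sum>j\<in>J. \<bar>M j\<bar>) \<le> \<theta>" "\<forall>j\<in>J. \<bar>x j\<bar> \<le> c" "0 \<le> c"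
  shows "\<bar>\<Sum>j\<in>J. M j * x j\<bar> \<le> \<theta> * c"
proof -
  have "\<bar>\<Sum>j\<in>J. M j * x j\<bar> \<le> (\<Sum>j\<in>J. \<bar>M j\<bar> * c)"
    by (rule order_trans[OF sum_abs sum_mono]) (use assms in \<open>auto simp: abs_mult intro!: mult_left_mono\<close>)
  also have "\<dots> \<le> \<theta> * c" using assms by (simp add: mult_right_mono flip: sum_distrib_right)
  finally show ?thesis .
qed

text \<open>Picard iteration starting from 0: successive differences shrink by the factor
  \<open>\<theta>\<close> in the maximum norm over \<open>J\<close>.\<close>

lemma identity_plus_contraction_solvable:
  fixes M :: "'a \<Rightarrow> 'a \<Rightarrow> real"
  assumes J: "finite J" and M: "\<And>i. i \<in> J \<Longrightarrow> (\<Sum>j\<in>J. \<bar>M i j\<bar>) \<le> \<theta>" and \<theta>: "0 \<le> \<theta>" "\<theta> < 1"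
  obtains x where "\<forall>i\<in>J. x i + (\<Sum>j\<in>J. M i j * x j) = r i"
proof -
  define X where "X = rec_nat (\<lambda>i. 0) (\<lambda>_ y i. r i - (\<Sum>j\<in>J. M i j * y j))"
  have X0: "X 0 = (\<lambda>i. 0)" and XS: "X (Suc p) = (\<lambda>i. r i - (\<Sum>j\<in>J. M i j * X p j))" for p
    by (simp_all add: X_def)
  define R where "R = (\<Sum>i\<in>J. \<bar>r i\<bar>)"
  have R0: "0 \<le> R" by (simp add: R_def sum_nonneg)
  have step: "\<forall>i\<in>J. \<bar>X (Suc p) i - X p i\<bar> \<le> R * \<theta> ^ p" for p
  proof (induction p)
    case 0
    then show ?case using J by (auto simp: XS X0 R_def intro: member_le_sum)
  next
    case (Suc p)
    show ?case
    proof
      fix i assume i: "i \<in> J"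
      have "X (Suc (Suc p)) i - X (Suc p) i = - (\<Sum>j\<in>J. M i j * (X (Suc p) j - X p j))"
        by (simp add: XS[of "Suc p"] XS[of p] right_diff_distrib sum_subtractf)
      then have "\<bar>X (Suc (Suc p)) i - X (Suc p) i\<bar> = \<bar>\<Sum>j\<in>J. M i j * (X (Suc p) j - X p j)\<bar>" by simp
      also have "\<dots> \<le> \<theta> * (R * \<theta> ^ p)"
        using abs_weighted_sum_le[OF M[OF i] Suc.IH] R0 \<theta> by simp
      finally show "\<bar>X (Suc (Suc p)) i - X (Suc p) i\<bar> \<le> R * \<theta> ^ Suc p" by (simp add: mult_ac)
    qed
  qed
  have conv: "convergent (\<lambda>p. X p i)" if i: "i \<in> J" for i
  proof -
    have "summable (\<lambda>p. X (Suc p) i - X p i)"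
    proof (rule summable_comparison_test')
      show "summable (\<lambda>p. R * \<theta> ^ p)" using \<theta> by (intro summable_mult summable_geometric) auto
      show "norm (X (Suc p) i - X p i) \<le> R * \<theta> ^ p" if "0 \<le> p" for p using step i by auto
    qed
    then have "convergent (\<lambda>p. \<Sum>q<p. X (Suc q) i - X q i)" by (simp add: summable_iff_convergent)
    moreover have "(\<Sum>q<p. X (Suc q) i - X q i) = X p i" for p
      using sum_lessThan_telescope[of "\<lambda>q. X q i" p] by (simp add: X0)
    ultimately show ?thesis by simp
  qed
  define x where "x = (\<lambda>i. lim (\<lambda>p. X p i))"
  have lim: "(\<lambda>p. X p i) \<longlonglongrightarrow> x i" if "i \<in> J" for i
    using conv[OF that] unfolding x_def by (simp add: convergent_LIMSEQ_iff)
  have "x i + (\<Sum>j\<in>J. M i j * x j) = r i" if i: "i \<in> J" for i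
  proof -
    have "(\<lambda>p. r i - (\<Sum>j\<in>J. M i j * X p j)) \<longlonglongrightarrow> r i - (\<Sum>j\<in>J. M i j * x j)"
      by (intro tendsto_intros lim)
    moreover have "(\<lambda>p. X (Suc p) i) \<longlonglongrightarrow> x i" using lim[OF i] by (rule LIMSEQ_Suc)
    ultimately show ?thesis using LIMSEQ_unique by (fastforce simp: XS)
  qed
  then show thesis using that by blast
qed

section \<open>Linearity of the generating forms\<close>

lemma eta_diff: "eta n A z (\<lambda>c. v c - v' c) = eta n A z v - eta n A z v'"
  by (simp add: eta_def right_diff_distrib sum_subtractf)

lemma eta_sum: "eta n A z (\<lambda>c. \<Sum>i\<in>I. \<mu> i * g i c) = (\<Sum>i\<in>I. \<mu> i * eta n A z (g i))"
  unfolding eta_def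
  by (simp add: right_diff_distrib sum_subtractf sum_distrib_left mult_ac) (rule sum.swap)

lemma dfA_diff: "dfA n k m F A \<alpha> z (\<lambda>c. v c - v' c) = dfA n k m F A \<alpha> z v - dfA n k m F A \<alpha> z v'"
  by (simp add: dfA_def right_diff_distrib sum_subtractf)

lemma dfA_sum: "dfA n k m F A \<alpha> z (\<lambda>c. \<Sum>i\<in>I. \<mu> i * g i c) = (\<Sum>i\<in>I. \<mu> i * dfA n k m F A \<alpha> z (g i))"
proof -
  have "(\<Sum>c\<in>Dset n k m. P c * (\<Sum>i\<in>I. \<mu> i * g i c)) = (\<Sum>i\<in>I. \<mu> i * (\<Sum>c\<in>Dset n k m. P c * g i c))"
    for P :: "coord \<Rightarrow> real"
    unfolding sum_distrib_left by (subst sum.swap) (simp add: mult.left_commute)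
  then show ?thesis unfolding dfA_def by (simp add: right_diff_distrib sum_subtractf)
qed

lemma Omega_antisym: "Omega n A v v' = - Omega n A v' v"
  by (simp add: Omega_def sum_negf[symmetric])

lemma Omega_diff_left: "Omega n A (\<lambda>c. v c - v' c) w = Omega n A v w - Omega n A v' w"
  by (simp add: Omega_def sum_subtractf[symmetric] algebra_simps)

lemma Omega_sum_left: "Omega n A (\<lambda>c. \<Sum>i\<in>I. \<mu> i * g i c) w = (\<Sum>i\<in>I. \<mu> i * Omega n A (g i) w)"
proof -
  have "Omega n A (\<lambda>c. \<Sum>i\<in>I. \<mu> i * g i c) w
      = (\<Sum>j<n. \<Sum>i\<in>I. \<mu> i * (g i (CQ A j) * w (CX j) - w (CQ A j) * g i (CX j)))"
    unfolding Omega_def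
    by (simp add: sum_distrib_left sum_distrib_right sum_subtractf[symmetric] algebra_simps)
  also have "\<dots> = (\<Sum>i\<in>I. \<mu> i * Omega n A (g i) w)"
    unfolding Omega_def sum_distrib_left by (rule sum.swap)
  finally show ?thesis .
qed

lemma Omega_sum_right: "Omega n A w (\<lambda>c. \<Sum>i\<in>I. \<mu> i * g i c) = (\<Sum>i\<in>I. \<mu> i * Omega n A w (g i))"
  unfolding Omega_antisym[of n A w] Omega_sum_left by (simp add: sum_negf)

lemma supp_on_diff: "supp_on C v \<Longrightarrow> supp_on C v' \<Longrightarrow> supp_on C (\<lambda>c. v c - v' c)"
  by (simp add: supp_on_def)

lemma supp_on_sum: "(\<And>i. i \<in> I \<Longrightarrow> supp_on C (g i)) \<Longrightarrow> supp_on C (\<lambda>c. \<Sum>i\<in>I. \<mu> i * g i c)"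
  by (simp add: supp_on_def)

text \<open>The conditions on a single vector of an integral element, which are linear; isotropy for
  \<open>Omega\<close> concerns pairs of vectors and is kept apart.\<close>

definition tangential :: "nat \<Rightarrow> nat \<Rightarrow> nat \<Rightarrow> rhs \<Rightarrow> (coord \<Rightarrow> real) \<Rightarrow> (coord \<Rightarrow> real) \<Rightarrow> bool" where
  "tangential n k m F z v \<longleftrightarrow> supp_on (Zc n m) v \<and>
     (\<forall>A<m. eta n A z v = 0 \<and> (\<forall>\<alpha>\<in>{k..<n}. dfA n k m F A \<alpha> z v = 0))"

lemma tangential_diff:
  "tangential n k m F z v \<Longrightarrow> tangential n k m F z v' \<Longrightarrow> tangential n k m F z (\<lambda>c. v c - v' c)"
  by (simp add: tangential_def eta_diff dfA_diff supp_on_diff)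

lemma tangential_sum:
  "(\<And>i. i \<in> I \<Longrightarrow> tangential n k m F z (g i)) \<Longrightarrow> tangential n k m F z (\<lambda>c. \<Sum>i\<in>I. \<mu> i * g i c)"
  by (simp add: tangential_def eta_sum dfA_sum supp_on_sum)

lemma sum_Dset:
  fixes f :: "coord \<Rightarrow> real"
  shows "(\<Sum>c\<in>Dset n k m. f c) = (\<Sum>i<n. f (CX i)) + (\<Sum>A<m. f (CP A)) + (\<Sum>(A, L)\<in>{..<m} \<times> {..<k}. f (CQ A L))"
proof -
  have D: "Dset n k m = (CX ` {..<n} \<union> CP ` {..<m}) \<union> (\<lambda>(A, L). CQ A L) ` ({..<m} \<times> {..<k})"
    by (auto simp: Dset_def)
  have i: "inj_on (\<lambda>(A, L). CQ A L) ({..<m} \<times> {..<k})" by (auto simp: inj_on_def)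
  have "(\<Sum>c\<in>Dset n k m. f c) = (\<Sum>c\<in>CX ` {..<n}. f c) + (\<Sum>c\<in>CP ` {..<m}. f c)
      + (\<Sum>c\<in>(\<lambda>(A, L). CQ A L) ` ({..<m} \<times> {..<k}). f c)"
    unfolding D by (subst sum.union_disjoint, auto)+
  then show ?thesis
    by (simp add: sum.reindex[OF i] sum.reindex inj_on_def case_prod_beta)
qed

text \<open>Without an \<open>x\<close>-part, \<open>eta\<close> reduces to the
  \<open>p\<close>-part, and \<open>dfA\<close> expresses the components of index at least k through
  those of index below k. Only the m k components \<open>CQ B G\<close> with \<open>G < k\<close>
  stay free.\<close>

lemma tangential_vertical:
  assumes v: "tangential n k m F z v" and x: "\<And>i. i < n \<Longrightarrow> v (CX i) = 0" and A: "A < m"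
  shows "v (CP A) = 0"
    and "k \<le> \<alpha> \<Longrightarrow> \<alpha> < n \<Longrightarrow> v (CQ A \<alpha>) =
      (\<Sum>(B, G)\<in>{..<m} \<times> {..<k}. partial (CQ B G) (F A \<alpha>) (projD n k m z) * v (CQ B G))"
proof -
  have p: "v (CP B) = 0" if "B < m" for B
    using v that x by (simp add: tangential_def eta_def)
  show "v (CP A) = 0" by (rule p[OF A])
  assume "k \<le> \<alpha>" "\<alpha> < n"
  then have "dfA n k m F A \<alpha> z v = 0" using v A by (simp add: tangential_def)
  then show "v (CQ A \<alpha>) =
      (\<Sum>(B, G)\<in>{..<m} \<times> {..<k}. partial (CQ B G) (F A \<alpha>) (projD n k m z) * v (CQ B G))"
    unfolding dfA_def sum_Dset using p x by simp
qed

text \<open>The basis, normalised to project onto the coordinate vectors of the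
  \<open>x\<close>-space, of an n-plane on which the forms \<open>eta\<close>, \<open>dfA\<close>
  and \<open>Omega\<close> vanish; the equations \<open>fA = 0\<close> at the base point are kept
  separate.\<close>

definition integral_frame :: "nat \<Rightarrow> nat \<Rightarrow> nat \<Rightarrow> rhs \<Rightarrow> (coord \<Rightarrow> real) \<Rightarrow> (nat \<Rightarrow> coord \<Rightarrow> real) \<Rightarrow> bool" where
  "integral_frame n k m F z g \<longleftrightarrow>
     (\<forall>i<n. tangential n k m F z (g i) \<and> (\<forall>j<n. g i (CX j) = (if j = i then 1 else 0)) \<and>
        (\<forall>j<n. \<forall>A<m. Omega n A (g i) (g j) = 0))"

text \<open>For a normalised frame, isotropy is the symmetry of second derivatives.\<close>

lemma integral_frame_swap:
  assumes "integral_frame n k m F z g" "A < m" "i < n" "j < n"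
  shows "g i (CQ A j) = g j (CQ A i)"
proof -
  have "Omega n A (g i) (g j) = (\<Sum>r<n. (if r = j then g i (CQ A r) else 0) - (if r = i then g j (CQ A r) else 0))"
    unfolding Omega_def by (rule sum.cong) (use assms in \<open>auto simp: integral_frame_def\<close>)
  then have "Omega n A (g i) (g j) = g i (CQ A j) - g j (CQ A i)"
    using assms(3,4) by (simp add: sum_subtractf sum.delta)
  then show ?thesis using assms by (simp add: integral_frame_def)
qed

lemma integral_frame_sum_CX:
  assumes "integral_frame n k m F z g" "j < n"
  shows "(\<Sum>i<n. \<mu> i * g i (CX j)) = \<mu> j"
proof -
  have "(\<Sum>i<n. \<mu> i * g i (CX j)) = (\<Sum>i<n. if i = j then \<mu> i else 0)"
    by (rule sum.cong) (use assms in \<open>auto simp: integral_frame_def\<close>)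
  then show ?thesis using assms(2) by (simp add: sum.delta)
qed

lemma integral_frame_isotropic:
  assumes "integral_frame n k m F z g" "A < m"
  shows "Omega n A (\<lambda>c. \<Sum>i<n. \<mu> i * g i c) (\<lambda>c. \<Sum>i<n. \<nu> i * g i c) = 0"
  using assms by (simp add: Omega_sum_left Omega_sum_right integral_frame_def)

lemma integral_frame_tangential:
  assumes "integral_frame n k m F z g"
  shows "tangential n k m F z (\<lambda>c. \<Sum>i<n. \<mu> i * g i c)"
  using assms by (intro tangential_sum) (simp add: integral_frame_def)

text \<open>The equations \<open>fA = 0\<close> identify the first derivatives of the approximate
  solution with the coordinates of \<open>z\<close>, which makes \<open>eta\<close> vanish on the
  frame; \<open>dfA\<close> vanishes by the differentiated equation and \<open>Omega\<close> by
  symmetry of second derivatives.\<close>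

lemma integral_frame_exists:
  assumes kn: "k < n" and sw: "supp_on (Dset n k m) (projD n k m z)"
    and F: "\<And>A \<alpha>. A < m \<Longrightarrow> k \<le> \<alpha> \<Longrightarrow> \<alpha> < n \<Longrightarrow> analytic_at (Dset n k m) (F A \<alpha>) (projD n k m z)"
    and sol: "approx_solvable n k m F (projD n k m z)"
    and f: "\<forall>A<m. \<forall>\<alpha>\<in>{k..<n}. fA n k m F A \<alpha> z = 0"
    and q: "\<And>A L G. A < m \<Longrightarrow> L < k \<Longrightarrow> G < k \<Longrightarrow> q A L G = q A G L"
  obtains g where "integral_frame n k m F z g"
    "\<forall>A<m. \<forall>L<k. \<forall>G<k. g L (CQ A G) = q A L G"
proof -
  let ?w = "projD n k m z"
  let ?P = "\<lambda>B j. if j < k then ?w (CQ B j) else F B j ?w"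
  obtain S where S1: "\<forall>A<m. \<forall>i<n. \<forall>j<n. S A i j = S A j i"
    and S2: "\<forall>A<m. \<forall>L<k. \<forall>G<k. S A L G = q A L G"
    and S3: "\<forall>A<m. \<forall>\<alpha>\<in>{k..<n}. \<forall>j<n. S A j \<alpha> = (\<Sum>c\<in>Dset n k m. partial c (F A \<alpha>) ?w *
        jet_frame n m ?P S j c)"
    by (rule approx_solvable_second_jet[OF kn sw F sol q])
  define g where "g = jet_frame n m ?P S"
  have gX: "g i (CX j) = (if j = i then 1 else 0)" for i j by (simp add: g_def jet_frame_def)
  have gQ: "g i (CQ A j) = S A i j" if "A < m" "j < n" for i j A using that by (simp add: g_def jet_frame_def)
  have gP: "g i (CP A) = z (CQ A i)" if "A < m" "i < n" for i A
    using that f by (auto simp: g_def jet_frame_def fA_def projD_def Dset_def)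
  have "integral_frame n k m F z g"
    unfolding integral_frame_def
  proof (intro allI impI conjI)
    fix i assume i: "i < n"
    have "supp_on (Zc n m) (g i)"
      using i by (auto simp: supp_on_def g_def jet_frame_def Zc_def split: coord.split)
    moreover have "eta n A z (g i) = 0" if A: "A < m" for A
      unfolding eta_def gX gP[OF A i] using i by (simp add: if_distrib sum.delta cong: if_cong)
    moreover have "dfA n k m F A \<alpha> z (g i) = 0" if "A < m" "\<alpha> \<in> {k..<n}" for A \<alpha>
      unfolding dfA_def using S3 i that gQ[of A \<alpha> i] by (simp add: g_def)
    ultimately show "tangential n k m F z (g i)" by (simp add: tangential_def)
    show "g i (CX j) = (if j = i then 1 else 0)" for j by (rule gX)
    show "Omega n A (g i) (g j) = 0" if j: "j < n" and A: "A < m" for j A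
    proof -
      have "Omega n A (g i) (g j) = (\<Sum>r<n. (if r = j then S A i r else 0) - (if r = i then S A j r else 0))"
        unfolding Omega_def by (rule sum.cong) (use A in \<open>auto simp: gX gQ\<close>)
      then show ?thesis using S1 i j A by (simp add: sum_subtractf sum.delta)
    qed
  qed
  moreover have "\<forall>A<m. \<forall>L<k. \<forall>G<k. g L (CQ A G) = q A L G"
    using S2 gQ kn by auto
  ultimately show thesis by (rule that)
qed

text \<open>This matrix vanishes when the element projects onto the coordinate \<open>l\<close>-plane of the
  \<open>x\<close>-space, as \<open>E\<^sub>0\<close> does, and it is the only obstruction to solving for the second derivatives.\<close>
definition tilt :: "nat \<Rightarrow> nat \<Rightarrow> nat \<Rightarrow> nat \<Rightarrow> rhs \<Rightarrow> (xcoord \<Rightarrow> real) \<Rightarrow> nat \<times> nat \<Rightarrow> nat \<times> nat \<Rightarrow> real" where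
  "tilt n k m l F t = (\<lambda>(A, L) (B, G).
     \<Sum>b\<in>{l..<n}. t (Cb b L) * partial (CQ B G) (F A b) (projD n k m (zpart t)))"

text \<open>Row sums serve existence and uniqueness of the second derivatives, column sums the
  transposed system for the differentials. A common bound \<theta> must satisfy \<theta> (2 +
  \<theta>) < 1 for the antisymmetric part to vanish, that is \<theta> < sqrt 2 - 1; the value 1/3
  does.\<close>

locale tilted_element =
  fixes n k m l :: nat and F :: rhs and t :: "xcoord \<Rightarrow> real"
  assumes kn: "k < n" and kl: "k \<le> l" and ln: "l \<le> n"
    and supp_t: "supp_on (chartC n m l) t"
    and rows: "\<And>i. i \<in> {..<m} \<times> {..<k} \<Longrightarrow> (\<Sum>j\<in>{..<m} \<times> {..<k}. \<bar>tilt n k m l F t i j\<bar>) \<le> 1 / 3"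
    and cols: "\<And>j. j \<in> {..<m} \<times> {..<k} \<Longrightarrow> (\<Sum>i\<in>{..<m} \<times> {..<k}. \<bar>tilt n k m l F t i j\<bar>) \<le> 1 / 3"
begin

abbreviation "z \<equiv> zpart t"
abbreviation "e \<equiv> ebasis n l t"
abbreviation "J \<equiv> {..<m} \<times> {..<k}"
abbreviation "M \<equiv> tilt n k m l F t"

section \<open>Elements with small tilt\<close>

lemma sum_ebasis:
  assumes "a < l"
  shows "(\<Sum>i<n. e a (CX i) * f i) = f a + (\<Sum>b\<in>{l..<n}. t (Cb b a) * f b)"
proof -
  have "{..<n} = {..<l} \<union> {l..<n}" using ln by auto
  then have "(\<Sum>i<n. e a (CX i) * f i) = (\<Sum>i<l. e a (CX i) * f i) + (\<Sum>b\<in>{l..<n}. e a (CX b) * f b)"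
    by (simp add: sum.union_disjoint ivl_disj_int)
  also have "(\<Sum>i<l. e a (CX i) * f i) = (\<Sum>i<l. if i = a then f i else 0)"
    by (rule sum.cong) (auto simp: ebasis_def)
  also have "\<dots> = f a" using assms by (simp add: sum.delta)
  also have "(\<Sum>b\<in>{l..<n}. e a (CX b) * f b) = (\<Sum>b\<in>{l..<n}. t (Cb b a) * f b)"
    by (rule sum.cong) (use assms in \<open>auto simp: ebasis_def\<close>)
  finally show ?thesis .
qed

lemma supp_ebasis: "a < l \<Longrightarrow> supp_on (Zc n m) (e a)"
  using supp_t ln by (auto simp: supp_on_def ebasis_def Zc_def chartC_def split: coord.split)

lemma sum_tilt:
  assumes "A < m" "L < k"
  shows "(\<Sum>b\<in>{l..<n}. t (Cb b L) * (\<Sum>(B, G)\<in>J. partial (CQ B G) (F A b) (projD n k m z) * y (B, G)))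
    = (\<Sum>j\<in>J. M (A, L) j * y j)"
proof -
  have "(\<Sum>j\<in>J. M (A, L) j * y j) = (\<Sum>j\<in>J. \<Sum>b\<in>{l..<n}. t (Cb b L) * (partial (CQ (fst j) (snd j)) (F A b) (projD n k m z) * y j))"
    by (rule sum.cong) (auto simp: tilt_def sum_distrib_right mult.assoc)
  also have "\<dots> = (\<Sum>b\<in>{l..<n}. \<Sum>j\<in>J. t (Cb b L) * (partial (CQ (fst j) (snd j)) (F A b) (projD n k m z) * y j))"
    by (rule sum.swap)
  finally show ?thesis by (simp add: sum_distrib_left case_prod_beta)
qed

text \<open>Only the \<open>x\<close>-part of \<open>e L\<close> meets a vertical vector. Its
  entries with index b from l on bring in the components \<open>CQ A b\<close>, which the equations
  \<open>dfA = 0\<close> eliminate because l is at least k; what is left is 1 + M acting on the free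
  components.\<close>

lemma Omega_vertical_ebasis:
  assumes v: "tangential n k m F z v" and x: "\<And>i. i < n \<Longrightarrow> v (CX i) = 0" and A: "A < m" and L: "L < k"
  shows "Omega n A v (e L) = v (CQ A L) + (\<Sum>j\<in>J. M (A, L) j * v (CQ (fst j) (snd j)))"
proof -
  have "Omega n A v (e L) = (\<Sum>i<n. e L (CX i) * v (CQ A i))"
    unfolding Omega_def by (rule sum.cong) (use x in auto)
  also have "\<dots> = v (CQ A L) + (\<Sum>b\<in>{l..<n}. t (Cb b L) * v (CQ A b))"
    by (rule sum_ebasis) (use L kl in auto)
  also have "(\<Sum>b\<in>{l..<n}. t (Cb b L) * v (CQ A b)) =
     (\<Sum>b\<in>{l..<n}. t (Cb b L) * (\<Sum>(B, G)\<in>J. partial (CQ B G) (F A b) (projD n k m z) * v (CQ B G)))"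
    by (rule sum.cong) (use tangential_vertical(2)[OF v x A] kl in auto)
  also have "\<dots> = (\<Sum>j\<in>J. M (A, L) j * v (CQ (fst j) (snd j)))"
    using sum_tilt[OF A L, of "\<lambda>j. v (CQ (fst j) (snd j))"] by simp
  finally show ?thesis .
qed

text \<open>By \<open>Omega_vertical_ebasis\<close> the free components lie in the kernel of 1 + M,
  which is trivial by the row bound; they determine all other components.\<close>

lemma vertical_polar_zero:
  assumes v: "tangential n k m F z v" and x: "\<And>i. i < n \<Longrightarrow> v (CX i) = 0"
    and O: "\<And>A L. A < m \<Longrightarrow> L < k \<Longrightarrow> Omega n A v (e L) = 0"
  shows "v = (\<lambda>c. 0)"
proof -
  have JQ: "v (CQ (fst i) (snd i)) = 0" if i: "i \<in> J" for i
  proof (rule contraction_fixpoint_zero[of J "1/3" "\<lambda>i. v (CQ (fst i) (snd i))"])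
    fix i c assume i: "i \<in> J" and c: "\<forall>j\<in>J. \<bar>v (CQ (fst j) (snd j))\<bar> \<le> c"
    have c0: "0 \<le> c" using c i by force
    have "v (CQ (fst i) (snd i)) = - (\<Sum>j\<in>J. M i j * v (CQ (fst j) (snd j)))"
      using Omega_vertical_ebasis[OF v x, of "fst i" "snd i"] O[of "fst i" "snd i"] i by auto
    then show "\<bar>v (CQ (fst i) (snd i))\<bar> \<le> 1 / 3 * c"
      using abs_weighted_sum_le[OF rows[OF i] c c0] by simp
  qed (use i in auto)
  show ?thesis
  proof
    fix c
    show "v c = 0"
    proof (cases "c \<in> Zc n m")
      case False
      then show ?thesis using v by (simp add: tangential_def supp_on_def)
    next
      case True
      then consider (x) i where "c = CX i" "i < n" | (p) A where "c = CP A" "A < m"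
        | (q) A j where "c = CQ A j" "A < m" "j < n" by (auto simp: Zc_def)
      then show ?thesis
      proof cases
        case q
        have "v (CQ A j) = 0"
        proof (cases "j < k")
          case True
          then show ?thesis using JQ[of "(A, j)"] q by simp
        next
          case False
          then have "v (CQ A j) = (\<Sum>(B, G)\<in>J. partial (CQ B G) (F A j) (projD n k m z) * v (CQ B G))"
            using tangential_vertical(2)[OF v x] q by simp
          also have "\<dots> = 0" using JQ by (intro sum.neutral) auto
          finally show ?thesis .
        qed
        then show ?thesis using q by simp
      qed (use x tangential_vertical(1)[OF v x] in auto)
    qed
  qed
qed

text \<open>Swapping indices turns the difference of the two frames in direction b into a component
  of the single vertical vector g_G - g0_G, to which the equations \<open>dfA = 0\<close> apply. For
  fixed G this is 1 + M acting on the pairs (A, L), so the systems for different G decouple.\<close>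

lemma frame_difference:
  assumes g: "integral_frame n k m F z g" and g0: "integral_frame n k m F z g0"
    and A: "A < m" and L: "L < k" and G: "G < k"
  shows "(\<Sum>i<n. e L (CX i) * (g i (CQ A G) - g0 i (CQ A G))) =
     (g L (CQ A G) - g0 L (CQ A G)) + (\<Sum>j\<in>J. M (A, L) j * (g G (CQ (fst j) (snd j)) - g0 G (CQ (fst j) (snd j))))"
proof -
  let ?d = "\<lambda>c. g G c - g0 G c"
  have Gn: "G < n" using G kn by simp
  have d: "tangential n k m F z ?d" "\<And>i. i < n \<Longrightarrow> ?d (CX i) = 0"
    using g g0 Gn by (auto simp: integral_frame_def intro!: tangential_diff)
  have "(\<Sum>i<n. e L (CX i) * (g i (CQ A G) - g0 i (CQ A G))) = (g L (CQ A G) - g0 L (CQ A G))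
     + (\<Sum>b\<in>{l..<n}. t (Cb b L) * (g b (CQ A G) - g0 b (CQ A G)))"
    by (rule sum_ebasis) (use L kl in auto)
  also have "(\<Sum>b\<in>{l..<n}. t (Cb b L) * (g b (CQ A G) - g0 b (CQ A G))) =
    (\<Sum>b\<in>{l..<n}. t (Cb b L) * (\<Sum>(B, S)\<in>J. partial (CQ B S) (F A b) (projD n k m z) * ?d (CQ B S)))"
  proof (rule sum.cong)
    fix b assume b: "b \<in> {l..<n}"
    then have "g b (CQ A G) - g0 b (CQ A G) = ?d (CQ A b)"
      using integral_frame_swap[OF g A _ Gn] integral_frame_swap[OF g0 A _ Gn] by simp
    also have "\<dots> = (\<Sum>(B, S)\<in>J. partial (CQ B S) (F A b) (projD n k m z) * ?d (CQ B S))"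
      by (rule tangential_vertical(2)[OF d A]) (use b kl in auto)
    finally show "t (Cb b L) * (g b (CQ A G) - g0 b (CQ A G)) =
      t (Cb b L) * (\<Sum>(B, S)\<in>J. partial (CQ B S) (F A b) (projD n k m z) * ?d (CQ B S))" by simp
  qed simp
  also have "\<dots> = (\<Sum>j\<in>J. M (A, L) j * ?d (CQ (fst j) (snd j)))"
    using sum_tilt[OF A L, of "\<lambda>j. ?d (CQ (fst j) (snd j))"] by simp
  finally show ?thesis .
qed

text \<open>Solving for the second derivatives \<open>q\<close> is a perturbation of the identity; the
  antisymmetric part of the solution satisfies a homogeneous equation with small coefficients, because \<open>\<Omega>\<close> vanishes on the given
  vectors and on the integral element obtained from the symmetric part.\<close>
lemma ebasis_in_integral_frame:
  assumes frames: "\<And>q :: nat \<Rightarrow> nat \<Rightarrow> nat \<Rightarrow> real.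
      (\<forall>A<m. \<forall>L<k. \<forall>G<k. q A L G = q A G L) \<Longrightarrow>
      \<exists>g. integral_frame n k m F z g \<and> (\<forall>A<m. \<forall>L<k. \<forall>G<k. g L (CQ A G) = q A L G)"
    and tan: "\<And>L. L < k \<Longrightarrow> tangential n k m F z (e L)"
    and O: "\<And>A L G. A < m \<Longrightarrow> L < k \<Longrightarrow> G < k \<Longrightarrow> Omega n A (e L) (e G) = 0"
  obtains g where "integral_frame n k m F z g"
    "\<forall>L<k. e L = (\<lambda>c. \<Sum>i<n. e L (CX i) * g i c)"
proof -
  obtain g0 where g0: "integral_frame n k m F z g0" "\<forall>A<m. \<forall>L<k. \<forall>G<k. g0 L (CQ A G) = 0"
    using frames[of "\<lambda>_ _ _. 0"] by auto
  define hat where "hat = (\<lambda>(g :: nat \<Rightarrow> coord \<Rightarrow> real) L c. \<Sum>i<n. e L (CX i) * g i c)"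
  \<comment> \<open>The amount by which the reference frame with \<open>q = 0\<close> misses
    \<open>e L\<close>. By \<open>frame_difference\<close> the correction solves (1 + M) x_G = r_G
    for each G separately, and its symmetry in L and G is not yet known.\<close>
  define r where "r = (\<lambda>G (A, L). e L (CQ A G) - hat g0 L (CQ A G))"
  have "\<exists>x. \<forall>i\<in>J. x i + (\<Sum>j\<in>J. M i j * x j) = r G i" for G
  proof -
    have "finite J" by simp
    then obtain y where "\<forall>i\<in>J. y i + (\<Sum>j\<in>J. M i j * y j) = r G i"
      by (rule identity_plus_contraction_solvable[where M = M and r = "r G", OF _ rows]) auto
    then show ?thesis by blast
  qed
  then obtain x where x: "\<And>G i. i \<in> J \<Longrightarrow> x G i + (\<Sum>j\<in>J. M i j * x G j) = r G i" by metis
  define \<sigma> where "\<sigma> = (\<lambda>A L G. (x G (A, L) + x L (A, G)) / 2)"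
  define \<tau> where "\<tau> = (\<lambda>A L G. (x G (A, L) - x L (A, G)) / 2)"
  have sym: "\<sigma> A L G = \<sigma> A G L" and anti: "\<tau> A L G = - \<tau> A G L"
    and x_split: "x G (A, L) = \<sigma> A L G + \<tau> A L G" for A L G
    by (simp_all add: \<sigma>_def \<tau>_def field_simps)
  obtain g where g: "integral_frame n k m F z g" "\<forall>A<m. \<forall>L<k. \<forall>G<k. g L (CQ A G) = \<sigma> A L G"
    using frames[of \<sigma>] sym by blast
  \<comment> \<open>The frame built from the symmetric part reproduces \<open>e L\<close> up to a
    vertical vector, whose free components turn out to be (1 + M) applied to \<tau>.\<close>
  define d where "d = (\<lambda>L c. e L c - hat g L c)"
  have hatX: "hat g L (CX i) = e L (CX i)" if "i < n" for L i
    unfolding hat_def by (rule integral_frame_sum_CX[OF g(1) that])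
  have dX: "d L (CX i) = 0" if "i < n" for L i using hatX that by (simp add: d_def)
  have dtan: "tangential n k m F z (d L)" if "L < k" for L
    unfolding d_def hat_def using tan[OF that] integral_frame_tangential[OF g(1)] by (intro tangential_diff)
  have dQ: "d L (CQ A G) = \<tau> A L G + (\<Sum>(B, S)\<in>J. M (A, L) (B, S) * \<tau> B S G)"
    if A: "A < m" and L: "L < k" and G: "G < k" for A L G
  proof -
    have "hat g L (CQ A G) - hat g0 L (CQ A G) = (\<Sum>i<n. e L (CX i) * (g i (CQ A G) - g0 i (CQ A G)))"
      by (simp add: hat_def right_diff_distrib sum_subtractf)
    also have "\<dots> = \<sigma> A L G + (\<Sum>j\<in>J. M (A, L) j * (g G (CQ (fst j) (snd j)) - g0 G (CQ (fst j) (snd j))))"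
      unfolding frame_difference[OF g(1) g0(1) A L G] using g(2) g0(2) A L G by simp
    also have "(\<Sum>j\<in>J. M (A, L) j * (g G (CQ (fst j) (snd j)) - g0 G (CQ (fst j) (snd j))))
       = (\<Sum>(B, S)\<in>J. M (A, L) (B, S) * \<sigma> B S G)"
      by (rule sum.cong) (use g(2) g0(2) G sym in auto)
    finally have 1: "hat g L (CQ A G) - hat g0 L (CQ A G) = \<sigma> A L G + (\<Sum>(B, S)\<in>J. M (A, L) (B, S) * \<sigma> B S G)" .
    have "e L (CQ A G) - hat g0 L (CQ A G) = x G (A, L) + (\<Sum>j\<in>J. M (A, L) j * x G j)"
      using x[of "(A, L)" G] A L by (simp add: r_def)
    also have "(\<Sum>j\<in>J. M (A, L) j * x G j) = (\<Sum>(B, S)\<in>J. M (A, L) (B, S) * \<sigma> B S G + M (A, L) (B, S) * \<tau> B S G)"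
      by (rule sum.cong) (auto simp: x_split distrib_left)
    also have "\<dots> = (\<Sum>(B, S)\<in>J. M (A, L) (B, S) * \<sigma> B S G) + (\<Sum>(B, S)\<in>J. M (A, L) (B, S) * \<tau> B S G)"
      by (simp add: case_prod_beta sum.distrib)
    finally show ?thesis using 1 x_split[of G A L] by (simp add: d_def)
  qed
  \<comment> \<open>Expand Omega(e_L, e_G) = 0 with e = d + hat. The term in d and d vanishes since
    both vectors are vertical, the term in hat and hat since the frame is isotropic; the two mixed
    terms give the symmetry in L and G.\<close>
  have Od: "Omega n A (d L) (e G) = Omega n A (d G) (e L)" if A: "A < m" and L: "L < k" and G: "G < k" for A L G
  proof -
    have dd: "Omega n A (d L) (d G) = 0" for L G
      unfolding Omega_def by (rule sum.neutral) (simp add: dX)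
    have hh: "Omega n A (hat g L) (hat g G) = 0" for L G
      unfolding hat_def by (rule integral_frame_isotropic[OF g(1) A])
    have e1: "Omega n A (e L) v = Omega n A (d L) v + Omega n A (hat g L) v" for L v
      unfolding d_def Omega_diff_left by simp
    have e2: "Omega n A v (e L) = Omega n A v (d L) + Omega n A v (hat g L)" for L v
      using e1[of L v] Omega_antisym[of n A v] by simp
    have "Omega n A (d L) (e G) = Omega n A (d L) (hat g G)" for L G using dd e2[of "d L" G] by simp
    moreover have "0 = Omega n A (d L) (hat g G) + Omega n A (hat g L) (d G)"
      using O[OF A L G] e1[of L "e G"] e2[of "d L" G] e2[of "hat g L" G] dd hh by simp
    ultimately show ?thesis using Omega_antisym[of n A "hat g L" "d G"] by simp
  qed
  let ?T = "{..<m} \<times> {..<k} \<times> {..<k}"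
  \<comment> \<open>The symmetric quantity is \<tau> + Y + X, where Y is bounded by \<theta> c and X
    by \<theta> (1 + \<theta>) c with \<theta> = 1/3. Antisymmetry isolates 2 \<tau>, so \<tau> is
    bounded by \<theta> (2 + \<theta>) c = 7/9 c.\<close>
  have \<tau>0: "\<tau> A L G = 0" if "A < m" "L < k" "G < k" for A L G
  proof -
    have "(\<lambda>(A, L, G). \<tau> A L G) (A, L, G) = 0"
    proof (rule contraction_fixpoint_zero[of ?T "7/9"])
      fix i c assume i: "i \<in> ?T" and c: "\<forall>j\<in>?T. \<bar>(\<lambda>(A, L, G). \<tau> A L G) j\<bar> \<le> c"
      obtain A L G where i': "i = (A, L, G)" "A < m" "L < k" "G < k" using i by auto
      have c': "\<bar>\<tau> B S R\<bar> \<le> c" if "B < m" "S < k" "R < k" for B S R using c that by auto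
      have c0: "0 \<le> c" using c'[OF i'(2-4)] by linarith
      define Y where "Y = (\<lambda>A L G. \<Sum>(B, S)\<in>J. M (A, L) (B, S) * \<tau> B S G)"
      have Y: "\<bar>Y A L G\<bar> \<le> 1 / 3 * c" if "A < m" "L < k" "G < k" for A L G
      proof -
        have "\<bar>\<Sum>j\<in>J. M (A, L) j * \<tau> (fst j) (snd j) G\<bar> \<le> 1 / 3 * c"
          by (rule abs_weighted_sum_le[OF rows _ c0]) (use that c' in auto)
        then show ?thesis by (simp add: Y_def case_prod_beta)
      qed
      have dY: "d L (CQ A G) = \<tau> A L G + Y A L G" if "A < m" "L < k" "G < k" for A L G
        unfolding Y_def by (rule dQ[OF that])
      have db: "\<bar>d L (CQ A G)\<bar> \<le> 4 / 3 * c" if "A < m" "L < k" "G < k" for A L G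
        using dY[OF that] Y[OF that] c'[OF that] by linarith
      define X where "X = (\<lambda>A L G. \<Sum>j\<in>J. M (A, G) j * d L (CQ (fst j) (snd j)))"
      have X: "\<bar>X A L G\<bar> \<le> 1 / 3 * (4 / 3 * c)" if "A < m" "L < k" "G < k" for A L G
        unfolding X_def by (rule abs_weighted_sum_le[OF rows]) (use that db c0 in auto)
      have Oe: "Omega n A (d L) (e G) = d L (CQ A G) + X A L G" if "A < m" "L < k" "G < k" for A L G
        unfolding X_def by (rule Omega_vertical_ebasis[OF dtan dX]) (use that in auto)
      have "d L (CQ A G) + X A L G = d G (CQ A L) + X A G L"
        using Od[OF i'(2-4)] Oe[OF i'(2-4)] Oe[OF i'(2) i'(4) i'(3)] by simp
      then have "2 * \<tau> A L G = Y A G L - Y A L G + X A G L - X A L G"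
        using dY[OF i'(2-4)] dY[OF i'(2) i'(4) i'(3)] anti[of A L G] by simp
      then have "\<bar>\<tau> A L G\<bar> \<le> 7 / 9 * c"
        using Y[OF i'(2-4)] Y[OF i'(2) i'(4) i'(3)] X[OF i'(2-4)] X[OF i'(2) i'(4) i'(3)] by linarith
      then show "\<bar>(\<lambda>(A, L, G). \<tau> A L G) i\<bar> \<le> 7 / 9 * c" by (simp add: i')
    qed (use that in auto)
    then show ?thesis by simp
  qed
  have d0: "d L = (\<lambda>c. 0)" if L: "L < k" for L
  proof (rule vertical_polar_zero[OF dtan[OF L] dX])
    have dQ0: "d L (CQ A G) = 0" if "A < m" "G < k" for A G
    proof -
      have "(\<Sum>(B, S)\<in>J. M (A, L) (B, S) * \<tau> B S G) = 0"
        by (rule sum.neutral) (use \<tau>0 that in auto)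
      then show ?thesis using dQ[OF that(1) L that(2)] \<tau>0[OF that(1) L that(2)] by simp
    qed
    show "Omega n A (d L) (e G) = 0" if "A < m" "G < k" for A G
    proof -
      have "(\<Sum>j\<in>J. M (A, G) j * d L (CQ (fst j) (snd j))) = 0"
        by (rule sum.neutral) (use dQ0 in auto)
      then show ?thesis using Omega_vertical_ebasis[OF dtan[OF L] dX that] dQ0[OF that] by simp
    qed
  qed
  have "e L = (\<lambda>c. \<Sum>i<n. e L (CX i) * g i c)" if "L < k" for L
  proof
    fix c show "e L c = (\<Sum>i<n. e L (CX i) * g i c)"
      using fun_cong[OF d0[OF that], of c] by (simp add: d_def hat_def)
  qed
  then show thesis using that g(1) by blast
qed

text \<open>Subtracting the vector of the plane with the same \<open>x\<close>-part leaves a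
  vertical vector. It still pairs to zero with every \<open>e L\<close>, since these lie in the
  isotropic plane, so \<open>vertical_polar_zero\<close> applies.\<close>

lemma polar_in_integral_frame:
  assumes g: "integral_frame n k m F z g" and eg: "\<forall>L<k. e L = (\<lambda>c. \<Sum>i<n. e L (CX i) * g i c)"
    and v: "tangential n k m F z v" and O: "\<And>A L. A < m \<Longrightarrow> L < k \<Longrightarrow> Omega n A v (e L) = 0"
  shows "v = (\<lambda>c. \<Sum>i<n. v (CX i) * g i c)"
proof -
  let ?h = "\<lambda>c. \<Sum>i<n. v (CX i) * g i c"
  have "(\<lambda>c. v c - ?h c) = (\<lambda>c. 0)"
  proof (rule vertical_polar_zero)
    show "tangential n k m F z (\<lambda>c. v c - ?h c)"
      by (rule tangential_diff[OF v integral_frame_tangential[OF g]])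
    show "v (CX j) - ?h (CX j) = 0" if "j < n" for j
      using integral_frame_sum_CX[OF g that] by simp
    show "Omega n A (\<lambda>c. v c - ?h c) (e L) = 0" if "A < m" "L < k" for A L
    proof -
      have "Omega n A ?h (e L) = Omega n A ?h (\<lambda>c. \<Sum>i<n. e L (CX i) * g i c)"
        using eg that by simp
      then show ?thesis
        using O[OF that] integral_frame_isotropic[OF g that(1)] by (simp add: Omega_diff_left)
    qed
  qed
  note eq = this
  show ?thesis
  proof
    fix c show "v c = ?h c" using fun_cong[OF eq, of c] by linarith
  qed
qed

end

section \<open>Ordinary zeros\<close>

definition frame_span :: "nat \<Rightarrow> (nat \<Rightarrow> coord \<Rightarrow> real) \<Rightarrow> (coord \<Rightarrow> real) set" where
  "frame_span n g = {v. \<exists>\<mu>. v = (\<lambda>c. \<Sum>i<n. \<mu> i * g i c)}"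

text \<open>On both planes the \<open>x\<close>-components are linear coordinates, so replacing one
  frame by the other while keeping them is injective and preserves independence.\<close>

lemma independent_frame_transport:
  assumes g: "\<And>i j. i < n \<Longrightarrow> j < n \<Longrightarrow> g i (CX j) = (if j = i then 1 else 0)"
    and g': "\<And>i j. i < n \<Longrightarrow> j < n \<Longrightarrow> g' i (CX j) = (if j = i then 1 else 0)"
    and S: "S \<subseteq> frame_span n g" "lin_indep_set S"
  shows "\<exists>S'\<subseteq>frame_span n g'. lin_indep_set S' \<and> card S' = card S"
proof -
  define \<phi> where "\<phi> = (\<lambda>v c. \<Sum>i<n. v (CX i) * g' i c :: real)"
  have coord: "(\<Sum>i<n. \<mu> i * h i (CX j)) = \<mu> j"
    if "\<And>i j. i < n \<Longrightarrow> j < n \<Longrightarrow> h i (CX j) = (if j = i then 1 else 0)" "j < n"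
    for \<mu> :: "nat \<Rightarrow> real" and h j
  proof -
    have "(\<Sum>i<n. \<mu> i * h i (CX j)) = (\<Sum>i<n. if i = j then \<mu> i else 0)"
      by (rule sum.cong) (use that in auto)
    then show ?thesis using that(2) by (simp add: sum.delta)
  qed
  have \<phi>X: "\<phi> v (CX j) = v (CX j)" if "j < n" for v j
    unfolding \<phi>_def by (rule coord[OF g' that])
  have rep: "v c = (\<Sum>i<n. v (CX i) * g i c)" if v: "v \<in> S" for v c
  proof -
    obtain \<mu> where \<mu>: "v = (\<lambda>c. \<Sum>i<n. \<mu> i * g i c)" using v S(1) by (auto simp: frame_span_def)
    then have "v (CX i) = \<mu> i" if "i < n" for i using coord[OF g that] by simp
    then have "(\<Sum>i<n. v (CX i) * g i c) = (\<Sum>i<n. \<mu> i * g i c)" by (intro sum.cong) auto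
    then show ?thesis using \<mu> by simp
  qed
  have inj: "inj_on \<phi> S"
  proof (rule inj_onI)
    fix v v' assume v: "v \<in> S" "v' \<in> S" and eq: "\<phi> v = \<phi> v'"
    have X: "v (CX i) = v' (CX i)" if "i < n" for i
      using \<phi>X[OF that, of v] \<phi>X[OF that, of v'] eq by simp
    show "v = v'"
    proof
      fix c
      have "(\<Sum>i<n. v (CX i) * g i c) = (\<Sum>i<n. v' (CX i) * g i c)" by (rule sum.cong) (auto simp: X)
      then show "v c = v' c" using rep[OF v(1), of c] rep[OF v(2), of c] by linarith
    qed
  qed
  have "lin_indep_set (\<phi> ` S)"
    unfolding lin_indep_set_def
  proof (intro conjI allI impI)
    show "finite (\<phi> ` S)" using S(2) by (simp add: lin_indep_set_def)
    fix \<mu> assume 0: "\<forall>c. (\<Sum>v\<in>\<phi> ` S. \<mu> v * v c) = 0"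
    have 1: "(\<Sum>v\<in>S. \<mu> (\<phi> v) * v (CX i)) = 0" if "i < n" for i
      using 0[rule_format, of "CX i"] by (simp add: sum.reindex[OF inj] \<phi>X[OF that])
    have "(\<Sum>v\<in>S. \<mu> (\<phi> v) * v c) = 0" for c
    proof -
      have "(\<Sum>v\<in>S. \<mu> (\<phi> v) * v c) = (\<Sum>v\<in>S. \<Sum>i<n. \<mu> (\<phi> v) * v (CX i) * g i c)"
      proof (rule sum.cong)
        fix v assume "v \<in> S"
        from rep[OF this, of c] have "\<mu> (\<phi> v) * v c = \<mu> (\<phi> v) * (\<Sum>i<n. v (CX i) * g i c)" by metis
        then show "\<mu> (\<phi> v) * v c = (\<Sum>i<n. \<mu> (\<phi> v) * v (CX i) * g i c)"
          by (simp only: sum_distrib_left mult.assoc)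
      qed simp
      also have "\<dots> = (\<Sum>i<n. (\<Sum>v\<in>S. \<mu> (\<phi> v) * v (CX i)) * g i c)"
        unfolding sum_distrib_right by (rule sum.swap)
      also have "\<dots> = 0" using 1 by simp
      finally show ?thesis .
    qed
    then have "\<forall>v\<in>S. \<mu> (\<phi> v) = 0"
      using S(2) unfolding lin_indep_set_def by (elim conjE allE[of _ "\<lambda>v. \<mu> (\<phi> v)"]) blast
    then show "\<forall>v\<in>\<phi> ` S. \<mu> v = 0" by blast
  qed
  moreover have "\<phi> ` S \<subseteq> frame_span n g'" by (auto simp: frame_span_def \<phi>_def)
  ultimately show ?thesis using card_image[OF inj] by blast
qed

text \<open>Regularity asks only for equal dimensions, so the predicates whose greatest value
  defines \<open>vdim\<close> are compared directly.\<close>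

lemma vdim_frame_span_eq:
  assumes "\<And>i j. i < n \<Longrightarrow> j < n \<Longrightarrow> g i (CX j) = (if j = i then 1 else 0)"
    and "\<And>i j. i < n \<Longrightarrow> j < n \<Longrightarrow> g' i (CX j) = (if j = i then 1 else 0)"
  shows "vdim (frame_span n g) = vdim (frame_span n g')"
proof -
  have "(\<exists>S\<subseteq>frame_span n g. lin_indep_set S \<and> card S = d) \<longleftrightarrow>
      (\<exists>S\<subseteq>frame_span n g'. lin_indep_set S \<and> card S = d)" for d
    using independent_frame_transport[OF assms] independent_frame_transport[OF assms(2,1)] by auto
  then show ?thesis by (simp add: vdim_def)
qed

lemma ebasis_in_Espan:
  assumes "a < l" shows "ebasis n l t a \<in> Espan n l t"
proof -
  have "(\<Sum>a'<l. (if a' = a then 1 else 0) * ebasis n l t a' c) = (\<Sum>a'<l. if a' = a then ebasis n l t a' c else 0)" for c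
    by (rule sum.cong) auto
  then have "ebasis n l t a = (\<lambda>c. \<Sum>a'<l. (if a' = a then 1 else 0) * ebasis n l t a' c)"
    using assms by (auto simp: sum.delta)
  then show ?thesis unfolding Espan_def mem_Collect_eq by (rule exI[of _ "\<lambda>a'. if a' = a then 1 else 0"])
qed

text \<open>Labels for generators: coefficients of a linear relation are attached to labels, whether
  or not two labels name the same function.\<close>

datatype gen_idx = GF nat nat | GE nat nat | GD nat nat nat | GO nat nat nat

definition gen_fun :: "nat \<Rightarrow> nat \<Rightarrow> nat \<Rightarrow> nat \<Rightarrow> rhs \<Rightarrow> gen_idx \<Rightarrow> (xcoord \<Rightarrow> real) \<Rightarrow> real" where
  "gen_fun n k m l F \<iota> t = (case \<iota> of
     GF A \<alpha> \<Rightarrow> fA n k m F A \<alpha> (zpart t)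
   | GE A a \<Rightarrow> eta n A (zpart t) (ebasis n l t a)
   | GD A \<alpha> a \<Rightarrow> dfA n k m F A \<alpha> (zpart t) (ebasis n l t a)
   | GO A L a \<Rightarrow> Omega n A (ebasis n l t L) (ebasis n l t a))"

text \<open>The members of the family whose differentials turn out to be independent; only
  \<open>\<Omega>(e\<^sub>a, e\<^sub>a\<^sub>')\<close> with both indices at least \<open>k\<close> (and repetitions) are left out.\<close>
definition gen_set :: "nat \<Rightarrow> nat \<Rightarrow> nat \<Rightarrow> nat \<Rightarrow> gen_idx set" where
  "gen_set n k m l = {GF A \<alpha> | A \<alpha>. A < m \<and> k \<le> \<alpha> \<and> \<alpha> < n} \<union> {GE A a | A a. A < m \<and> a < l}
     \<union> {GD A \<alpha> a | A \<alpha> a. A < m \<and> k \<le> \<alpha> \<and> \<alpha> < n \<and> a < l}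
     \<union> {GO A L a | A L a. A < m \<and> L < k \<and> L < a \<and> a < l}"

lemma gen_set_image:
  "gen_set n k m l = (\<lambda>(A, \<alpha>). GF A \<alpha>) ` ({..<m} \<times> {k..<n}) \<union> ((\<lambda>(A, a). GE A a) ` ({..<m} \<times> {..<l})
     \<union> ((\<lambda>(A, \<alpha>, a). GD A \<alpha> a) ` ({..<m} \<times> {k..<n} \<times> {..<l})
     \<union> (\<lambda>(A, L, a). GO A L a) ` {(A, L, a) \<in> {..<m} \<times> {..<k} \<times> {..<l}. L < a}))"
  by (auto simp: gen_set_def image_iff)

lemma finite_gen_set: "finite (gen_set n k m l)"
  unfolding gen_set_image by (intro finite_UnI finite_imageI) (auto intro: finite_subset[of _ "{..<m} \<times> {..<k} \<times> {..<l}"])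

text \<open>The restriction \<open>L < a\<close> is moved into the summand, so that all sums run
  over full index ranges and collapse one index at a time.\<close>

lemma sum_gen_set:
  fixes f :: "gen_idx \<Rightarrow> real"
  shows "(\<Sum>\<iota>\<in>gen_set n k m l. f \<iota>) = (\<Sum>A<m. \<Sum>\<alpha>\<in>{k..<n}. f (GF A \<alpha>)) + (\<Sum>A<m. \<Sum>a<l. f (GE A a))
    + (\<Sum>A<m. \<Sum>\<alpha>\<in>{k..<n}. \<Sum>a<l. f (GD A \<alpha> a))
    + (\<Sum>A<m. \<Sum>L<k. \<Sum>a<l. if L < a then f (GO A L a) else 0)"
proof -
  let ?O = "{(A, L, a) \<in> {..<m} \<times> {..<k} \<times> {..<l}. L < a}"
  have fin: "finite ?O" by (rule finite_subset[of _ "{..<m} \<times> {..<k} \<times> {..<l}"]) auto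
  have 1: "(\<Sum>\<iota>\<in>(\<lambda>(A, \<alpha>). GF A \<alpha>) ` ({..<m} \<times> {k..<n}). f \<iota>) = (\<Sum>A<m. \<Sum>\<alpha>\<in>{k..<n}. f (GF A \<alpha>))"
    by (subst sum.reindex) (auto simp: inj_on_def sum.cartesian_product case_prod_beta)
  have 2: "(\<Sum>\<iota>\<in>(\<lambda>(A, a). GE A a) ` ({..<m} \<times> {..<l}). f \<iota>) = (\<Sum>A<m. \<Sum>a<l. f (GE A a))"
    by (subst sum.reindex) (auto simp: inj_on_def sum.cartesian_product case_prod_beta)
  have 3: "(\<Sum>\<iota>\<in>(\<lambda>(A, \<alpha>, a). GD A \<alpha> a) ` ({..<m} \<times> {k..<n} \<times> {..<l}). f \<iota>)
      = (\<Sum>A<m. \<Sum>\<alpha>\<in>{k..<n}. \<Sum>a<l. f (GD A \<alpha> a))"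
    by (subst sum.reindex) (auto simp: inj_on_def sum.cartesian_product case_prod_beta)
  have "(\<Sum>\<iota>\<in>(\<lambda>(A, L, a). GO A L a) ` ?O. f \<iota>) = (\<Sum>(A, L, a)\<in>?O. f (GO A L a))"
    by (subst sum.reindex) (auto simp: inj_on_def case_prod_beta)
  also have "\<dots> = (\<Sum>(A, L, a)\<in>{..<m} \<times> {..<k} \<times> {..<l}. if L < a then f (GO A L a) else 0)"
    by (rule sum.mono_neutral_cong_left) (auto split: if_splits)
  also have "\<dots> = (\<Sum>A<m. \<Sum>L<k. \<Sum>a<l. if L < a then f (GO A L a) else 0)"
    by (simp add: sum.cartesian_product)
  finally have 4: "(\<Sum>\<iota>\<in>(\<lambda>(A, L, a). GO A L a) ` ?O. f \<iota>) = \<dots>" .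
  show ?thesis unfolding gen_set_image 1[symmetric] 2[symmetric] 3[symmetric] 4[symmetric]
    using fin by (subst sum.union_disjoint; auto)+
qed

text \<open>Enumerating the labels without repetition carries independence over the index set to the
  list required by the definition.\<close>

lemma ordinary_zeroI:
  assumes zero: "\<forall>g\<in>\<F>. g t = 0" and I: "finite I" and sub: "f ` I \<subseteq> \<F>"
    and indep: "\<And>\<mu>. \<forall>c\<in>C. (\<Sum>\<iota>\<in>I. \<mu> \<iota> * partial c (f \<iota>) t) = 0 \<Longrightarrow> \<forall>\<iota>\<in>I. \<mu> \<iota> = 0"
    and e: "e > 0" and suff: "\<And>t'. t' \<in> box_nbhd C t e \<Longrightarrow> \<forall>\<iota>\<in>I. f \<iota> t' = 0 \<Longrightarrow> \<forall>g\<in>\<F>. g t' = 0"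
  shows "ordinary_zero C \<F> t"
proof -
  obtain xs where xs: "set xs = I" "distinct xs" using finite_distinct_list[OF I] by blast
  have bij: "bij_betw (\<lambda>j. xs ! j) {..<length xs} I" using xs by (simp add: bij_betw_nth)
  show ?thesis unfolding ordinary_zero_def
  proof (intro conjI exI[of _ "map f xs"])
    show "\<forall>g\<in>\<F>. g t = 0" by (rule zero)
    show "set (map f xs) \<subseteq> \<F>" using sub xs by simp
    show "\<forall>\<mu>. (\<forall>c\<in>C. (\<Sum>j<length (map f xs). \<mu> j * partial c (map f xs ! j) t) = 0) \<longrightarrow>
        (\<forall>j<length (map f xs). \<mu> j = 0)"
    proof (intro allI impI)
      fix \<mu> j assume H: "\<forall>c\<in>C. (\<Sum>j<length (map f xs). \<mu> j * partial c (map f xs ! j) t) = 0"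
        and j: "j < length (map f xs)"
      define idx where "idx = the_inv_into {..<length xs} (\<lambda>j. xs ! j)"
      have idx: "idx (xs ! j) = j" if "j < length xs" for j
        unfolding idx_def by (rule the_inv_into_f_f) (use bij that in \<open>auto simp: bij_betw_def\<close>)
      have "(\<Sum>\<iota>\<in>I. \<mu> (idx \<iota>) * partial c (f \<iota>) t) = (\<Sum>j<length xs. \<mu> j * partial c (f (xs ! j)) t)" for c
        by (subst sum.reindex_bij_betw[OF bij, symmetric]) (simp add: idx)
      then have "\<forall>\<iota>\<in>I. \<mu> (idx \<iota>) = 0" using H by (intro indep) simp
      moreover have "xs ! j \<in> I" "j < length xs" using j xs by auto
      ultimately show "\<mu> j = 0" using idx[of j] by force
    qed
    show "\<exists>e>0. \<forall>t\<in>box_nbhd C t e. (\<forall>g\<in>\<F>. g t = 0) = (\<forall>g\<in>set (map f xs). g t = 0)"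
      using e suff sub xs by (intro exI[of _ e]) auto
  qed
qed

section \<open>Differentials of the generators in the chart\<close>

lemma partial_of_affine:
  assumes "\<And>s. f (t(c := t c + s)) = f t + D * s"
  shows "partial c f t = D"
  by (rule partial_eqI(2)[of 1 _ _ _ _ 0]) (use assms in auto)

text \<open>As a function of the single coordinate c^B_{aj} every generator is affine, so its
  partial derivative is an exact coefficient and only first derivatives of \<open>F\<close>
  occur.\<close>

lemma gen_fun_partial_Cq:
  assumes B: "B < m" and j: "j < n"
  shows "partial (Cq B a j) (gen_fun n k m l F (GF A \<alpha>)) t = 0"
    "partial (Cq B a j) (gen_fun n k m l F (GE A a')) t = 0"
    "k \<le> \<alpha> \<Longrightarrow> partial (Cq B a j) (gen_fun n k m l F (GD A \<alpha> a')) t =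
      (if a' = a then (if A = B \<and> \<alpha> = j then 1 else 0)
         - (if j < k then partial (CQ B j) (F A \<alpha>) (projD n k m (zpart t)) else 0) else 0)"
    "partial (Cq B a j) (gen_fun n k m l F (GO A L a')) t =
      (if A = B then (if L = a then ebasis n l t a' (CX j) else 0)
         - (if a' = a then ebasis n l t L (CX j) else 0) else 0)"
proof -
  define t' where "t' = (\<lambda>s. t(Cq B a j := t (Cq B a j) + s))"
  have tt: "t(Cq B a j := t (Cq B a j) + s) = t' s" for s by (simp add: t'_def)
  have z': "zpart (t' s) = zpart t" for s by (simp add: zpart_def t'_def)
  have eX: "ebasis n l (t' s) a' (CX i) = ebasis n l t a' (CX i)"
    and eP: "ebasis n l (t' s) a' (CP A) = ebasis n l t a' (CP A)"
    and eQ: "ebasis n l (t' s) a' (CQ A i) =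
      ebasis n l t a' (CQ A i) + (if A = B \<and> a' = a \<and> i = j then s else 0)" for s a' i A
    by (auto simp: ebasis_def t'_def)
  show "partial (Cq B a j) (gen_fun n k m l F (GF A \<alpha>)) t = 0"
    by (rule partial_of_affine) (simp add: gen_fun_def z' tt)
  show "partial (Cq B a j) (gen_fun n k m l F (GE A a')) t = 0"
    by (rule partial_of_affine) (simp add: gen_fun_def eta_def z' eX eP tt)
  show "partial (Cq B a j) (gen_fun n k m l F (GD A \<alpha> a')) t =
      (if a' = a then (if A = B \<and> \<alpha> = j then 1 else 0)
         - (if j < k then partial (CQ B j) (F A \<alpha>) (projD n k m (zpart t)) else 0) else 0)"
  proof (rule partial_of_affine)
    fix s
    let ?P = "\<lambda>c. partial c (F A \<alpha>) (projD n k m (zpart t))"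
    have "(\<Sum>(A', L)\<in>{..<m} \<times> {..<k}. ?P (CQ A' L) * ebasis n l (t' s) a' (CQ A' L)) =
      (\<Sum>q\<in>{..<m} \<times> {..<k}. (case q of (A', L) \<Rightarrow> ?P (CQ A' L) * ebasis n l t a' (CQ A' L))
        + (if q = (B, j) then (if a' = a then ?P (CQ B j) * s else 0) else 0))"
      by (rule sum.cong) (auto simp: eQ algebra_simps split: if_splits)
    also have "\<dots> = (\<Sum>(A', L)\<in>{..<m} \<times> {..<k}. ?P (CQ A' L) * ebasis n l t a' (CQ A' L))
        + (if j < k then (if a' = a then ?P (CQ B j) * s else 0) else 0)"
      using B by (simp only: sum.distrib) (simp add: sum.delta)
    finally have "(\<Sum>c\<in>Dset n k m. ?P c * ebasis n l (t' s) a' c) =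
       (\<Sum>c\<in>Dset n k m. ?P c * ebasis n l t a' c) + (if j < k then (if a' = a then ?P (CQ B j) * s else 0) else 0)"
      unfolding sum_Dset by (simp add: eX eP)
    then show "gen_fun n k m l F (GD A \<alpha> a') (t(Cq B a j := t (Cq B a j) + s)) =
      gen_fun n k m l F (GD A \<alpha> a') t + (if a' = a then (if A = B \<and> \<alpha> = j then 1 else 0)
         - (if j < k then ?P (CQ B j) else 0) else 0) * s"
      unfolding tt gen_fun_def gen_idx.case dfA_def z' eQ by (auto simp: algebra_simps)
  qed
  show "partial (Cq B a j) (gen_fun n k m l F (GO A L a')) t =
      (if A = B then (if L = a then ebasis n l t a' (CX j) else 0)
         - (if a' = a then ebasis n l t L (CX j) else 0) else 0)"
  proof (rule partial_of_affine)
    fix s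
    have "Omega n A (ebasis n l (t' s) L) (ebasis n l (t' s) a') =
      (\<Sum>i<n. (ebasis n l t L (CQ A i) * ebasis n l t a' (CX i) - ebasis n l t a' (CQ A i) * ebasis n l t L (CX i))
        + (if i = j then (if A = B then (if L = a then ebasis n l t a' (CX j) else 0)
         - (if a' = a then ebasis n l t L (CX j) else 0) else 0) * s else 0))"
      unfolding Omega_def eQ eX by (rule sum.cong) (auto simp: algebra_simps)
    also have "\<dots> = Omega n A (ebasis n l t L) (ebasis n l t a') + (if A = B then (if L = a then ebasis n l t a' (CX j) else 0)
         - (if a' = a then ebasis n l t L (CX j) else 0) else 0) * s"
      using j unfolding Omega_def by (simp only: sum.distrib) (simp add: sum.delta)
    finally show "gen_fun n k m l F (GO A L a') (t(Cq B a j := t (Cq B a j) + s)) =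
      gen_fun n k m l F (GO A L a') t + (if A = B then (if L = a then ebasis n l t a' (CX j) else 0)
         - (if a' = a then ebasis n l t L (CX j) else 0) else 0) * s"
      unfolding tt gen_fun_def gen_idx.case .
  qed
qed

lemma gen_fun_partial_Cp:
  "partial (Cp B a) (gen_fun n k m l F (GF A \<alpha>)) t = 0"
  "partial (Cp B a) (gen_fun n k m l F (GE A a')) t = (if A = B \<and> a' = a then 1 else 0)"
proof -
  define t' where "t' = (\<lambda>s. t(Cp B a := t (Cp B a) + s))"
  have tt: "t(Cp B a := t (Cp B a) + s) = t' s" for s by (simp add: t'_def)
  have z': "zpart (t' s) = zpart t" for s by (simp add: zpart_def t'_def)
  have eX: "ebasis n l (t' s) a' (CX i) = ebasis n l t a' (CX i)"
    and eP: "ebasis n l (t' s) a' (CP A) = ebasis n l t a' (CP A) + (if A = B \<and> a' = a then s else 0)" for s a' i A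
    by (auto simp: ebasis_def t'_def)
  show "partial (Cp B a) (gen_fun n k m l F (GF A \<alpha>)) t = 0"
    by (rule partial_of_affine) (simp add: gen_fun_def z' tt)
  show "partial (Cp B a) (gen_fun n k m l F (GE A a')) t = (if A = B \<and> a' = a then 1 else 0)"
    by (rule partial_of_affine) (simp add: gen_fun_def eta_def z' eX eP tt)
qed

text \<open>For \<beta> at least k the coordinate p^B_\<beta> is not an argument of
  \<open>F\<close>, so only the leading term of \<open>fA\<close> depends on it.\<close>

lemma gen_fun_partial_ZZ:
  assumes "k \<le> \<beta>"
  shows "partial (ZZ (CQ B \<beta>)) (gen_fun n k m l F (GF A \<alpha>)) t = (if A = B \<and> \<alpha> = \<beta> then 1 else 0)"
proof (rule partial_of_affine)
  fix s
  have "projD n k m (zpart (t(ZZ (CQ B \<beta>) := t (ZZ (CQ B \<beta>)) + s))) = projD n k m (zpart t)"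
    using assms by (intro ext) (auto simp: projD_def zpart_def Dset_def)
  then show "gen_fun n k m l F (GF A \<alpha>) (t(ZZ (CQ B \<beta>) := t (ZZ (CQ B \<beta>)) + s)) =
      gen_fun n k m l F (GF A \<alpha>) t + (if A = B \<and> \<alpha> = \<beta> then 1 else 0) * s"
    by (simp add: gen_fun_def fA_def) (simp add: zpart_def)
qed

context tilted_element
begin

text \<open>On the coordinates \<open>c\<^sup>B\<^sub>a\<^sub>j\<close> a linear relation between the differentials reads
  \<open>\<nu>\<^sub>a = - \<nu>\<^sub>a M\<close> with the small matrix \<open>M\<close>, first for \<open>a \<ge> k\<close> and then for \<open>a < k\<close>.\<close>
lemma gen_fun_differentials_independent:
  assumes H: "\<forall>c\<in>chartC n m l. (\<Sum>\<iota>\<in>gen_set n k m l. \<mu> \<iota> * partial c (gen_fun n k m l F \<iota>) t) = 0"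
  shows "\<forall>\<iota>\<in>gen_set n k m l. \<mu> \<iota> = 0"
proof -
  \<comment> \<open>Antisymmetric extension of the coefficients of the chosen Omega(e_L, e_a).
    Entries with both indices at least k are zero, as those generators were not chosen.\<close>
  define \<nu> where "\<nu> = (\<lambda>B a a'. (if a < k \<and> a < a' then \<mu> (GO B a a') else 0)
      - (if a' < k \<and> a' < a then \<mu> (GO B a' a) else 0))"
  let ?P = "\<lambda>A \<alpha> B j. partial (CQ B j) (F A \<alpha>) (projD n k m z)"
  have anti: "\<nu> B a a' = - \<nu> B a' a" for B a a' by (simp add: \<nu>_def)
  \<comment> \<open>The relation along c^B_{aj}, to which \<open>GF\<close> and \<open>GE\<close> do
    not contribute. The three ranges of j used below come from \<open>k\<close> and from the
    \<open>x\<close>-part of the basis: unit entries for j < l, the coordinates c^j_a' from l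
    on.\<close>
  have eqn: "(if k \<le> j then \<mu> (GD B j a) else 0)
      - (if j < k then \<Sum>A<m. \<Sum>\<alpha>\<in>{k..<n}. \<mu> (GD A \<alpha> a) * ?P A \<alpha> B j else 0)
      + (\<Sum>a'<l. \<nu> B a a' * e a' (CX j)) = 0"
    if B: "B < m" and a: "a < l" and j: "j < n" for B a j
  proof -
    have "Cq B a j \<in> chartC n m l" using that by (simp add: chartC_def)
    then have 0: "(\<Sum>\<iota>\<in>gen_set n k m l. \<mu> \<iota> * partial (Cq B a j) (gen_fun n k m l F \<iota>) t) = 0"
      using H by blast
    have "(\<Sum>A<m. \<Sum>\<alpha>\<in>{k..<n}. \<Sum>a'<l. \<mu> (GD A \<alpha> a') * partial (Cq B a j) (gen_fun n k m l F (GD A \<alpha> a')) t)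
      = (\<Sum>A<m. \<Sum>\<alpha>\<in>{k..<n}. \<Sum>a'<l. if a' = a then \<mu> (GD A \<alpha> a) * ((if A = B \<and> \<alpha> = j then 1 else 0)
         - (if j < k then ?P A \<alpha> B j else 0)) else 0)"
      by (intro sum.cong refl) (use gen_fun_partial_Cq(3)[OF B j] in auto)
    also have "\<dots> = (\<Sum>A<m. \<Sum>\<alpha>\<in>{k..<n}. (if \<alpha> = j then (if A = B then \<mu> (GD A \<alpha> a) else 0) else 0)
         - (if j < k then \<mu> (GD A \<alpha> a) * ?P A \<alpha> B j else 0))"
      using a by (intro sum.cong refl) (simp add: sum.delta algebra_simps)
    also have "\<dots> = (if k \<le> j then \<mu> (GD B j a) else 0)
      - (if j < k then \<Sum>A<m. \<Sum>\<alpha>\<in>{k..<n}. \<mu> (GD A \<alpha> a) * ?P A \<alpha> B j else 0)"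
      using B j by (simp add: sum_subtractf sum.delta)
    finally have D: "(\<Sum>A<m. \<Sum>\<alpha>\<in>{k..<n}. \<Sum>a'<l. \<mu> (GD A \<alpha> a') * partial (Cq B a j) (gen_fun n k m l F (GD A \<alpha> a')) t)
      = (if k \<le> j then \<mu> (GD B j a) else 0)
      - (if j < k then \<Sum>A<m. \<Sum>\<alpha>\<in>{k..<n}. \<mu> (GD A \<alpha> a) * ?P A \<alpha> B j else 0)" .
    have "(\<Sum>A<m. \<Sum>L<k. \<Sum>a'<l. if L < a' then \<mu> (GO A L a') * partial (Cq B a j) (gen_fun n k m l F (GO A L a')) t else 0)
      = (\<Sum>A<m. if A = B then (\<Sum>L<k. \<Sum>a'<l. (if L = a then (if L < a' then \<mu> (GO B L a') * e a' (CX j) else 0) else 0)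
          - (if a' = a then (if L < a' then \<mu> (GO B L a') * e L (CX j) else 0) else 0)) else 0)"
    proof (intro sum.cong refl)
      fix A
      show "(\<Sum>L<k. \<Sum>a'<l. if L < a' then \<mu> (GO A L a') * partial (Cq B a j) (gen_fun n k m l F (GO A L a')) t else 0)
        = (if A = B then (\<Sum>L<k. \<Sum>a'<l. (if L = a then (if L < a' then \<mu> (GO B L a') * e a' (CX j) else 0) else 0)
          - (if a' = a then (if L < a' then \<mu> (GO B L a') * e L (CX j) else 0) else 0)) else 0)"
      proof (cases "A = B")
        case True
        then show ?thesis
          by (simp only: if_True simp_thms gen_fun_partial_Cq(4)[OF B j])
            (intro sum.cong refl, auto simp: algebra_simps)
      qed (simp add: gen_fun_partial_Cq(4)[OF B j] cong: if_cong)
    qed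
    also have "\<dots> = (\<Sum>L<k. \<Sum>a'<l. (if L = a then (if L < a' then \<mu> (GO B L a') * e a' (CX j) else 0) else 0))
        - (\<Sum>L<k. \<Sum>a'<l. (if a' = a then (if L < a' then \<mu> (GO B L a') * e L (CX j) else 0) else 0))"
      using B by (simp add: sum.delta sum_subtractf)
    also have "(\<Sum>L<k. \<Sum>a'<l. (if L = a then (if L < a' then \<mu> (GO B L a') * e a' (CX j) else 0) else 0))
      = (\<Sum>a'<l. (if a < k \<and> a < a' then \<mu> (GO B a a') else 0) * e a' (CX j))"
      by (subst sum.swap) (auto simp: sum.delta intro!: sum.cong)
    also have "(\<Sum>L<k. \<Sum>a'<l. (if a' = a then (if L < a' then \<mu> (GO B L a') * e L (CX j) else 0) else 0))
      = (\<Sum>L<k. (if L < a then \<mu> (GO B L a) * e L (CX j) else 0))"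
      using a by (simp add: sum.delta)
    also have "\<dots> = (\<Sum>a'<l. (if a' < k \<and> a' < a then \<mu> (GO B a' a) else 0) * e a' (CX j))"
      by (rule sum.mono_neutral_cong_left) (use kl in auto)
    finally have O: "(\<Sum>A<m. \<Sum>L<k. \<Sum>a'<l. if L < a' then \<mu> (GO A L a') * partial (Cq B a j) (gen_fun n k m l F (GO A L a')) t else 0)
      = (\<Sum>a'<l. \<nu> B a a' * e a' (CX j))"
      by (simp add: \<nu>_def left_diff_distrib sum_subtractf)
    show ?thesis
      using 0 unfolding sum_gen_set D O by (simp add: gen_fun_partial_Cq(1,2)[OF B j])
  qed
  have eX: "e a' (CX j) = (if j < l then (if a' = j then 1 else 0) else t (Cb j a'))"
    if "a' < l" "j < n" for a' j using that by (auto simp: ebasis_def)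
  have low: "\<nu> B a j = (\<Sum>A<m. \<Sum>\<alpha>\<in>{k..<n}. \<mu> (GD A \<alpha> a) * ?P A \<alpha> B j)"
    if B: "B < m" and a: "a < l" and j: "j < k" for B a j
  proof -
    have "(\<Sum>a'<l. \<nu> B a a' * e a' (CX j)) = (\<Sum>a'<l. if a' = j then \<nu> B a a' else 0)"
      by (rule sum.cong) (use j kl kn eX in auto)
    then show ?thesis using eqn[OF B a, of j] j kl kn by (simp add: sum.delta)
  qed
  have mid: "\<mu> (GD B j a) = - \<nu> B a j" if B: "B < m" and a: "a < l" and j: "k \<le> j" "j < l" for B a j
  proof -
    have "(\<Sum>a'<l. \<nu> B a a' * e a' (CX j)) = (\<Sum>a'<l. if a' = j then \<nu> B a a' else 0)"
      by (rule sum.cong) (use j ln eX in auto)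
    then show ?thesis using eqn[OF B a, of j] j ln by (simp add: sum.delta)
  qed
  have high: "\<mu> (GD B j a) = - (\<Sum>a'<l. \<nu> B a a' * t (Cb j a'))"
    if B: "B < m" and a: "a < l" and j: "l \<le> j" "j < n" for B a j
  proof -
    have "(\<Sum>a'<l. \<nu> B a a' * e a' (CX j)) = (\<Sum>a'<l. \<nu> B a a' * t (Cb j a'))"
      by (rule sum.cong) (use j eX in auto)
    then show ?thesis using eqn[OF B a, of j] j kl by simp
  qed
  \<comment> \<open>For fixed a, the hypothesis \<open>up\<close> removes the entries of \<nu> with
    second index at least k. Then the coefficients of df with \<alpha> below l vanish, and those
    with \<alpha> from l on return to \<nu> through the transpose of M, which is where the column
    sums enter.\<close>
  have step: "\<nu> B a L = 0"
    if a: "a < l" and up: "\<And>B a'. B < m \<Longrightarrow> k \<le> a' \<Longrightarrow> a' < l \<Longrightarrow> \<nu> B a a' = 0" and BL: "B < m" "L < k"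
    for B a L
  proof -
    have fix_eq: "\<nu> B a G = - (\<Sum>i\<in>J. M i (B, G) * \<nu> (fst i) a (snd i))" if BG: "B < m" "G < k" for B G
    proof -
      have "(\<Sum>\<alpha>\<in>{k..<n}. \<mu> (GD A \<alpha> a) * ?P A \<alpha> B G) = - (\<Sum>L<k. M (A, L) (B, G) * \<nu> A a L)"
        if A: "A < m" for A
      proof -
        have "(\<Sum>\<alpha>\<in>{k..<n}. \<mu> (GD A \<alpha> a) * ?P A \<alpha> B G) = (\<Sum>b\<in>{l..<n}. \<mu> (GD A b a) * ?P A b B G)"
          by (rule sum.mono_neutral_right) (use kl mid[OF A a] up[OF A] in auto)
        also have "\<dots> = (\<Sum>b\<in>{l..<n}. - (\<Sum>L<k. \<nu> A a L * (t (Cb b L) * ?P A b B G)))"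
        proof (rule sum.cong)
          fix b assume b: "b \<in> {l..<n}"
          have "(\<Sum>a'<l. \<nu> A a a' * t (Cb b a')) = (\<Sum>L<k. \<nu> A a L * t (Cb b L))"
            by (rule sum.mono_neutral_right) (use kl up[OF A] in auto)
          then show "\<mu> (GD A b a) * ?P A b B G = - (\<Sum>L<k. \<nu> A a L * (t (Cb b L) * ?P A b B G))"
            using high[OF A a, of b] b by (simp add: sum_distrib_right mult.assoc)
        qed simp
        also have "\<dots> = - (\<Sum>L<k. \<Sum>b\<in>{l..<n}. \<nu> A a L * (t (Cb b L) * ?P A b B G))"
          unfolding sum_negf by (subst sum.swap) simp
        finally show ?thesis by (simp add: tilt_def sum_distrib_left mult.commute)
      qed
      then have "\<nu> B a G = (\<Sum>A<m. - (\<Sum>L<k. M (A, L) (B, G) * \<nu> A a L))"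
        using low[OF BG(1) a BG(2)] by simp
      then show ?thesis by (simp add: sum_negf sum.cartesian_product case_prod_beta)
    qed
    have "(\<lambda>i. \<nu> (fst i) a (snd i)) (B, L) = 0"
    proof (rule contraction_fixpoint_zero[of J "1/3"])
      fix i c assume i: "i \<in> J" and c: "\<forall>j\<in>J. \<bar>\<nu> (fst j) a (snd j)\<bar> \<le> c"
      have c0: "0 \<le> c" using c i by force
      have "\<nu> (fst i) a (snd i) = - (\<Sum>j\<in>J. M j i * \<nu> (fst j) a (snd j))"
        using fix_eq[of "fst i" "snd i"] i by auto
      then show "\<bar>\<nu> (fst i) a (snd i)\<bar> \<le> 1 / 3 * c"
        using abs_weighted_sum_le[OF cols[OF i] c c0] by simp
    qed (use BL in auto)
    then show ?thesis by simp
  qed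
  \<comment> \<open>For a at least k the hypothesis \<open>up\<close> holds by the definition of
    \<nu>; for a below k it follows from this first case by antisymmetry.\<close>
  have \<nu>1: "\<nu> B a L = 0" if "B < m" "k \<le> a" "a < l" "L < k" for B a L
    by (rule step) (use that in \<open>auto simp: \<nu>_def\<close>)
  have \<nu>2: "\<nu> B a L = 0" if "B < m" "a < k" "L < k" for B a L
    by (rule step) (use that kl \<nu>1 anti[of _ a] in auto)
  have \<nu>0: "\<nu> B a a' = 0" if "B < m" "a < l" "a' < l" for B a a'
  proof (cases "a' < k")
    case True
    then show ?thesis using \<nu>1 \<nu>2 that by (cases "a < k") auto
  next
    case False
    then show ?thesis using \<nu>1[of B a' a] anti[of B a a'] that by (cases "a < k") (auto simp: \<nu>_def)
  qed
  have GO: "\<mu> (GO A L a) = 0" if "A < m" "L < k" "L < a" "a < l" for A L a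
    using \<nu>0[of A L a] that kl by (simp add: \<nu>_def)
  have GD: "\<mu> (GD A \<alpha> a) = 0" if "A < m" "k \<le> \<alpha>" "\<alpha> < n" "a < l" for A \<alpha> a
    using that mid[of A a \<alpha>] high[of A a \<alpha>] \<nu>0 by (cases "\<alpha> < l") auto
  \<comment> \<open>The remaining coefficients are read off triangularly: c^B_a isolates
    \<open>eta\<close> once df and Omega are gone, and then p^B_\<beta> isolates f.\<close>
  have GE: "\<mu> (GE B a) = 0" if B: "B < m" and a: "a < l" for B a
  proof -
    have "Cp B a \<in> chartC n m l" using that by (simp add: chartC_def)
    then have 0: "(\<Sum>\<iota>\<in>gen_set n k m l. \<mu> \<iota> * partial (Cp B a) (gen_fun n k m l F \<iota>) t) = 0"
      using H by blast
    have "(\<Sum>A<m. \<Sum>a'<l. \<mu> (GE A a') * (if A = B \<and> a' = a then 1 else 0))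
      = (\<Sum>A<m. \<Sum>a'<l. if a' = a then (if A = B then \<mu> (GE A a') else 0) else 0)"
      by (intro sum.cong refl) auto
    also have "\<dots> = \<mu> (GE B a)" using a B by (simp add: sum.delta)
    finally have E: "(\<Sum>A<m. \<Sum>a'<l. \<mu> (GE A a') * (if A = B \<and> a' = a then 1 else 0)) = \<mu> (GE B a)" .
    have D: "(\<Sum>A<m. \<Sum>\<alpha>\<in>{k..<n}. \<Sum>a'<l. \<mu> (GD A \<alpha> a') * X A \<alpha> a') = 0" for X :: "nat \<Rightarrow> nat \<Rightarrow> nat \<Rightarrow> real"
      by (intro sum.neutral ballI) (use GD in auto)
    have O: "(\<Sum>A<m. \<Sum>L<k. \<Sum>a'<l. if L < a' then \<mu> (GO A L a') * X A L a' else 0) = 0" for X :: "nat \<Rightarrow> nat \<Rightarrow> nat \<Rightarrow> real"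
      by (intro sum.neutral ballI) (use GO in auto)
    show ?thesis using 0 unfolding sum_gen_set D O gen_fun_partial_Cp E by simp
  qed
  have GF: "\<mu> (GF B \<beta>) = 0" if B: "B < m" and b: "k \<le> \<beta>" "\<beta> < n" for B \<beta>
  proof -
    have "ZZ (CQ B \<beta>) \<in> chartC n m l" using that by (simp add: chartC_def Zc_def)
    then have 0: "(\<Sum>\<iota>\<in>gen_set n k m l. \<mu> \<iota> * partial (ZZ (CQ B \<beta>)) (gen_fun n k m l F \<iota>) t) = 0"
      using H by blast
    have "(\<Sum>A<m. \<Sum>\<alpha>\<in>{k..<n}. \<mu> (GF A \<alpha>) * (if A = B \<and> \<alpha> = \<beta> then 1 else 0))
      = (\<Sum>A<m. \<Sum>\<alpha>\<in>{k..<n}. if \<alpha> = \<beta> then (if A = B then \<mu> (GF A \<alpha>) else 0) else 0)"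
      by (intro sum.cong refl) auto
    also have "\<dots> = \<mu> (GF B \<beta>)" using b B by (simp add: sum.delta)
    finally have E: "(\<Sum>A<m. \<Sum>\<alpha>\<in>{k..<n}. \<mu> (GF A \<alpha>) * (if A = B \<and> \<alpha> = \<beta> then 1 else 0)) = \<mu> (GF B \<beta>)" .
    have D: "(\<Sum>A<m. \<Sum>\<alpha>\<in>{k..<n}. \<Sum>a'<l. \<mu> (GD A \<alpha> a') * X A \<alpha> a') = 0" for X :: "nat \<Rightarrow> nat \<Rightarrow> nat \<Rightarrow> real"
      by (intro sum.neutral ballI) (use GD in auto)
    have O: "(\<Sum>A<m. \<Sum>L<k. \<Sum>a'<l. if L < a' then \<mu> (GO A L a') * X A L a' else 0) = 0" for X :: "nat \<Rightarrow> nat \<Rightarrow> nat \<Rightarrow> real"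
      by (intro sum.neutral ballI) (use GO in auto)
    have Ez: "(\<Sum>A<m. \<Sum>a'<l. \<mu> (GE A a') * X A a') = 0" for X :: "nat \<Rightarrow> nat \<Rightarrow> real"
      by (intro sum.neutral ballI) (use GE in auto)
    show ?thesis using 0 unfolding sum_gen_set D O Ez gen_fun_partial_ZZ[OF b(1)] E by simp
  qed
  show ?thesis using GO GD GE GF by (auto simp: gen_set_def)
qed

end

section \<open>Regularity\<close>

context tilted_element
begin

text \<open>The pairings with the first k basis vectors do all the work: among themselves they put
  these k vectors into an n-plane, and the other basis vectors, being polar to them, lie in the same
  plane.\<close>

lemma integral_plane_exists:
  assumes F: "\<And>A \<alpha>. A < m \<Longrightarrow> k \<le> \<alpha> \<Longrightarrow> \<alpha> < n \<Longrightarrow> analytic_at (Dset n k m) (F A \<alpha>) (projD n k m z)"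
    and sol: "approx_solvable n k m F (projD n k m z)"
    and zero: "\<forall>\<iota>\<in>gen_set n k m l. gen_fun n k m l F \<iota> t = 0"
  obtains g where "integral_frame n k m F z g" "\<forall>a<l. e a = (\<lambda>c. \<Sum>i<n. e a (CX i) * g i c)"
proof -
  have f: "\<forall>A<m. \<forall>\<alpha>\<in>{k..<n}. fA n k m F A \<alpha> z = 0"
  proof (intro allI impI ballI)
    fix A \<alpha> assume "A < m" "\<alpha> \<in> {k..<n}"
    then have "GF A \<alpha> \<in> gen_set n k m l" by (simp add: gen_set_def)
    from zero[rule_format, OF this] show "fA n k m F A \<alpha> z = 0" by (simp add: gen_fun_def)
  qed
  have tan: "tangential n k m F z (e a)" if a: "a < l" for a
    unfolding tangential_def
  proof (intro conjI allI impI ballI)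
    show "supp_on (Zc n m) (e a)" by (rule supp_ebasis[OF a])
    fix A assume A: "A < m"
    then have "GE A a \<in> gen_set n k m l" using a by (simp add: gen_set_def)
    from zero[rule_format, OF this] show "eta n A z (e a) = 0" by (simp add: gen_fun_def)
    fix \<alpha> assume "\<alpha> \<in> {k..<n}"
    then have "GD A \<alpha> a \<in> gen_set n k m l" using a A by (simp add: gen_set_def)
    from zero[rule_format, OF this] show "dfA n k m F A \<alpha> z (e a) = 0" by (simp add: gen_fun_def)
  qed
  have O1: "Omega n A (e L) (e a) = 0" if "A < m" "L < k" "L < a" "a < l" for A L a
  proof -
    have "GO A L a \<in> gen_set n k m l" using that by (simp add: gen_set_def)
    from zero[rule_format, OF this] show ?thesis by (simp add: gen_fun_def)
  qed
  have O: "Omega n A (e a) (e L) = 0" if "A < m" "L < k" "a < l" for A L a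
  proof -
    consider "L < a" | "a = L" | "a < L" by linarith
    then show ?thesis
    proof cases
      case 1
      then show ?thesis using O1[of A L a] Omega_antisym[of n A "e a" "e L"] that by simp
    next
      case 2
      then show ?thesis by (simp add: Omega_def)
    next
      case 3
      then show ?thesis using O1[of A a L] that kl by simp
    qed
  qed
  have sw: "supp_on (Dset n k m) (projD n k m z)" by (simp add: supp_on_def projD_def)
  have frames: "\<exists>g. integral_frame n k m F z g \<and> (\<forall>A<m. \<forall>L<k. \<forall>G<k. g L (CQ A G) = q A L G)"
    if q: "\<forall>A<m. \<forall>L<k. \<forall>G<k. q A L G = q A G L" for q :: "nat \<Rightarrow> nat \<Rightarrow> nat \<Rightarrow> real"
  proof -
    have q': "q A L G = q A G L" if "A < m" "L < k" "G < k" for A L G using q that by blast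
    obtain g where "integral_frame n k m F z g" "\<forall>A<m. \<forall>L<k. \<forall>G<k. g L (CQ A G) = q A L G"
      by (rule integral_frame_exists[OF kn sw F sol f q'])
    then show ?thesis by blast
  qed
  obtain g where g: "integral_frame n k m F z g" "\<forall>L<k. e L = (\<lambda>c. \<Sum>i<n. e L (CX i) * g i c)"
    by (rule ebasis_in_integral_frame[OF frames]) (use tan O kl in auto)
  have "e a = (\<lambda>c. \<Sum>i<n. e a (CX i) * g i c)" if "a < l" for a
    by (rule polar_in_integral_frame[OF g tan[OF that] O]) (use that in auto)
  then show thesis using that g(1) by blast
qed

text \<open>Being polar to the first k basis vectors already confines a vector to the plane;
  conversely the plane is isotropic and contains the element.\<close>

lemma Hpolar_eq_frame_span:
  assumes g: "integral_frame n k m F z g" and eg: "\<forall>a<l. e a = (\<lambda>c. \<Sum>i<n. e a (CX i) * g i c)"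
  shows "Hpolar n k m F z (Espan n l t) = frame_span n g"
proof (intro set_eqI iffI)
  fix v assume v: "v \<in> Hpolar n k m F z (Espan n l t)"
  have "v = (\<lambda>c. \<Sum>i<n. v (CX i) * g i c)"
  proof (rule polar_in_integral_frame[OF g])
    show "\<forall>L<k. e L = (\<lambda>c. \<Sum>i<n. e L (CX i) * g i c)" using eg kl by auto
    show "tangential n k m F z v" using v by (simp add: Hpolar_def tangential_def)
    show "Omega n A v (e L) = 0" if "A < m" "L < k" for A L
      using v that kl ebasis_in_Espan[of L l n t] by (simp add: Hpolar_def)
  qed
  then show "v \<in> frame_span n g" unfolding frame_span_def mem_Collect_eq
    by (rule exI[of _ "\<lambda>i. v (CX i)"])
next
  fix v assume "v \<in> frame_span n g"
  then obtain \<mu> where v: "v = (\<lambda>c. \<Sum>i<n. \<mu> i * g i c)" by (auto simp: frame_span_def)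
  have "Omega n A v (e a) = 0" if "A < m" "a < l" for A a
  proof -
    have "Omega n A v (e a) = Omega n A v (\<lambda>c. \<Sum>i<n. e a (CX i) * g i c)" using eg that by simp
    then show ?thesis using integral_frame_isotropic[OF g that(1)] by (simp add: v)
  qed
  then have "Omega n A v w = 0" if "A < m" "w \<in> Espan n l t" for A w
    using that by (auto simp: Espan_def Omega_sum_right)
  moreover have "tangential n k m F z v" unfolding v by (rule integral_frame_tangential[OF g])
  ultimately show "v \<in> Hpolar n k m F z (Espan n l t)" by (simp add: Hpolar_def tangential_def)
qed

text \<open>The omitted Omega(e_a, e_a') vanish because both vectors lie in one isotropic
  n-plane.\<close>

lemma Fam_zero_of_gen_set:
  assumes F: "\<And>A \<alpha>. A < m \<Longrightarrow> k \<le> \<alpha> \<Longrightarrow> \<alpha> < n \<Longrightarrow> analytic_at (Dset n k m) (F A \<alpha>) (projD n k m z)"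
    and sol: "approx_solvable n k m F (projD n k m z)"
    and zero: "\<forall>\<iota>\<in>gen_set n k m l. gen_fun n k m l F \<iota> t = 0"
  shows "\<forall>h\<in>Fam n k m l F. h t = 0"
proof -
  obtain g where g: "integral_frame n k m F z g" and eg: "\<forall>a<l. e a = (\<lambda>c. \<Sum>i<n. e a (CX i) * g i c)"
    by (rule integral_plane_exists[OF F sol zero])
  have O: "Omega n A (e a) (e a') = 0" if "A < m" "a < l" "a' < l" for A a a'
  proof -
    have "Omega n A (e a) (e a') = Omega n A (\<lambda>c. \<Sum>i<n. e a (CX i) * g i c) (\<lambda>c. \<Sum>i<n. e a' (CX i) * g i c)"
      using eg that by simp
    then show ?thesis using integral_frame_isotropic[OF g that(1)] by simp
  qed
  have "\<And>A \<alpha>. A < m \<Longrightarrow> k \<le> \<alpha> \<Longrightarrow> \<alpha> < n \<Longrightarrow> fA n k m F A \<alpha> z = 0"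
    using zero[rule_format, of "GF _ _"] by (simp add: gen_set_def gen_fun_def)
  moreover have "\<And>A a. A < m \<Longrightarrow> a < l \<Longrightarrow> eta n A z (e a) = 0"
    using zero[rule_format, of "GE _ _"] by (simp add: gen_set_def gen_fun_def)
  moreover have "\<And>A \<alpha> a. A < m \<Longrightarrow> k \<le> \<alpha> \<Longrightarrow> \<alpha> < n \<Longrightarrow> a < l \<Longrightarrow> dfA n k m F A \<alpha> z (e a) = 0"
    using zero[rule_format, of "GD _ _ _"] by (simp add: gen_set_def gen_fun_def)
  ultimately show ?thesis using O unfolding Fam_def by auto
qed

end

lemma gen_fun_in_Fam:
  assumes "k \<le> l"
  shows "gen_fun n k m l F ` gen_set n k m l \<subseteq> Fam n k m l F"
proof (rule image_subsetI)
  fix \<iota> assume "\<iota> \<in> gen_set n k m l"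
  then consider (f) A \<alpha> where "\<iota> = GF A \<alpha>" "A < m" "k \<le> \<alpha>" "\<alpha> < n"
    | (e) A a where "\<iota> = GE A a" "A < m" "a < l"
    | (d) A \<alpha> a where "\<iota> = GD A \<alpha> a" "A < m" "k \<le> \<alpha>" "\<alpha> < n" "a < l"
    | (o) A L a where "\<iota> = GO A L a" "A < m" "L < l" "a < l"
    using assms by (auto simp: gen_set_def)
  then show "gen_fun n k m l F \<iota> \<in> Fam n k m l F"
  proof cases
    case f
    then have "gen_fun n k m l F \<iota> = (\<lambda>t. fA n k m F A \<alpha> (zpart t))" by (auto simp: gen_fun_def)
    then show ?thesis using f unfolding Fam_def by blast
  next
    case e
    then have "gen_fun n k m l F \<iota> = (\<lambda>t. eta n A (zpart t) (ebasis n l t a))" by (auto simp: gen_fun_def)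
    then show ?thesis using e unfolding Fam_def by blast
  next
    case d
    then have "gen_fun n k m l F \<iota> = (\<lambda>t. dfA n k m F A \<alpha> (zpart t) (ebasis n l t a))" by (auto simp: gen_fun_def)
    then show ?thesis using d unfolding Fam_def by blast
  next
    case o
    then have "gen_fun n k m l F \<iota> = (\<lambda>t. Omega n A (ebasis n l t L) (ebasis n l t a))" by (auto simp: gen_fun_def)
    then show ?thesis using o unfolding Fam_def by blast
  qed
qed

lemma integral_element_imp_Fam_zero:
  assumes "integral_element n k m F U (zpart t) (Espan n l t)"
  shows "\<forall>h\<in>Fam n k m l F. h t = 0"
proof -
  have e: "ebasis n l t a \<in> Espan n l t" if "a < l" for a by (rule ebasis_in_Espan[OF that])
  show ?thesis using assms e unfolding integral_element_def Fam_def by auto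
qed

section \<open>Smallness of the tilt near the base point\<close>

lemma uniformly_bounded_near:
  fixes h :: "'j \<Rightarrow> ('i \<Rightarrow> real) \<Rightarrow> real"
  assumes "finite I" and "\<And>i. i \<in> I \<Longrightarrow> \<exists>e>0. \<exists>K. \<forall>y\<in>box_nbhd C x e. \<bar>h i y\<bar> \<le> K"
  shows "\<exists>e>0. \<exists>K\<ge>0. \<forall>i\<in>I. \<forall>y\<in>box_nbhd C x e. \<bar>h i y\<bar> \<le> K"
  using assms
proof (induction rule: finite_induct)
  case empty
  then show ?case by (auto intro: exI[of _ 1])
next
  case (insert j I)
  then obtain e1 K1 where 1: "e1 > 0" "K1 \<ge> 0" "\<forall>i\<in>I. \<forall>y\<in>box_nbhd C x e1. \<bar>h i y\<bar> \<le> K1" by auto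
  obtain e2 K2 where 2: "e2 > 0" "\<forall>y\<in>box_nbhd C x e2. \<bar>h j y\<bar> \<le> K2" using insert.prems[of j] by auto
  have sub: "box_nbhd C x (min e1 e2) \<subseteq> box_nbhd C x e1" "box_nbhd C x (min e1 e2) \<subseteq> box_nbhd C x e2"
    by (auto intro!: box_nbhd_mono)
  have "\<forall>i\<in>insert j I. \<forall>y\<in>box_nbhd C x (min e1 e2). \<bar>h i y\<bar> \<le> max K1 K2"
    using 1(3) 2(2) sub by (auto simp: le_max_iff_disj)
  then show ?case using 1 2 by (intro exI[of _ "min e1 e2"] exI[of _ "max K1 K2"] conjI) auto
qed

text \<open>The tilt is a sum of products of the coordinates c^b_L, which vanish at
  \<open>t0\<close>, with first derivatives of \<open>F\<close>, which are bounded near the base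
  point.\<close>

lemma tilted_element_near:
  assumes kn: "k < n" and kl: "k \<le> l" and ln: "l \<le> n"
    and U: "open_coords (Dset n k m) U"
    and F: "\<forall>A<m. \<forall>\<alpha>\<in>{k..<n}. \<forall>w\<in>U. analytic_at (Dset n k m) (F A \<alpha>) w"
    and t0: "\<forall>b a. t0 (Cb b a) = 0" and w0: "projD n k m (zpart t0) \<in> U"
  shows "\<exists>e>0. \<forall>t\<in>box_nbhd (chartC n m l) t0 e. tilted_element n k m l F t \<and> projD n k m (zpart t) \<in> U"
proof -
  let ?wc = "projD n k m (zpart t0)"
  let ?D = "Dset n k m"
  obtain e1 where e1: "e1 > 0" "box_nbhd ?D ?wc e1 \<subseteq> U" using U w0 unfolding open_coords_def by blast
  let ?h = "\<lambda>(A, \<alpha>, B, G). partial (CQ B G) (F A \<alpha>)"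
  let ?I = "{..<m} \<times> {k..<n} \<times> {..<m} \<times> {..<k}"
  have "\<exists>e>0. \<exists>K\<ge>0. \<forall>i\<in>?I. \<forall>y\<in>box_nbhd ?D ?wc e. \<bar>?h i y\<bar> \<le> K"
  proof (rule uniformly_bounded_near)
    show "finite ?I" by simp
    fix i assume "i \<in> ?I"
    then obtain A \<alpha> B G where i: "i = (A, \<alpha>, B, G)" "A < m" "\<alpha> \<in> {k..<n}" "B < m" "G < k" by auto
    have an: "analytic_at ?D (partial (CQ B G) (F A \<alpha>)) ?wc"
      using i F w0 by (intro analytic_at_partial finite_Dset) (auto simp: Dset_def)
    obtain e K where "e > 0" "\<forall>y\<in>box_nbhd ?D ?wc e. \<bar>partial (CQ B G) (F A \<alpha>) y\<bar> \<le> K"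
      by (rule analytic_at_bounded[OF finite_Dset an])
    then show "\<exists>e>0. \<exists>K. \<forall>y\<in>box_nbhd ?D ?wc e. \<bar>?h i y\<bar> \<le> K" using i by auto
  qed
  then obtain e2 K where e2: "e2 > 0" and K: "K \<ge> 0"
    and bnd: "\<forall>i\<in>?I. \<forall>y\<in>box_nbhd ?D ?wc e2. \<bar>?h i y\<bar> \<le> K" by blast
  \<comment> \<open>An entry of the tilt is at most n e K, and a row or column has m k entries, so
    \<open>e \<le> 1 / N\<close> brings the sums below 1/3. The final 1 makes \<open>N\<close>
    positive.\<close>
  define N where "N = 3 * real (m * k) * real n * (K + 1) + 1"
  have N: "N > 0" using K unfolding N_def by (intro add_nonneg_pos mult_nonneg_nonneg) auto
  define e where "e = min (min e1 e2) (1 / N)"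
  have e: "e > 0" "e \<le> e1" "e \<le> e2" "e \<le> 1 / N" using e1 e2 N by (auto simp: e_def)
  have "tilted_element n k m l F t \<and> projD n k m (zpart t) \<in> U" if t: "t \<in> box_nbhd (chartC n m l) t0 e" for t
  proof -
    let ?w = "projD n k m (zpart t)"
    have "?w \<in> box_nbhd ?D ?wc e"
    proof -
      have "\<bar>t (ZZ c) - t0 (ZZ c)\<bar> < e" if "c \<in> ?D" for c
      proof -
        have "ZZ c \<in> chartC n m l" using that kn by (auto simp: Dset_def chartC_def Zc_def)
        then show ?thesis using t by (simp add: box_nbhd_def)
      qed
      then show ?thesis using e by (auto simp: box_nbhd_def supp_on_def projD_def zpart_def)
    qed
    then have w: "?w \<in> box_nbhd ?D ?wc e1" "?w \<in> box_nbhd ?D ?wc e2"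
      using box_nbhd_mono[OF e(2), of ?D ?wc] box_nbhd_mono[OF e(3), of ?D ?wc] by blast+
    define T where "T = real n * (e * K)"
    have Mb: "\<bar>tilt n k m l F t i j\<bar> \<le> T"
      if "i \<in> {..<m} \<times> {..<k}" "j \<in> {..<m} \<times> {..<k}" for i j
    proof -
      obtain A L B G where ij: "i = (A, L)" "j = (B, G)" "A < m" "L < k" "B < m" "G < k" using \<open>i \<in> _\<close> \<open>j \<in> _\<close> by auto
      have "\<bar>tilt n k m l F t i j\<bar> \<le> (\<Sum>b\<in>{l..<n}. e * K)"
        unfolding tilt_def ij prod.case
      proof (rule order_trans[OF sum_abs sum_mono])
        fix b assume b: "b \<in> {l..<n}"
        have "Cb b L \<in> chartC n m l" using b ij kl by (simp add: chartC_def)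
        then have "\<bar>t (Cb b L)\<bar> < e" using t t0 by (auto simp: box_nbhd_def)
        moreover have "\<bar>partial (CQ B G) (F A b) ?w\<bar> \<le> K"
          using bnd[rule_format, of "(A, b, B, G)", OF _ w(2)] b ij kl by simp
        ultimately show "\<bar>t (Cb b L) * partial (CQ B G) (F A b) ?w\<bar> \<le> e * K"
          by (simp add: abs_mult mult_mono)
      qed
      also have "\<dots> = real (n - l) * (e * K)" by simp
      also have "\<dots> \<le> T" unfolding T_def by (rule mult_right_mono) (use e K in auto)
      finally show ?thesis .
    qed
    have "real (m * k) * T \<le> 1 / 3"
    proof -
      have "3 * (real (m * k) * T) = e * (3 * real (m * k) * real n * K)" by (simp add: T_def)
      also have "\<dots> \<le> e * N"
      proof (rule mult_left_mono)
        have "3 * real (m * k) * real n * K \<le> 3 * real (m * k) * real n * (K + 1)"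
          by (rule mult_left_mono) auto
        then show "3 * real (m * k) * real n * K \<le> N" by (simp add: N_def)
      qed (use e in simp)
      also have "\<dots> \<le> 1" using e(4) N by (simp add: pos_le_divide_eq)
      finally show ?thesis by simp
    qed
    then have S: "(\<Sum>j\<in>{..<m} \<times> {..<k}. f j) \<le> 1 / 3" if "\<And>j. j \<in> {..<m} \<times> {..<k} \<Longrightarrow> f j \<le> T" for f :: "nat \<times> nat \<Rightarrow> real"
      using sum_bounded_above[of "{..<m} \<times> {..<k}" f T] that by (simp add: card_cartesian_product)
    have "tilted_element n k m l F t"
    proof
      show "supp_on (chartC n m l) t" using t by (simp add: box_nbhd_def)
      fix i assume i: "i \<in> {..<m} \<times> {..<k}"
      show "(\<Sum>j\<in>{..<m} \<times> {..<k}. \<bar>tilt n k m l F t i j\<bar>) \<le> 1 / 3"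
        by (rule S) (rule Mb[OF i])
      show "(\<Sum>j\<in>{..<m} \<times> {..<k}. \<bar>tilt n k m l F t j i\<bar>) \<le> 1 / 3"
        by (rule S) (rule Mb[OF _ i])
    qed (fact kn kl ln)+
    then show ?thesis using w(1) e1(2) by blast
  qed
  then show ?thesis using e(1) by blast
qed

theorem theorem6p1:
  fixes n k m l :: nat and F :: rhs and U :: "(coord \<Rightarrow> real) set" and t0 :: "xcoord \<Rightarrow> real"
  assumes "1 \<le> k" and "k < n" and "1 \<le> m" and "k \<le> l" and "l \<le> n"
    and "open_coords (Dset n k m) U"
    and "\<forall>A<m. \<forall>\<alpha>\<in>{k..<n}. \<forall>w\<in>U. analytic_at (Dset n k m) (F A \<alpha>) w"
    and "\<forall>w\<in>U. approx_solvable n k m F w"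
    and "supp_on (chartC n m l) t0"
    and "\<forall>b a. t0 (Cb b a) = 0"
    and "projD n k m (zpart t0) \<in> U"
    and "\<forall>A<m. \<forall>\<alpha>\<in>{k..<n}. zpart t0 (CQ A \<alpha>) = F A \<alpha> (projD n k m (zpart t0))"
    and "integral_element n k m F U (zpart t0) (Espan n l t0)"
  shows "\<exists>e>0. \<forall>t\<in>box_nbhd (chartC n m l) t0 e.
           integral_element n k m F U (zpart t) (Espan n l t) \<longrightarrow> kahler_regular n k m l F U t"
proof -
  let ?C = "chartC n m l" and ?G = "gen_set n k m l" and ?f = "gen_fun n k m l F"
  let ?IE = "\<lambda>t. integral_element n k m F U (zpart t) (Espan n l t)"
  let ?H = "\<lambda>t. Hpolar n k m F (zpart t) (Espan n l t)"
  obtain e where e: "e > 0"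
    and near: "\<forall>t\<in>box_nbhd ?C t0 e. tilted_element n k m l F t \<and> projD n k m (zpart t) \<in> U"
    using tilted_element_near[OF assms(2,4,5,6,7,10,11)] by blast
  have F: "analytic_at (Dset n k m) (F A \<alpha>) (projD n k m (zpart t))"
    if "t \<in> box_nbhd ?C t0 e" "A < m" "k \<le> \<alpha>" "\<alpha> < n" for t A \<alpha>
    using near assms(7,8) that by auto
  have sol: "approx_solvable n k m F (projD n k m (zpart t))" if "t \<in> box_nbhd ?C t0 e" for t
    using near assms(8) that by blast
  have gz: "\<forall>\<iota>\<in>?G. ?f \<iota> t = 0" if "?IE t" for t
    using integral_element_imp_Fam_zero[OF that] gen_fun_in_Fam[OF assms(4), of n m F] by blast
  have H: "\<exists>g. integral_frame n k m F (zpart t) g \<and> ?H t = frame_span n g"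
    if t: "t \<in> box_nbhd ?C t0 e" and ie: "?IE t" for t
  proof -
    interpret tilted_element n k m l F t using near t by blast
    obtain g where g: "integral_frame n k m F (zpart t) g"
      "\<forall>a<l. ebasis n l t a = (\<lambda>c. \<Sum>i<n. ebasis n l t a (CX i) * g i c)"
      by (rule integral_plane_exists[OF F[OF t] sol[OF t] gz[OF ie]])
    then show ?thesis using Hpolar_eq_frame_span[OF g] by blast
  qed
  have dim: "vdim (?H t) = vdim (?H t')"
    if tt: "t \<in> box_nbhd ?C t0 e" "?IE t" "t' \<in> box_nbhd ?C t0 e" "?IE t'" for t t'
  proof -
    obtain g where g: "integral_frame n k m F (zpart t) g" "?H t = frame_span n g"
      using H[OF tt(1,2)] by blast
    obtain g' where g': "integral_frame n k m F (zpart t') g'" "?H t' = frame_span n g'"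
      using H[OF tt(3,4)] by blast
    have "vdim (frame_span n g) = vdim (frame_span n g')"
      by (rule vdim_frame_span_eq) (use g(1) g'(1) in \<open>auto simp: integral_frame_def\<close>)
    then show ?thesis using g g' by simp
  qed
  \<comment> \<open>Ordinariness and constancy of the dimension are local conditions around
    \<open>t\<close>, so \<open>t\<close> is kept within e/2 of \<open>t0\<close> to leave a whole
    box around it in which solvability and the tilt bounds persist.\<close>
  have half: "box_nbhd ?C t (e / 2) \<subseteq> box_nbhd ?C t0 e" if "t \<in> box_nbhd ?C t0 (e / 2)" for t
  proof
    fix t' assume t': "t' \<in> box_nbhd ?C t (e / 2)"
    have "\<bar>t' i - t0 i\<bar> < e" if i: "i \<in> ?C" for i
    proof -
      have "\<bar>t' i - t i\<bar> < e / 2" "\<bar>t i - t0 i\<bar> < e / 2"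
        using t' \<open>t \<in> box_nbhd ?C t0 (e / 2)\<close> i by (simp_all add: box_nbhd_def)
      then show ?thesis by linarith
    qed
    then show "t' \<in> box_nbhd ?C t0 e" using t' by (simp add: box_nbhd_def)
  qed
  have "kahler_regular n k m l F U t" if t: "t \<in> box_nbhd ?C t0 (e / 2)" and ie: "?IE t" for t
  proof -
    have te: "t \<in> box_nbhd ?C t0 e" using t box_nbhd_mono[of "e / 2" e] e by auto
    interpret tilted_element n k m l F t using near te by blast
    have "ordinary_zero ?C (Fam n k m l F) t"
    proof (rule ordinary_zeroI[where f = ?f and I = ?G and e = "e / 2"])
      show "\<forall>h\<in>Fam n k m l F. h t = 0" by (rule integral_element_imp_Fam_zero[OF ie])
      show "finite ?G" by (rule finite_gen_set)
      show "?f ` ?G \<subseteq> Fam n k m l F" by (rule gen_fun_in_Fam[OF assms(4)])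
      show "\<forall>\<iota>\<in>?G. \<mu> \<iota> = 0" if "\<forall>c\<in>?C. (\<Sum>\<iota>\<in>?G. \<mu> \<iota> * partial c (?f \<iota>) t) = 0" for \<mu>
        by (rule gen_fun_differentials_independent[OF that])
      show "e / 2 > 0" using e by simp
      fix t' assume t': "t' \<in> box_nbhd ?C t (e / 2)" and z: "\<forall>\<iota>\<in>?G. ?f \<iota> t' = 0"
      have t'e: "t' \<in> box_nbhd ?C t0 e" using half[OF t] t' by blast
      have til: "tilted_element n k m l F t'" using near t'e by blast
      show "\<forall>h\<in>Fam n k m l F. h t' = 0"
        by (rule tilted_element.Fam_zero_of_gen_set[OF til F[OF t'e] sol[OF t'e] z])
    qed
    then have "kahler_ordinary n k m l F U t" using ie by (simp add: kahler_ordinary_def)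
    moreover have "vdim (?H t') = vdim (?H t)" if "t' \<in> box_nbhd ?C t (e / 2)" "?IE t'" for t'
      using dim[of t' t] half[OF t] te ie that by blast
    ultimately show ?thesis unfolding kahler_regular_def using e
      by (intro conjI exI[of _ "e / 2"]) auto
  qed
  then show ?thesis using e by (intro exI[of _ "e / 2"]) auto
qed

end
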